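(* There exist $\eta>0$ and $\mu_0>0$ such that, for any $\mu\in(0,\mu_0)$ and any energy $h\in(-\eta\mu,\eta\mu)$, one can find a sequence of ejection-collision orbits $\{z_k(t)\}_{k\in\mathbb N}$, $z_k(t)=(q_k(t),p_k(t))$, in the energy level $\mathcal H(q,p;\mu)=h$ such that $$\limsup_{k\to\infty}\Big(\sup_{t}\|q_k(t)\|\Big)=+\infty,$$ where the supremum is over all $t$ in the interval of definition of $z_k$ (between its ejection and its collision).
   Context: The planar circular restricted three-body problem with mass ratio $\mu\in(0,1/2]$, in rotating coordinates $(q,p)\in\mathbb R^2\times\mathbb R^2$, is the Hamiltonian system $\dot q=\partial_p\mathcal H$, $\dot p=-\partial_q\mathcal H$ of $$\mathcal H(q,p;\mu)=\frac{\|p\|^2}{2}-q_1p_2+q_2p_1-\frac{1-\mu}{\|q+(\mu,0)\|}-\frac{\mu}{\|q-(1-\mu,0)\|}.$$ The Sun is the primary at $(-\mu,0)$. An orbit $(q(t),p(t))$ is an ejection orbit (from the Sun) if there is $t_0\in\mathbb R$ with $\lim_{t\to t_0^+}q(t)=(-\mu,0)$; a collision orbit (to the Sun) if there is $t_1\in\mathbb R$ with $\lim_{t\to t_1^-}q(t)=(-\mu,0)$; an ejection-collision orbit if it is both (so it is defined on $(t_0,t_1)$). *)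

theory Defs
  imports "HOL-Analysis.Analysis"
begin

definition sun :: "real \<Rightarrow> real^2" where
  "sun \<mu> = vector [- \<mu>, 0]"

definition planet :: "real \<Rightarrow> real^2" where
  "planet \<mu> = vector [1 - \<mu>, 0]"

text \<open>The value at a collision with a primary is meaningless, because division by zero is total;
  orbits are therefore required below to avoid both primaries.\<close>

definition hamiltonian :: "real \<Rightarrow> real^2 \<Rightarrow> real^2 \<Rightarrow> real" where
  "hamiltonian \<mu> q p =
     (norm p)\<^sup>2 / 2 - q $ 1 * p $ 2 + q $ 2 * p $ 1
       - (1 - \<mu>) / norm (q - sun \<mu>) - \<mu> / norm (q - planet \<mu>)"

definition partials :: "(real^2 \<Rightarrow> real) \<Rightarrow> real^2 \<Rightarrow> real^2" where
  "partials f x = (\<chi> i. deriv (\<lambda>s. f (x + s *\<^sub>R axis i 1)) 0)"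

definition orbit_on :: "real \<Rightarrow> real set \<Rightarrow> (real \<Rightarrow> real^2) \<Rightarrow> (real \<Rightarrow> real^2) \<Rightarrow> bool" where
  "orbit_on \<mu> I q p \<longleftrightarrow>
     (\<forall>t\<in>I. q t \<noteq> sun \<mu> \<and> q t \<noteq> planet \<mu> \<and>
        (q has_vector_derivative partials (\<lambda>y. hamiltonian \<mu> (q t) y) (p t)) (at t) \<and>
        (p has_vector_derivative - partials (\<lambda>x. hamiltonian \<mu> x (p t)) (q t)) (at t))"

text \<open>Ejection from and collision to the Sun. The times of ejection and collision are parameters, since they
  delimit the interval of definition of the orbit; the values of \<open>q\<close> and \<open>p\<close> outside it are irrelevant.\<close>

definition ejection_collision_orbit ::
    "real \<Rightarrow> real \<Rightarrow> real \<Rightarrow> (real \<Rightarrow> real^2) \<Rightarrow> (real \<Rightarrow> real^2) \<Rightarrow> bool" where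
  "ejection_collision_orbit \<mu> t0 t1 q p \<longleftrightarrow>
     t0 < t1 \<and> orbit_on \<mu> {t0<..<t1} q p \<and>
     (q \<longlongrightarrow> sun \<mu>) (at_right t0) \<and> (q \<longlongrightarrow> sun \<mu>) (at_left t1)"

end

theory Submission
  imports Defs
begin

text \<open>The flow is reversed by \<open>(q, p, t) \<mapsto> (cnj q, - cnj p, - t)\<close>, so an ejection orbit that has an
  apocentre on the axis through the primaries is its own mirror image and ends in a collision. Ejection orbits at
  energy \<open>h\<close> form a one-parameter family, and \<open>h + G\<close> (with \<open>G\<close> the angular momentum) is their energy in the inertial
  frame. At first order in \<open>\<mu>\<close> the planet changes \<open>G\<close> by \<open>\<mu>\<close> times the derivative of a potential that has a logarithmic
  singularity at the orbit that hits the planet, so this kick takes large values of both signs: some of the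
  ejection orbits are elliptic after passing the planet and some escape. At the boundary between the two kinds
  the time to apocentre, hence also its distance, tends to infinity, and since the frame rotates the angle of the
  apocentre tends to \<open>- \<infinity>\<close>; by the intermediate value theorem it passes through infinitely many multiples of \<open>pi\<close>.\<close>

section \<open>Flows of globally Lipschitz fields\<close>

text \<open>The kick is of order \<open>\<mu>\<close>, so the energies must be too, and an
  approximation with error below the kick is needed over unbounded times. Near the primaries the
  angular momentum is carried along divided by \<open>\<mu>\<close>; at \<open>\<mu> = 0\<close>
  that component is the kick itself, so plain continuous dependence on initial data replaces an
  expansion in \<open>\<mu>\<close>. The parameter \<open>\<beta>\<close> stays in a compact
  interval on which the unperturbed orbits miss the planet, which makes \<open>\<mu>0\<close>
  uniform. Beyond distance about 8 the torque is at most \<open>8 * \<mu>\<close> times the radial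
  deceleration, and the radial momentum starts below 1, so the angular momentum drifts by at most
  \<open>8 * \<mu>\<close> however long the leg lasts. In units of \<open>\<mu>\<close> the budget
  is: a kick of 30, less 11 for the comparison at the matching point, less 1 for \<open>h\<close>,
  leaves 18; a margin of 17 is asked for, of which the drift can consume 8. Both legs are first
  solved for fields cut off so as to be globally Lipschitz, which gives global existence and
  continuous dependence at once; the estimates then show that the cut-offs are inactive.\<close>

lemma solutions_dist:
  fixes F :: "'a::euclidean_space \<Rightarrow> 'a"
  assumes lip: "L-lipschitz_on UNIV F"
    and x: "\<And>t. t \<in> {0..S} \<Longrightarrow> (x has_vector_derivative F (x t)) (at t within {0..S})"
    and y: "\<And>t. t \<in> {0..S} \<Longrightarrow> (y has_vector_derivative F (y t)) (at t within {0..S})"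
    and t: "t \<in> {0..S}"
  shows "dist (x t) (y t) \<le> exp (L * t) * dist (x 0) (y 0)"
proof -
  \<comment> \<open>Gronwall without an integral inequality: the Lipschitz bound makes the
    discounted squared distance \<open>e\<close> nonincreasing.\<close>
  define e where "e t = exp (- 2 * L * t) * ((x t - y t) \<bullet> (x t - y t))" for t
  have e': "(e has_real_derivative exp (- 2 * L * t) *
      (2 * ((x t - y t) \<bullet> (F (x t) - F (y t))) - 2 * L * ((x t - y t) \<bullet> (x t - y t)))) (at t within {0..S})"
    if "t \<in> {0..S}" for t
  proof -
    have "((\<lambda>t. x t - y t) has_vector_derivative (F (x t) - F (y t))) (at t within {0..S})"
      using x y that by (auto intro: has_vector_derivative_diff)
    then have "((\<lambda>t. x t - y t) has_derivative (\<lambda>s. s *\<^sub>R (F (x t) - F (y t)))) (at t within {0..S})"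
      by (simp add: has_vector_derivative_def)
    from has_derivative_inner[OF this this]
    have "((\<lambda>t. (x t - y t) \<bullet> (x t - y t)) has_real_derivative 2 * ((x t - y t) \<bullet> (F (x t) - F (y t)))) (at t within {0..S})"
      by (simp add: has_field_derivative_def mult.commute[of _ "2::real"] inner_commute algebra_simps)
         (erule has_derivative_eq_rhs, auto simp: algebra_simps inner_commute)
    moreover have "((\<lambda>t. exp (- 2 * L * t)) has_real_derivative exp (- 2 * L * t) * (- 2 * L)) (at t within {0..S})"
      by (auto intro!: derivative_eq_intros)
    ultimately have "(e has_real_derivative exp (- 2 * L * t) * (2 * ((x t - y t) \<bullet> (F (x t) - F (y t)))) +
        exp (- 2 * L * t) * (- 2 * L) * ((x t - y t) \<bullet> (x t - y t))) (at t within {0..S})"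
      unfolding e_def[abs_def] by (intro DERIV_cong[OF DERIV_mult]) (auto simp: algebra_simps)
    then show ?thesis by (rule DERIV_cong) (simp add: algebra_simps)
  qed
  have neg: "(x t - y t) \<bullet> (F (x t) - F (y t)) \<le> L * ((x t - y t) \<bullet> (x t - y t))" for t
  proof -
    have "(x t - y t) \<bullet> (F (x t) - F (y t)) \<le> norm (x t - y t) * norm (F (x t) - F (y t))"
      by (rule norm_cauchy_schwarz)
    also have "\<dots> \<le> norm (x t - y t) * (L * norm (x t - y t))"
      using lipschitz_onD[OF lip, of "x t" "y t"] by (intro mult_left_mono) (auto simp: dist_norm)
    finally show ?thesis by (simp add: dot_square_norm power2_eq_square algebra_simps)
  qed
  have "e t \<le> e 0"
  proof (rule ccontr)
    assume "\<not> e t \<le> e 0"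
    moreover have "0 < t" using t calculation by (cases "t = 0") auto
    ultimately have lt: "e 0 < e t" "0 < t" by auto
    have "\<exists>z\<in>{0<..<t}. e t - e 0 = (t - 0) * (exp (- 2 * L * z) *
      (2 * ((x z - y z) \<bullet> (F (x z) - F (y z))) - 2 * L * ((x z - y z) \<bullet> (x z - y z))))"
    proof -
      have "\<exists>z\<in>{0<..<t}. e t - e 0 = (\<lambda>s. s * (exp (- 2 * L * z) *
      (2 * ((x z - y z) \<bullet> (F (x z) - F (y z))) - 2 * L * ((x z - y z) \<bullet> (x z - y z))))) (t - 0)"
      proof (rule mvt_simple[OF \<open>0<t\<close>])
        fix z assume "0 \<le> z" "z \<le> t"
        then show "(e has_derivative (\<lambda>s. s * (exp (- 2 * L * z) *
      (2 * ((x z - y z) \<bullet> (F (x z) - F (y z))) - 2 * L * ((x z - y z) \<bullet> (x z - y z)))))) (at z within {0..t})"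
          using has_field_derivative_subset[OF e'[of z], of "{0..t}"] t
          by (simp add: has_field_derivative_def mult_commute_abs)
      qed
      then show ?thesis by simp
    qed
    then obtain z where "e t - e 0 = t * (exp (- 2 * L * z) *
      (2 * ((x z - y z) \<bullet> (F (x z) - F (y z))) - 2 * L * ((x z - y z) \<bullet> (x z - y z))))" by auto
    moreover have "exp (- 2 * L * z) *
      (2 * ((x z - y z) \<bullet> (F (x z) - F (y z))) - 2 * L * ((x z - y z) \<bullet> (x z - y z))) \<le> 0"
      using neg[of z] by (intro mult_nonneg_nonpos) auto
    ultimately have "e t - e 0 \<le> 0" using \<open>0<t\<close> by (simp add: mult_nonneg_nonpos)
    then show False using lt by simp
  qed
  then have "exp (- 2 * L * t) * (dist (x t) (y t))^2 \<le> (dist (x 0) (y 0))^2"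
    by (simp add: e_def dist_norm dot_square_norm)
  then have "exp (2 * L * t) * (exp (- 2 * L * t) * (dist (x t) (y t))^2) \<le> exp (2 * L * t) * (dist (x 0) (y 0))^2"
    by (intro mult_left_mono) auto
  then have "(dist (x t) (y t))^2 \<le> (exp (L * t) * dist (x 0) (y 0))^2"
    by (simp add: mult.assoc[symmetric] exp_add[symmetric] power_mult_distrib exp_double[symmetric])
  then show ?thesis by (rule power2_le_imp_le) auto
qed

lemma integral_exp_le:
  fixes a :: real assumes "a > 0" "0 \<le> t"
  shows "integral {0..t} (\<lambda>s. exp (a * s)) \<le> exp (a * t) / a" "(\<lambda>s. exp (a * s)) integrable_on {0..t}"
proof -
  have "((\<lambda>s. exp (a * s)) has_integral (exp (a * t) / a - exp (a * 0) / a)) {0..t}"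
    using assms by (intro fundamental_theorem_of_calculus)
      (auto intro!: derivative_eq_intros simp: has_real_derivative_iff_has_vector_derivative[symmetric])
  then show "integral {0..t} (\<lambda>s. exp (a * s)) \<le> exp (a * t) / a" "(\<lambda>s. exp (a * s)) integrable_on {0..t}"
    using assms by (auto simp: integral_unique has_integral_integrable)
qed

text \<open>Picard iteration in an exponentially weighted sup norm, so that one fixed point covers
  the whole half-line. The unknown \<open>y\<close> is the displacement from \<open>x0\<close>
  multiplied by \<open>exp (- 2 * M * t)\<close>, and the weight makes the contraction constant
  \<open>L / (2 * M)\<close>.\<close>

lemma global_solution:
  fixes F :: "'a::euclidean_space \<Rightarrow> 'a"
  assumes lip: "L-lipschitz_on UNIV F"
  shows "\<exists>x. x 0 = x0 \<and> (\<forall>t\<ge>0. (x has_vector_derivative F (x t)) (at t within {0..}))"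
proof -
  \<comment> \<open>Adding 1 keeps the weight exponent positive when \<open>L = 0\<close>.\<close>
  define M where "M = L + 1"
  have L0: "0 \<le> L" using lip by (rule lipschitz_on_nonneg)
  then have M: "M > 0" "L \<le> M" by (auto simp: M_def)
  have Fc: "continuous_on A F" for A
    by (rule continuous_on_subset[OF lipschitz_on_continuous_on[OF lip]]) auto
  \<comment> \<open>Bounded continuous functions live on the whole line, so negative times are
    projected to 0.\<close>
  define p where "p t = max t 0" for t :: real
  have p: "p t \<ge> 0" for t by (auto simp: p_def)
  have pc: "continuous_on UNIV p" unfolding p_def by (intro continuous_intros)
  define g where "g y s = F (x0 + exp (2 * M * s) *\<^sub>R apply_bcontfun y s)" for y :: "real \<Rightarrow>\<^sub>C 'a" and s
  have gc: "continuous_on A (g y)" for y A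
    unfolding g_def by (intro continuous_intros continuous_on_compose2[OF Fc[of UNIV]]) auto
  have gi: "g y integrable_on {0..t}" for y t by (rule integrable_continuous_real[OF gc])
  define J where "J y t = integral {0..t} (g y)" for y t
  have Jf: "J y = (\<lambda>u. integral {0..u} (g y))" for y by (simp add: fun_eq_iff J_def)
  have J': "(J y has_vector_derivative g y t) (at t within {0..})" if "t \<ge> 0" for t y
  proof -
    have "((\<lambda>u. integral {0..u} (g y)) has_vector_derivative g y t) (at t within {0..t+1})"
      using that by (intro integral_has_vector_derivative gc) auto
    moreover have "at t within {0..t+1} = at t within {0..}"
      using that by (intro at_within_nhd[of _ "{t-1<..<t+1}"]) auto
    ultimately show ?thesis unfolding Jf by simp
  qed
  have Jc: "continuous_on {0..} (J y)" for y
    using J' by (auto intro!: has_vector_derivative_continuous simp: continuous_on_eq_continuous_within)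
  define T where "T y t = exp (- 2 * M * p t) *\<^sub>R J y (p t)" for y t
  have Tc: "continuous_on UNIV (T y)" for y
    unfolding T_def by (intro continuous_intros pc continuous_on_compose2[OF Jc pc]) (auto simp: p)
  have bd: "norm (exp (- 2 * M * t) *\<^sub>R integral {0..t} f) \<le> C / (2 * M)"
    if "t \<ge> 0" "\<And>s. s \<in> {0..t} \<Longrightarrow> norm (f s) \<le> C * exp (2 * M * s)" "f integrable_on {0..t}" "C \<ge> 0"
    for f :: "real \<Rightarrow> 'a" and t C
  proof -
    have "norm (integral {0..t} f) \<le> integral {0..t} (\<lambda>s. C * exp (2 * M * s))"
      using that M integral_exp_le(2)[of "2*M" t]
      by (intro integral_norm_bound_integral integrable_on_mult_right) auto
    also have "\<dots> \<le> C * (exp (2 * M * t) / (2 * M))"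
      using mult_left_mono[OF integral_exp_le(1)[of "2*M" t], of C] that M by simp
    finally have "exp (- 2 * M * t) * norm (integral {0..t} f) \<le> exp (- 2 * M * t) * (C * (exp (2 * M * t) / (2 * M)))"
      by (intro mult_left_mono) auto
    also have "\<dots> = (exp (- 2 * M * t) * exp (2 * M * t)) * (C / (2 * M))" by simp
    also have "exp (- 2 * M * t) * exp (2 * M * t) = 1" by (simp add: exp_add[symmetric])
    finally show ?thesis by simp
  qed
  have yb: "norm (apply_bcontfun y s) \<le> norm y" for y :: "real \<Rightarrow>\<^sub>C 'a" and s by (rule norm_bounded)
  have Tb: "norm (T y t) \<le> (norm (F x0) + L * norm y) / (2 * M)" for y t
    unfolding T_def J_def
  proof (rule bd[OF p _ gi])
    fix s assume s: "s \<in> {0..p t}"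
    have "norm (g y s) \<le> norm (F x0) + norm (g y s - F x0)" by (metis add.commute diff_add_cancel norm_triangle_ineq)
    also have "norm (g y s - F x0) \<le> L * (exp (2 * M * s) * norm (apply_bcontfun y s))"
      using lipschitz_onD[OF lip, of "x0 + exp (2 * M * s) *\<^sub>R apply_bcontfun y s" x0]
      by (simp add: g_def dist_norm)
    also have "\<dots> \<le> L * (exp (2 * M * s) * norm y)"
      using L0 yb by (intro mult_left_mono) auto
    also have "norm (F x0) \<le> norm (F x0) * exp (2 * M * s)"
      using s M mult_left_mono[of 1 "exp (2 * M * s)" "norm (F x0)"] by simp
    finally show "norm (g y s) \<le> (norm (F x0) + L * norm y) * exp (2 * M * s)"
      by (simp add: algebra_simps)
  qed (use L0 in auto)
  have Tin: "T y \<in> bcontfun" for y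
    using Tc Tb by (auto simp: bcontfun_def bounded_iff)
  define TT where "TT y = Bcontfun (T y)" for y
  have TT: "apply_bcontfun (TT y) = T y" for y unfolding TT_def using Tin by (rule Bcontfun_inverse)
  have "\<exists>!y. TT y = y"
  proof (rule banach_fix_type[where c = "1/2"])
    show "\<forall>y. \<forall>z. dist (TT y) (TT z) \<le> 1 / 2 * dist y z"
    proof (intro allI dist_bound)
      fix y z :: "real \<Rightarrow>\<^sub>C 'a" and t
      have "norm (exp (- 2 * M * p t) *\<^sub>R integral {0..p t} (\<lambda>s. g y s - g z s)) \<le> (L * dist y z) / (2 * M)"
      proof (rule bd[OF p])
        show "(\<lambda>s. g y s - g z s) integrable_on {0..p t}" by (intro integrable_diff gi)
        fix s assume "s \<in> {0..p t}"
        have "norm (g y s - g z s) \<le> L * (exp (2 * M * s) * dist (apply_bcontfun y s) (apply_bcontfun z s))"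
          using lipschitz_onD[OF lip, of "x0 + exp (2 * M * s) *\<^sub>R apply_bcontfun y s" "x0 + exp (2 * M * s) *\<^sub>R apply_bcontfun z s"]
          by (simp add: g_def dist_norm scaleR_diff_right[symmetric])
        also have "\<dots> \<le> L * (exp (2 * M * s) * dist y z)"
          using L0 by (intro mult_left_mono) (auto simp: dist_bounded)
        finally show "norm (g y s - g z s) \<le> L * dist y z * exp (2 * M * s)" by (simp add: algebra_simps)
      qed (use L0 in auto)
      also have "\<dots> \<le> 1 / 2 * dist y z" using M by (simp add: field_simps mult_right_mono)
      finally show "dist (apply_bcontfun (TT y) t) (apply_bcontfun (TT z) t) \<le> 1 / 2 * dist y z"
        by (simp add: TT T_def J_def dist_norm scaleR_diff_right[symmetric] integral_diff gi)
    qed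
  qed auto
  then obtain y where y: "TT y = y" by auto
  define x where "x t = x0 + J y t" for t
  have "g y t = F (x t)" if "t \<ge> 0" for t
  proof -
    have "apply_bcontfun y t = exp (- 2 * M * t) *\<^sub>R J y t"
      using arg_cong[OF y, of "\<lambda>y. apply_bcontfun y t"] that by (simp add: TT T_def p_def)
    then show ?thesis by (simp add: g_def x_def exp_add[symmetric])
  qed
  then have "x 0 = x0 \<and> (\<forall>t\<ge>0. (x has_vector_derivative F (x t)) (at t within {0..}))"
    using J'[of _ y] by (auto simp: x_def[abs_def] J_def[of y 0] intro!: derivative_eq_intros)
  then show ?thesis by blast
qed

section \<open>Bounded Lipschitz functions\<close>

definition lip :: "('a::metric_space \<Rightarrow> 'b::metric_space) \<Rightarrow> bool" where
  "lip f \<longleftrightarrow> (\<exists>L. L-lipschitz_on UNIV f)"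

text \<open>Products of Lipschitz functions are Lipschitz only if the factors are bounded. The
  bounded ones form an algebra, so the clamped fields can be handled by structural rules.\<close>

definition bdd_lip :: "('a::metric_space \<Rightarrow> 'b::real_normed_vector) \<Rightarrow> bool" where
  "bdd_lip f \<longleftrightarrow> lip f \<and> bounded (range f)"

lemma bdd_lipI: "lip f \<Longrightarrow> (\<And>x. norm (f x) \<le> B) \<Longrightarrow> bdd_lip f"
  by (auto simp: bdd_lip_def bounded_iff)

lemma bdd_lipE:
  assumes "bdd_lip f"
  obtains L B where "L-lipschitz_on UNIV f" "\<And>x. norm (f x) \<le> B"
  using assms by (auto simp: bdd_lip_def lip_def bounded_iff)

lemma lip_compose: "lip g \<Longrightarrow> lip f \<Longrightarrow> lip (\<lambda>x. g (f x))"
  unfolding lip_def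
proof (elim exE)
  fix L M assume "L-lipschitz_on UNIV g" "M-lipschitz_on UNIV f"
  then show "\<exists>L. L-lipschitz_on UNIV (\<lambda>x. g (f x))"
    using lipschitz_on_compose2[of M UNIV f L g] lipschitz_on_subset by blast
qed

lemma lip_bounded_linear: "bounded_linear g \<Longrightarrow> lip f \<Longrightarrow> lip (\<lambda>x. g (f x))"
  by (rule lip_compose) (auto simp: lip_def intro: bounded_linear.lipschitz_boundE)

text \<open>Handles compositions such as \<open>sqrt\<close> and the reciprocal, which are Lipschitz
  only on the range of \<open>f\<close>.\<close>

lemma lip_1:
  assumes "lip f" and "\<And>x y. dist (g x) (g y) \<le> dist (f x) (f y) * K" and "0 \<le> K"
  shows "lip g"
proof -
  obtain L where L: "L-lipschitz_on UNIV f" using assms by (auto simp: lip_def)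
  have "(L * K)-lipschitz_on UNIV g"
  proof (rule lipschitz_onI)
    fix x y
    have "dist (g x) (g y) \<le> dist (f x) (f y) * K" by fact
    also have "\<dots> \<le> (L * dist x y) * K" using lipschitz_onD[OF L] assms by (intro mult_right_mono) auto
    finally show "dist (g x) (g y) \<le> L * K * dist x y" by (simp add: mult.commute mult.left_commute)
  qed (use lipschitz_on_nonneg[OF L] assms in auto)
  then show ?thesis by (auto simp: lip_def)
qed

lemma lip_id: "lip (\<lambda>x. x)" unfolding lip_def by (rule exI[of _ 1]) (auto simp: lipschitz_on_def)
lemma lip_fst: "lip f \<Longrightarrow> lip (\<lambda>x. fst (f x))"
  by (rule lip_1[of f _ 1]) (auto intro: dist_fst_le)
lemma lip_snd: "lip f \<Longrightarrow> lip (\<lambda>x. snd (f x))"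
  by (rule lip_1[of f _ 1]) (auto intro: dist_snd_le)
lemma lip_Re: "lip f \<Longrightarrow> lip (\<lambda>x. Re (f x))" by (rule lip_bounded_linear[OF bounded_linear_Re])
lemma lip_Im: "lip f \<Longrightarrow> lip (\<lambda>x. Im (f x))" by (rule lip_bounded_linear[OF bounded_linear_Im])

lemma lip_max: "lip f \<Longrightarrow> lip (\<lambda>x. max c (f x))" for f :: "_ \<Rightarrow> real"
  by (erule lip_1[where K = 1]) (auto simp: dist_real_def max_def)

definition clamp_abs :: "real \<Rightarrow> real \<Rightarrow> real" where "clamp_abs N x = max (- N) (min N x)"

lemma clamp_abs_eq: "\<bar>x\<bar> \<le> N \<Longrightarrow> clamp_abs N x = x" by (auto simp: clamp_abs_def)
lemma clamp_abs_le: "0 \<le> N \<Longrightarrow> \<bar>clamp_abs N x\<bar> \<le> N" by (auto simp: clamp_abs_def)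

lemma bdd_lip_clamp_abs: "lip f \<Longrightarrow> 0 \<le> N \<Longrightarrow> bdd_lip (\<lambda>x. clamp_abs N (f x))"
  by (rule bdd_lipI[where B = N], erule lip_1[where K = 1])
     (auto simp: dist_real_def clamp_abs_def max_def min_def)

lemma bdd_lip_lip: "bdd_lip f \<Longrightarrow> lip f" by (simp add: bdd_lip_def)

lemma bdd_lip_const: "bdd_lip (\<lambda>x. c)"
  by (rule bdd_lipI[where B = "norm c"]) (auto simp: lip_def lipschitz_on_def intro!: exI[of _ 0])

lemma bdd_lip_add:
  assumes "bdd_lip f" "bdd_lip g" shows "bdd_lip (\<lambda>x. f x + g x)"
proof -
  obtain L B where f: "L-lipschitz_on UNIV f" "\<And>x. norm (f x) \<le> B" using assms(1) by (rule bdd_lipE) blast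
  obtain M C where g: "M-lipschitz_on UNIV g" "\<And>x. norm (g x) \<le> C" using assms(2) by (rule bdd_lipE) blast
  show ?thesis
    by (rule bdd_lipI[where B = "B + C"])
       (auto simp: lip_def intro: lipschitz_on_add[OF f(1) g(1)] norm_triangle_mono f g)
qed

lemma bdd_lip_bounded_linear:
  assumes "bounded_linear T" "bdd_lip f" shows "bdd_lip (\<lambda>x. T (f x))"
proof -
  have "bounded (T ` range f)" using assms by (auto simp: bdd_lip_def intro: bounded_linear_image)
  then show ?thesis using assms lip_bounded_linear[of T f] by (auto simp: bdd_lip_def image_image)
qed

lemma bdd_lip_minus: "bdd_lip f \<Longrightarrow> bdd_lip (\<lambda>x. - f x)"
  by (rule bdd_lip_bounded_linear[of uminus]) (auto intro: bounded_linear_minus bounded_linear_ident)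

lemma bdd_lip_diff: "bdd_lip f \<Longrightarrow> bdd_lip g \<Longrightarrow> bdd_lip (\<lambda>x. f x - g x)"
  using bdd_lip_add[of f "\<lambda>x. - g x"] bdd_lip_minus[of g] by simp

lemma bdd_lip_mult:
  fixes f g :: "'a::metric_space \<Rightarrow> 'b::real_normed_algebra"
  assumes "bdd_lip f" "bdd_lip g" shows "bdd_lip (\<lambda>x. f x * g x)"
proof -
  obtain L B where f: "L-lipschitz_on UNIV f" "\<And>x. norm (f x) \<le> B" using assms(1) by (rule bdd_lipE) blast
  obtain M C where g: "M-lipschitz_on UNIV g" "\<And>x. norm (g x) \<le> C" using assms(2) by (rule bdd_lipE) blast
  have BC: "0 \<le> B" "0 \<le> C" using f(2) g(2) norm_ge_zero order_trans by blast+
  have LM: "0 \<le> L" "0 \<le> M" using f g lipschitz_on_nonneg by auto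
  show ?thesis
  proof (rule bdd_lipI[where B = "B * C"])
    show "norm (f x * g x) \<le> B * C" for x
      by (rule order_trans[OF norm_mult_ineq]) (intro mult_mono f g BC norm_ge_zero)
    have "(B * M + L * C)-lipschitz_on UNIV (\<lambda>x. f x * g x)"
    proof (rule lipschitz_onI)
      fix x y
      have "f x * g x - f y * g y = f x * (g x - g y) + (f x - f y) * g y" by (simp add: algebra_simps)
      then have "norm (f x * g x - f y * g y) \<le> norm (f x) * norm (g x - g y) + norm (f x - f y) * norm (g y)"
        by (metis norm_triangle_mono norm_mult_ineq)
      also have "\<dots> \<le> B * (M * dist x y) + (L * dist x y) * C"
        using f g BC LM lipschitz_onD[OF f(1), of x y] lipschitz_onD[OF g(1), of x y]
        by (intro add_mono mult_mono) (auto simp: dist_norm)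
      finally show "dist (f x * g x) (f y * g y) \<le> (B * M + L * C) * dist x y"
        by (simp add: dist_norm algebra_simps)
    qed (use BC LM in auto)
    then show "lip (\<lambda>x. f x * g x)" by (auto simp: lip_def)
  qed
qed

lemma bdd_lip_power:
  fixes f :: "'a::metric_space \<Rightarrow> 'b::real_normed_algebra_1"
  assumes "bdd_lip f" shows "bdd_lip (\<lambda>x. f x ^ n)"
  by (induction n) (auto intro: bdd_lip_const bdd_lip_mult assms)

lemma bdd_lip_Pair:
  assumes "bdd_lip f" "bdd_lip g" shows "bdd_lip (\<lambda>x. (f x, g x))"
proof -
  have "(\<lambda>x. (f x, g x)) = (\<lambda>x. (f x, 0) + (0, g x))" by auto
  then show ?thesis
    by (simp only:) (intro bdd_lip_add bdd_lip_bounded_linear[OF _ assms(1)] bdd_lip_bounded_linear[OF _ assms(2)]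
      bounded_linear_Pair bounded_linear_ident bounded_linear_zero)
qed

lemma bdd_lip_complex_of_real: "bdd_lip f \<Longrightarrow> bdd_lip (\<lambda>x. complex_of_real (f x))"
  by (rule bdd_lip_bounded_linear[OF bounded_linear_of_real])
lemma bdd_lip_Re: "bdd_lip f \<Longrightarrow> bdd_lip (\<lambda>x. Re (f x))"
  by (rule bdd_lip_bounded_linear[OF bounded_linear_Re])
lemma bdd_lip_Im: "bdd_lip f \<Longrightarrow> bdd_lip (\<lambda>x. Im (f x))"
  by (rule bdd_lip_bounded_linear[OF bounded_linear_Im])
lemma bdd_lip_cnj: "bdd_lip f \<Longrightarrow> bdd_lip (\<lambda>x. cnj (f x))"
  by (rule bdd_lip_bounded_linear[OF bounded_linear_cnj])
lemma lip_norm: "lip f \<Longrightarrow> lip (\<lambda>x. norm (f x))"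
  by (erule lip_1[where K = 1]) (auto simp: dist_norm norm_triangle_ineq3)

lemma bdd_lip_inverse:
  fixes f :: "'a::metric_space \<Rightarrow> real"
  assumes "lip f" "c > 0" "\<And>x. c \<le> f x" shows "bdd_lip (\<lambda>x. 1 / f x)"
proof (rule bdd_lipI[where B = "1 / c"])
  have pos: "f x > 0" for x using assms(2) assms(3)[of x] by simp
  show "norm (1 / f x) \<le> 1 / c" for x using assms pos[of x] by (simp add: frac_le)
  show "lip (\<lambda>x. 1 / f x)"
  proof (rule lip_1[OF assms(1), where K = "1 / (c * c)"])
    fix x y
    have "dist (1 / f x) (1 / f y) = dist (f x) (f y) * (1 / (f x * f y))"
      using pos[of x] pos[of y] by (simp add: dist_real_def abs_if field_simps)
    also have "\<dots> \<le> dist (f x) (f y) * (1 / (c * c))"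
      using pos[of x] pos[of y] assms by (intro mult_left_mono divide_left_mono mult_mono mult_pos_pos) auto
    finally show "dist (1 / f x) (1 / f y) \<le> dist (f x) (f y) * (1 / (c * c))" .
  qed (use assms in auto)
qed

lemma lip_sqrt:
  fixes f :: "'a::metric_space \<Rightarrow> real"
  assumes "lip f" "c > 0" "\<And>x. c \<le> f x" shows "lip (\<lambda>x. sqrt (f x))"
proof (rule lip_1[OF assms(1), where K = "1 / (2 * sqrt c)"])
  fix x y
  have pos: "f x > 0" for x using assms(2) assms(3)[of x] by simp
  have "(sqrt (f x) - sqrt (f y)) * (sqrt (f x) + sqrt (f y)) = f x - f y"
    using pos[of x] pos[of y] by (simp add: algebra_simps)
  then have "dist (sqrt (f x)) (sqrt (f y)) * (sqrt (f x) + sqrt (f y)) = dist (f x) (f y)"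
    using pos[of x] pos[of y] by (metis abs_mult abs_of_pos dist_real_def real_sqrt_gt_zero add_pos_pos)
  moreover have "2 * sqrt c \<le> sqrt (f x) + sqrt (f y)"
    using assms(3)[of x] assms(3)[of y] real_sqrt_le_mono[of c "f x"] real_sqrt_le_mono[of c "f y"] by linarith
  then have "dist (sqrt (f x)) (sqrt (f y)) * (2 * sqrt c) \<le> dist (sqrt (f x)) (sqrt (f y)) * (sqrt (f x) + sqrt (f y))"
    by (intro mult_left_mono) auto
  ultimately show "dist (sqrt (f x)) (sqrt (f y)) \<le> dist (f x) (f y) * (1 / (2 * sqrt c))"
    using assms by (simp add: field_simps)
qed (use assms in auto)

lemma bdd_lip_cos: "lip f \<Longrightarrow> bdd_lip (\<lambda>x. cos (f x))" for f :: "_ \<Rightarrow> real"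
proof (rule bdd_lipI[where B = 1], erule lip_1[where K = 1])
  fix x y
  show "dist (cos (f x)) (cos (f y)) \<le> dist (f x) (f y) * 1"
    using field_differentiable_bound[of UNIV cos "\<lambda>x. - sin x" 1 "f x" "f y"]
    by (simp add: dist_norm DERIV_cos)
qed auto

lemma bdd_lip_sin: "lip f \<Longrightarrow> bdd_lip (\<lambda>x. sin (f x))" for f :: "_ \<Rightarrow> real"
proof (rule bdd_lipI[where B = 1], erule lip_1[where K = 1])
  fix x y
  show "dist (sin (f x)) (sin (f y)) \<le> dist (f x) (f y) * 1"
    using field_differentiable_bound[of UNIV sin "\<lambda>x. cos x" 1 "f x" "f y"]
    by (simp add: dist_norm DERIV_sin)
qed auto

lemmas bdd_lip_intros = bdd_lip_const bdd_lip_add bdd_lip_diff bdd_lip_minus bdd_lip_mult bdd_lip_power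
  bdd_lip_Pair bdd_lip_complex_of_real bdd_lip_Re bdd_lip_Im bdd_lip_cnj

section \<open>Cartesian and polar equations of motion\<close>

text \<open>The Hamiltonian under the identification of the plane with the complex numbers;
  \<open>Im (cnj q * p)\<close> is the angular momentum about the barycentre.\<close>

definition cham :: "real \<Rightarrow> complex \<Rightarrow> complex \<Rightarrow> real" where
  "cham \<mu> q p = (cmod p)^2 / 2 - Im (cnj q * p) - (1 - \<mu>) / cmod (q + of_real \<mu>) - \<mu> / cmod (q + of_real (\<mu> - 1))"

text \<open>The gradient of the gravitational potential energy, that is, minus the force.\<close>

definition attraction :: "real \<Rightarrow> complex \<Rightarrow> complex" where
  "attraction \<mu> q = of_real ((1 - \<mu>) / cmod (q + of_real \<mu>) ^ 3) * (q + of_real \<mu>)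
     + of_real (\<mu> / cmod (q + of_real (\<mu> - 1)) ^ 3) * (q + of_real (\<mu> - 1))"

text \<open>Hamilton's equations in complex form. Derivatives are taken within \<open>I\<close>,
  hence one-sided at endpoints that belong to \<open>I\<close>, so that pieces on half-closed
  intervals can be glued.\<close>

definition csol :: "real \<Rightarrow> real set \<Rightarrow> (real \<Rightarrow> complex) \<Rightarrow> (real \<Rightarrow> complex) \<Rightarrow> bool" where
  "csol \<mu> I q p \<longleftrightarrow> (\<forall>t\<in>I. q t + of_real \<mu> \<noteq> 0 \<and> q t + of_real (\<mu> - 1) \<noteq> 0 \<and>
     (q has_vector_derivative p t - \<i> * q t) (at t within I) \<and>
     (p has_vector_derivative - \<i> * p t - attraction \<mu> (q t)) (at t within I))"

lemma has_real_derivative_inverse_sqrt: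
  assumes "(X has_real_derivative X') (at t within I)" "X t > 0"
  shows "((\<lambda>t. m / sqrt (X t)) has_real_derivative - (m / sqrt (X t) ^ 3 * X' / 2)) (at t within I)"
proof -
  have "sqrt (X t) > 0" using assms by simp
  then show ?thesis using assms
    by (auto intro!: derivative_eq_intros simp: field_simps power2_eq_square power3_eq_cube)
qed

lemma has_real_derivative_Re:
  "(f has_vector_derivative f') (at t within I) \<Longrightarrow> ((\<lambda>t. Re (f t)) has_real_derivative Re f') (at t within I)"
  unfolding has_real_derivative_iff_has_vector_derivative
  by (rule bounded_linear.has_vector_derivative[OF bounded_linear_Re])

lemma has_real_derivative_Im:
  "(f has_vector_derivative f') (at t within I) \<Longrightarrow> ((\<lambda>t. Im (f t)) has_real_derivative Im f') (at t within I)"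
  unfolding has_real_derivative_iff_has_vector_derivative
  by (rule bounded_linear.has_vector_derivative[OF bounded_linear_Im])

lemma has_vector_derivative_cis:
  "(\<theta> has_real_derivative d) (at t within I) \<Longrightarrow>
    ((\<lambda>t. cis (\<theta> t)) has_vector_derivative of_real d * (\<i> * cis (\<theta> t))) (at t within I)"
  unfolding has_vector_derivative_complex_iff by (auto intro!: derivative_eq_intros)

lemma cham_Re_Im:
  "cham \<mu> q p = ((Re p)^2 + (Im p)^2) / 2 - (Re q * Im p - Im q * Re p)
     - (1 - \<mu>) / sqrt ((Re q + \<mu>)^2 + (Im q)^2) - \<mu> / sqrt ((Re q + (\<mu> - 1))^2 + (Im q)^2)"
  by (simp add: cham_def cmod_def)

lemma cham_constant:
  assumes sol: "csol \<mu> I q p" and "convex I" "a \<in> I" "b \<in> I"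
  shows "cham \<mu> (q a) (p a) = cham \<mu> (q b) (p b)"
proof -
  have "((\<lambda>t. cham \<mu> (q t) (p t)) has_field_derivative 0) (at t within I)" if t: "t \<in> I" for t
  proof -
    have ne: "q t + of_real \<mu> \<noteq> 0" "q t + of_real (\<mu> - 1) \<noteq> 0"
      and q': "(q has_vector_derivative p t - \<i> * q t) (at t within I)"
      and p': "(p has_vector_derivative - \<i> * p t - attraction \<mu> (q t)) (at t within I)"
      using sol t by (auto simp: csol_def)
    have pos: "(Re (q t) + \<mu>)^2 + (Im (q t))^2 > 0" "(Re (q t) + (\<mu> - 1))^2 + (Im (q t))^2 > 0"
      using ne by (auto simp: complex_eq_iff sum_power2_gt_zero_iff)
    define s1 where "s1 = (1 - \<mu>) / sqrt ((Re (q t) + \<mu>)^2 + (Im (q t))^2) ^ 3"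
    define s2 where "s2 = \<mu> / sqrt ((Re (q t) + (\<mu> - 1))^2 + (Im (q t))^2) ^ 3"
    have g: "Re (attraction \<mu> (q t)) = s1 * (Re (q t) + \<mu>) + s2 * (Re (q t) + (\<mu> - 1))"
      "Im (attraction \<mu> (q t)) = s1 * Im (q t) + s2 * Im (q t)"
      by (simp_all add: attraction_def s1_def s2_def cmod_def)
    have x: "((\<lambda>t. Re (q t)) has_real_derivative Re (p t) + Im (q t)) (at t within I)"
      using has_real_derivative_Re[OF q'] by simp
    have y: "((\<lambda>t. Im (q t)) has_real_derivative Im (p t) - Re (q t)) (at t within I)"
      using has_real_derivative_Im[OF q'] by simp
    have u: "((\<lambda>t. Re (p t)) has_real_derivative Im (p t) - Re (attraction \<mu> (q t))) (at t within I)"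
      using has_real_derivative_Re[OF p'] by simp
    have v: "((\<lambda>t. Im (p t)) has_real_derivative - Re (p t) - Im (attraction \<mu> (q t))) (at t within I)"
      using has_real_derivative_Im[OF p'] by simp
    have A: "((\<lambda>t. (1 - \<mu>) / sqrt ((Re (q t) + \<mu>)^2 + (Im (q t))^2)) has_real_derivative
       - (s1 * (2 * (Re (q t) + \<mu>) * (Re (p t) + Im (q t)) + 2 * Im (q t) * (Im (p t) - Re (q t))) / 2)) (at t within I)"
      unfolding s1_def
      by (rule has_real_derivative_inverse_sqrt) (use pos in \<open>auto intro!: derivative_eq_intros q' simp: algebra_simps\<close>)
    have B: "((\<lambda>t. \<mu> / sqrt ((Re (q t) + (\<mu> - 1))^2 + (Im (q t))^2)) has_real_derivative
       - (s2 * (2 * (Re (q t) + (\<mu> - 1)) * (Re (p t) + Im (q t)) + 2 * Im (q t) * (Im (p t) - Re (q t))) / 2)) (at t within I)"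
      unfolding s2_def
      by (rule has_real_derivative_inverse_sqrt) (use pos in \<open>auto intro!: derivative_eq_intros q' simp: algebra_simps\<close>)
    have C: "((\<lambda>t. ((Re (p t))^2 + (Im (p t))^2) / 2 - (Re (q t) * Im (p t) - Im (q t) * Re (p t))) has_real_derivative
      (Re (p t) * (Im (p t) - Re (attraction \<mu> (q t))) + Im (p t) * (- Re (p t) - Im (attraction \<mu> (q t)))
       - ((Re (p t) + Im (q t)) * Im (p t) + Re (q t) * (- Re (p t) - Im (attraction \<mu> (q t)))
          - ((Im (p t) - Re (q t)) * Re (p t) + Im (q t) * (Im (p t) - Re (attraction \<mu> (q t))))))) (at t within I)"
      by (auto intro!: derivative_eq_intros q' p' simp: field_simps)
    show ?thesis unfolding cham_Re_Im
      by (rule DERIV_cong[OF DERIV_diff[OF DERIV_diff[OF C A] B]]) (simp add: g field_simps)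
  qed
  then obtain c where "\<And>t. t \<in> I \<Longrightarrow> cham \<mu> (q t) (p t) = c"
    using has_field_derivative_zero_constant[OF \<open>convex I\<close>, of "\<lambda>t. cham \<mu> (q t) (p t)"] by auto
  then show ?thesis using assms by simp
qed

text \<open>Polar coordinates at the barycentre: \<open>P\<close> is the radial and \<open>G\<close> the angular momentum. The primaries are at
  \<open>- \<kappa>\<close> for \<open>\<kappa> = \<mu>\<close> (Sun) and \<open>\<kappa> = \<mu> - 1\<close> (planet), and \<open>scaled_dist\<close> is the distance divided by \<open>r\<close>; in terms of
  \<open>\<rho> = 1 / r\<close> the field extends to a bounded Lipschitz one.\<close>

definition scaled_dist :: "real \<Rightarrow> real \<Rightarrow> real \<Rightarrow> real" where
  "scaled_dist \<kappa> \<rho> \<phi> = sqrt (1 + 2 * \<kappa> * \<rho> * cos \<phi> + (\<kappa> * \<rho>)^2)"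

definition radial_pull :: "real \<Rightarrow> real \<Rightarrow> real \<Rightarrow> real" where
  "radial_pull \<mu> \<rho> \<phi> = \<rho>^2 * ((1 - \<mu>) * (1 + \<mu> * \<rho> * cos \<phi>) * (1 / scaled_dist \<mu> \<rho> \<phi>) ^ 3
      + \<mu> * (1 + (\<mu> - 1) * \<rho> * cos \<phi>) * (1 / scaled_dist (\<mu> - 1) \<rho> \<phi>) ^ 3)"

text \<open>With the origin at the barycentre both primaries contribute with the same coefficient
  \<open>\<mu> * (1 - \<mu>)\<close>, which makes the torque of order \<open>\<mu>\<close>.\<close>

definition torque :: "real \<Rightarrow> real \<Rightarrow> real \<Rightarrow> real" where
  "torque \<mu> \<rho> \<phi> = \<mu> * (1 - \<mu>) * \<rho>^2 * sin \<phi> *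
     ((1 / scaled_dist \<mu> \<rho> \<phi>) ^ 3 - (1 / scaled_dist (\<mu> - 1) \<rho> \<phi>) ^ 3)"

definition polar_energy :: "real \<Rightarrow> real \<Rightarrow> real \<Rightarrow> real \<Rightarrow> real \<Rightarrow> real" where
  "polar_energy \<mu> r \<phi> P G = P^2 / 2 + (G / r)^2 / 2 - G
     - (1 / r) * ((1 - \<mu>) * (1 / scaled_dist \<mu> (1 / r) \<phi>) + \<mu> * (1 / scaled_dist (\<mu> - 1) (1 / r) \<phi>))"

text \<open>For \<open>\<mu>\<close> in the unit interval both primaries lie within distance 1 of
  the barycentre, so \<open>r > 1\<close> excludes collisions.\<close>

definition polar_sol where
  "polar_sol \<mu> I r \<phi> P G \<longleftrightarrow> (\<forall>t\<in>I. r t > (1::real) \<and>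
     (r has_real_derivative P t) (at t within I) \<and>
     (\<phi> has_real_derivative G t * (1 / r t)^2 - 1) (at t within I) \<and>
     (P has_real_derivative (G t)^2 * (1 / r t) ^ 3 - radial_pull \<mu> (1 / r t) (\<phi> t)) (at t within I) \<and>
     (G has_real_derivative torque \<mu> (1 / r t) (\<phi> t)) (at t within I))"

lemma polar_shift:
  assumes "r > 0"
  shows "of_real r * cis \<phi> + of_real \<kappa>
    = of_real r * Complex (1 + \<kappa> * (1 / r) * cos \<phi>) (- (\<kappa> * (1 / r) * sin \<phi>)) * cis \<phi>"
proof -
  have "\<kappa> * r = \<kappa> * r * (cos \<phi> * cos \<phi> + sin \<phi> * sin \<phi>)" by (simp add: sin_cos_squared_add3)
  also have "\<dots> = \<kappa> * (r * (cos \<phi> * cos \<phi>)) + \<kappa> * (r * (sin \<phi> * sin \<phi>))" by (simp only: distrib_left mult.assoc)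
  finally have e: "\<kappa> * r = \<dots>" .
  show ?thesis using assms
    by (simp add: complex_eq_iff field_simps flip: e)
qed

lemma cmod_polar_shift:
  assumes "r > 0"
  shows "cmod (of_real r * cis \<phi> + of_real \<kappa>) = r * scaled_dist \<kappa> (1 / r) \<phi>"
proof -
  have "(1 + \<kappa> * (1 / r) * cos \<phi>)^2 + (\<kappa> * (1 / r) * sin \<phi>)^2
    = 1 + 2 * \<kappa> * (1 / r) * cos \<phi> + (\<kappa> * (1 / r))^2 * ((cos \<phi>)^2 + (sin \<phi>)^2)"
    by (simp only: power_mult_distrib distrib_left power2_sum) (simp add: algebra_simps)
  also have "(cos \<phi>)^2 + (sin \<phi>)^2 = 1" by simp
  finally show ?thesis using assms unfolding polar_shift[OF assms]
    by (simp only: norm_mult norm_of_real norm_cis) (simp add: complex_norm scaled_dist_def)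
qed

lemma scaled_dist_bounds:
  assumes "0 \<le> \<rho>" "\<bar>\<kappa>\<bar> * \<rho> \<le> 1"
  shows "1 - \<bar>\<kappa>\<bar> * \<rho> \<le> scaled_dist \<kappa> \<rho> \<phi>" "scaled_dist \<kappa> \<rho> \<phi> \<le> 1 + \<bar>\<kappa>\<bar> * \<rho>"
    and "(1 - \<bar>\<kappa>\<bar> * \<rho>)^2 \<le> 1 + 2 * \<kappa> * \<rho> * cos \<phi> + (\<kappa> * \<rho>)^2"
proof -
  have "\<bar>\<kappa> * \<rho> * cos \<phi>\<bar> \<le> \<bar>\<kappa>\<bar> * \<rho> * 1"
    unfolding abs_mult using assms by (intro mult_mono) auto
  then have c: "\<kappa> * \<rho> * cos \<phi> \<le> \<bar>\<kappa>\<bar> * \<rho>" "- (\<bar>\<kappa>\<bar> * \<rho>) \<le> \<kappa> * \<rho> * cos \<phi>" by linarith+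
  have e: "(1 - \<bar>\<kappa>\<bar> * \<rho>)^2 = 1 - 2 * (\<bar>\<kappa>\<bar> * \<rho>) + (\<kappa> * \<rho>)^2" "(1 + \<bar>\<kappa>\<bar> * \<rho>)^2 = 1 + 2 * (\<bar>\<kappa>\<bar> * \<rho>) + (\<kappa> * \<rho>)^2"
    by (simp_all add: power2_eq_square algebra_simps abs_if)
  show b: "(1 - \<bar>\<kappa>\<bar> * \<rho>)^2 \<le> 1 + 2 * \<kappa> * \<rho> * cos \<phi> + (\<kappa> * \<rho>)^2" using e c by linarith
  then show "1 - \<bar>\<kappa>\<bar> * \<rho> \<le> scaled_dist \<kappa> \<rho> \<phi>" unfolding scaled_dist_def by (rule real_le_rsqrt)
  have "1 + 2 * \<kappa> * \<rho> * cos \<phi> + (\<kappa> * \<rho>)^2 \<le> (1 + \<bar>\<kappa>\<bar> * \<rho>)^2" using e c by linarith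
  then show "scaled_dist \<kappa> \<rho> \<phi> \<le> 1 + \<bar>\<kappa>\<bar> * \<rho>" unfolding scaled_dist_def using assms by (intro real_le_lsqrt) auto
qed

lemma scaled_dist_pos:
  assumes "r > 1" "\<bar>\<kappa>\<bar> \<le> 1" shows "0 < scaled_dist \<kappa> (1 / r) \<phi>"
proof -
  have "\<bar>\<kappa>\<bar> * (1 / r) < 1" using assms by simp
  moreover from this have "1 - \<bar>\<kappa>\<bar> * (1 / r) \<le> scaled_dist \<kappa> (1 / r) \<phi>"
    using assms by (intro scaled_dist_bounds(1)) auto
  ultimately show ?thesis by linarith
qed

lemma polar_to_csol:
  assumes "polar_sol \<mu> I r \<phi> P G" "0 < \<mu>" "\<mu> < 1"
  shows "csol \<mu> I (\<lambda>t. of_real (r t) * cis (\<phi> t)) (\<lambda>t. Complex (P t) (G t / r t) * cis (\<phi> t))"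
  unfolding csol_def
proof (intro ballI conjI)
  fix t assume t: "t \<in> I"
  then have r1: "r t > 1" and r': "(r has_real_derivative P t) (at t within I)"
    and f': "(\<phi> has_real_derivative G t * (1 / r t)^2 - 1) (at t within I)"
    and P': "(P has_real_derivative (G t)^2 * (1 / r t) ^ 3 - radial_pull \<mu> (1 / r t) (\<phi> t)) (at t within I)"
    and G': "(G has_real_derivative torque \<mu> (1 / r t) (\<phi> t)) (at t within I)"
    using assms(1) by (auto simp: polar_sol_def)
  have r: "r t > 0" using r1 by simp
  note d = scaled_dist_pos[OF r1, of \<mu> "\<phi> t"] scaled_dist_pos[OF r1, of "\<mu> - 1" "\<phi> t"]
  have dd: "0 < scaled_dist \<mu> (1 / r t) (\<phi> t)" "0 < scaled_dist (\<mu> - 1) (1 / r t) (\<phi> t)" using d assms by auto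
  have "cmod (of_real (r t) * cis (\<phi> t) + of_real \<mu>) > 0" "cmod (of_real (r t) * cis (\<phi> t) + of_real (\<mu> - 1)) > 0"
    unfolding cmod_polar_shift[OF r] using dd r by auto
  then show "of_real (r t) * cis (\<phi> t) + complex_of_real \<mu> \<noteq> 0" "of_real (r t) * cis (\<phi> t) + complex_of_real (\<mu> - 1) \<noteq> 0"
    by auto
  have cis': "((\<lambda>t. cis (\<phi> t)) has_vector_derivative of_real (G t * (1 / r t)^2 - 1) * (\<i> * cis (\<phi> t))) (at t within I)"
    using f' by (rule has_vector_derivative_cis)
  have "((\<lambda>t. of_real (r t) * cis (\<phi> t)) has_vector_derivative
     of_real (r t) * (of_real (G t * (1 / r t)^2 - 1) * (\<i> * cis (\<phi> t))) + of_real (P t) * cis (\<phi> t)) (at t within I)"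
    using r' by (intro has_vector_derivative_mult cis' has_vector_derivative_of_real)
       (simp add: has_real_derivative_iff_has_vector_derivative)
  moreover have "of_real (r t) * (of_real (G t * (1 / r t)^2 - 1) * (\<i> * cis (\<phi> t))) + of_real (P t) * cis (\<phi> t)
     = Complex (P t) (G t / r t) * cis (\<phi> t) - \<i> * (of_real (r t) * cis (\<phi> t))"
    using r by (simp add: complex_eq_iff field_simps power2_eq_square)
  ultimately show "((\<lambda>t. of_real (r t) * cis (\<phi> t)) has_vector_derivative
     Complex (P t) (G t / r t) * cis (\<phi> t) - \<i> * (of_real (r t) * cis (\<phi> t))) (at t within I)" by simp
  define b where "b = (1 / r t) * torque \<mu> (1 / r t) (\<phi> t)"
  define a where "a = radial_pull \<mu> (1 / r t) (\<phi> t)"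
  \<comment> \<open>In the frame turning with the position, the attraction has radial component
    \<open>a\<close> and transversal component \<open>- b\<close>, and \<open>b\<close> is the
    torque divided by \<open>r\<close>.\<close>
  have att: "attraction \<mu> (of_real (r t) * cis (\<phi> t)) = Complex a (- b) * cis (\<phi> t)"
  proof -
    define \<rho> where "\<rho> = 1 / r t"
    let ?C1 = "Complex (1 + \<mu> * (1 / r t) * cos (\<phi> t)) (- (\<mu> * (1 / r t) * sin (\<phi> t)))"
    let ?C2 = "Complex (1 + (\<mu> - 1) * (1 / r t) * cos (\<phi> t)) (- ((\<mu> - 1) * (1 / r t) * sin (\<phi> t)))"
    define k1 k2 where "k1 = 1 / scaled_dist \<mu> \<rho> (\<phi> t)" "k2 = 1 / scaled_dist (\<mu> - 1) \<rho> (\<phi> t)"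
    have "attraction \<mu> (of_real (r t) * cis (\<phi> t)) =
      of_real ((1 - \<mu>) / (r t * scaled_dist \<mu> (1 / r t) (\<phi> t)) ^ 3) *
        (of_real (r t) * ?C1 * cis (\<phi> t)) +
      of_real (\<mu> / (r t * scaled_dist (\<mu> - 1) (1 / r t) (\<phi> t)) ^ 3) *
        (of_real (r t) * ?C2 * cis (\<phi> t))"
      unfolding attraction_def cmod_polar_shift[OF r] unfolding polar_shift[OF r] ..
    also have "(1 - \<mu>) / (r t * scaled_dist \<mu> (1 / r t) (\<phi> t)) ^ 3 = (1 - \<mu>) * (1 / r t) ^ 3 * k1 ^ 3"
      by (simp add: k1_k2_def \<rho>_def power_divide power_mult_distrib)
    also have "\<mu> / (r t * scaled_dist (\<mu> - 1) (1 / r t) (\<phi> t)) ^ 3 = \<mu> * (1 / r t) ^ 3 * k2 ^ 3"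
      by (simp add: k1_k2_def \<rho>_def power_divide power_mult_distrib)
    also have "of_real ((1 - \<mu>) * (1 / r t) ^ 3 * k1 ^ 3) *
        (of_real (r t) * ?C1 * cis (\<phi> t)) +
      of_real (\<mu> * (1 / r t) ^ 3 * k2 ^ 3) *
        (of_real (r t) * ?C2 * cis (\<phi> t))
      = of_real (r t * (1 / r t) ^ 3) * (of_real ((1 - \<mu>) * k1 ^ 3) *
        ?C1 +
      of_real (\<mu> * k2 ^ 3) *
        ?C2) * cis (\<phi> t)"
      by (simp add: algebra_simps)
    also have "r t * (1 / r t) ^ 3 = (1 / r t)^2" using r by (simp add: field_simps power2_eq_square power3_eq_cube)
    also have "of_real ((1 / r t)^2) * (of_real ((1 - \<mu>) * k1 ^ 3) *
        ?C1 +
      of_real (\<mu> * k2 ^ 3) *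
        ?C2) = Complex a (- b)"
      unfolding complex_eq_iff a_def b_def radial_pull_def torque_def \<rho>_def[symmetric] k1_k2_def[symmetric]
      by (simp add: algebra_simps)
    finally show ?thesis .
  qed
  let ?D = "Complex ((G t)^2 * (1 / r t) ^ 3 - a) (b - G t * P t / (r t)^2)"
  have c': "((\<lambda>t. Complex (P t) (G t / r t)) has_vector_derivative
     ?D) (at t within I)"
    unfolding has_vector_derivative_complex_iff a_def b_def using P' G' r' r
    by (auto intro!: derivative_eq_intros simp: field_simps power2_eq_square)
  have "((\<lambda>t. Complex (P t) (G t / r t) * cis (\<phi> t)) has_vector_derivative
     Complex (P t) (G t / r t) * (of_real (G t * (1 / r t)^2 - 1) * (\<i> * cis (\<phi> t)))
      + ?D * cis (\<phi> t)) (at t within I)"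
    by (intro has_vector_derivative_mult cis' c')
  moreover have "Complex (P t) (G t / r t) * (of_real (G t * (1 / r t)^2 - 1) * (\<i> * cis (\<phi> t)))
      + ?D * cis (\<phi> t)
    = (Complex (P t) (G t / r t) * of_real (G t * (1 / r t)^2 - 1) * \<i>
      + ?D) * cis (\<phi> t)" by (simp add: algebra_simps)
  moreover have "Complex (P t) (G t / r t) * of_real (G t * (1 / r t)^2 - 1) * \<i>
      + ?D = - \<i> * Complex (P t) (G t / r t) - Complex a (- b)"
    using r by (simp add: complex_eq_iff field_simps power2_eq_square power3_eq_cube)
  moreover have "(- \<i> * Complex (P t) (G t / r t) - Complex a (- b)) * cis (\<phi> t)
    = - \<i> * (Complex (P t) (G t / r t) * cis (\<phi> t)) - attraction \<mu> (of_real (r t) * cis (\<phi> t))"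
    unfolding att by (simp only: left_diff_distrib mult.assoc)
  ultimately show "((\<lambda>t. Complex (P t) (G t / r t) * cis (\<phi> t)) has_vector_derivative
     - \<i> * (Complex (P t) (G t / r t) * cis (\<phi> t)) - attraction \<mu> (of_real (r t) * cis (\<phi> t))) (at t within I)"
    by simp
qed

lemma cham_polar:
  assumes "r > 0"
  shows "cham \<mu> (of_real r * cis \<phi>) (Complex P (G / r) * cis \<phi>) = polar_energy \<mu> r \<phi> P G"
proof -
  have "cnj (of_real r * cis \<phi>) * (Complex P (G / r) * cis \<phi>) = of_real r * Complex P (G / r) * (cis \<phi> * cnj (cis \<phi>))"
    by (simp add: mult_ac)
  also have "cis \<phi> * cnj (cis \<phi>) = 1" by (simp add: complex_norm_square[symmetric])
  finally have e: "cnj (of_real r * cis \<phi>) * (Complex P (G / r) * cis \<phi>) = of_real r * Complex P (G / r)"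
    by (simp only: mult_1_right)
  have Im: "Im (cnj (of_real r * cis \<phi>) * (Complex P (G / r) * cis \<phi>)) = G"
    unfolding e using assms by simp
  have nm: "(cmod (Complex P (G / r) * cis \<phi>))^2 = P^2 + (G / r)^2"
    by (simp add: norm_mult cmod_power2)
  show ?thesis
    unfolding cham_def Im nm cmod_polar_shift[OF assms] polar_energy_def
    by (simp add: add_divide_distrib distrib_left)
qed

section \<open>The outgoing leg far from the primaries\<close>

text \<open>The clamps make the field globally Lipschitz and are inactive on the outgoing leg; they are chosen such that
  the radial momentum decreases strictly along every trajectory.\<close>

definition far_field :: "real \<Rightarrow> real \<times> real \<times> real \<times> real \<Rightarrow> real \<times> real \<times> real \<times> real" where
  "far_field \<mu> z = (clamp_abs 2 (fst (snd (snd z))),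
     clamp_abs (1/4) (snd (snd (snd z))) * (1 / max 4 (fst z))^2 - 1,
     (clamp_abs (1/4) (snd (snd (snd z))))^2 * (1 / max 4 (fst z)) ^ 3 - radial_pull \<mu> (1 / max 4 (fst z)) (fst (snd z)),
     torque \<mu> (1 / max 4 (fst z)) (fst (snd z)))"

lemma scaled_dist_bounds':
  assumes "0 \<le> \<rho>" "\<rho> \<le> 1/4" "\<bar>\<kappa>\<bar> \<le> 1"
  shows "3/4 \<le> scaled_dist \<kappa> \<rho> \<phi>" "9/16 \<le> 1 + 2 * \<kappa> * \<rho> * cos \<phi> + (\<kappa> * \<rho>)^2"
proof -
  have k: "\<bar>\<kappa>\<bar> * \<rho> \<le> 1 * (1/4)" using assms by (intro mult_mono) auto
  show "3/4 \<le> scaled_dist \<kappa> \<rho> \<phi>" using scaled_dist_bounds(1)[of \<rho> \<kappa> \<phi>] assms k by linarith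
  have "(3/4)^2 \<le> (1 - \<bar>\<kappa>\<bar> * \<rho>)^2" using k by (intro power_mono) auto
  then show "9/16 \<le> 1 + 2 * \<kappa> * \<rho> * cos \<phi> + (\<kappa> * \<rho>)^2"
    using scaled_dist_bounds(3)[of \<rho> \<kappa> \<phi>] assms k by (simp add: power2_eq_square)
qed

lemma bdd_lip_inverse_scaled_dist:
  assumes "bdd_lip \<rho>" "lip \<phi>" "\<And>z. 0 \<le> \<rho> z" "\<And>z. \<rho> z \<le> 1/4" "\<bar>\<kappa>\<bar> \<le> 1"
  shows "bdd_lip (\<lambda>z. 1 / scaled_dist \<kappa> (\<rho> z) (\<phi> z))"
proof (rule bdd_lip_inverse[where c = "3/4"])
  have "bdd_lip (\<lambda>z. 1 + 2 * \<kappa> * \<rho> z * cos (\<phi> z) + (\<kappa> * \<rho> z)^2)"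
    by (intro bdd_lip_intros bdd_lip_cos assms)
  then show "lip (\<lambda>z. scaled_dist \<kappa> (\<rho> z) (\<phi> z))"
    unfolding scaled_dist_def
    by (intro lip_sqrt[where c = "9/16"] bdd_lip_lip scaled_dist_bounds'(2) assms) auto
qed (use assms scaled_dist_bounds' in auto)

lemma far_field_lipschitz:
  assumes "0 < \<mu>" "\<mu> < 1"
  obtains L where "L-lipschitz_on UNIV (far_field \<mu>)"
proof -
  have r: "bdd_lip (\<lambda>z :: real \<times> real \<times> real \<times> real. 1 / max 4 (fst z))"
    by (rule bdd_lip_inverse[where c = 4]) (auto intro!: lip_max lip_fst lip_id)
  have p: "lip (\<lambda>z :: real \<times> real \<times> real \<times> real. fst (snd z))" by (intro lip_fst lip_snd lip_id)
  have d: "bdd_lip (\<lambda>z :: real \<times> real \<times> real \<times> real. 1 / scaled_dist \<kappa> (1 / max 4 (fst z)) (fst (snd z)))"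
    if "\<bar>\<kappa>\<bar> \<le> 1" for \<kappa>
    by (rule bdd_lip_inverse_scaled_dist[OF r p]) (use that in \<open>auto simp: divide_le_eq\<close>)
  have "bdd_lip (far_field \<mu>)"
    unfolding far_field_def[abs_def] radial_pull_def torque_def
    by (intro bdd_lip_intros bdd_lip_cos bdd_lip_sin bdd_lip_clamp_abs r p d lip_fst lip_snd lip_id)
       (use assms in auto)
  then show ?thesis using that by (auto simp: bdd_lip_def lip_def)
qed

lemma radial_pull_ge:
  assumes "0 < \<mu>" "\<mu> \<le> 1/128" "0 < \<rho>" "\<rho> \<le> 1/4"
  shows "9/10 * \<rho>^2 \<le> radial_pull \<mu> \<rho> \<phi>"
proof -
  have k: "\<mu> * \<rho> \<le> 1/128 * (1/4)" using assms by (intro mult_mono) auto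
  have k2: "(1 - \<mu>) * \<rho> \<le> 1 * (1/4)" using assms by (intro mult_mono) auto
  have c: "\<bar>\<mu> * \<rho> * cos \<phi>\<bar> \<le> \<mu> * \<rho> * 1" "\<bar>(1 - \<mu>) * \<rho> * cos \<phi>\<bar> \<le> (1 - \<mu>) * \<rho> * 1"
    unfolding abs_mult using assms by (intro mult_mono; auto)+
  have d: "3/4 \<le> scaled_dist \<mu> \<rho> \<phi>" "3/4 \<le> scaled_dist (\<mu> - 1) \<rho> \<phi>"
    using assms scaled_dist_bounds'(1)[of \<rho> \<mu> \<phi>] scaled_dist_bounds'(1)[of \<rho> "\<mu> - 1" \<phi>] by auto
  have d2: "scaled_dist \<mu> \<rho> \<phi> \<le> 100/99" using scaled_dist_bounds(2)[of \<rho> \<mu> \<phi>] assms k by auto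
  have a: "99/100 \<le> 1 + \<mu> * \<rho> * cos \<phi>" using c k by linarith
  have b: "0 \<le> 1 + (\<mu> - 1) * \<rho> * cos \<phi>" using c(2) k2 by (simp add: algebra_simps abs_le_iff)
  have "99/100 \<le> 1 / scaled_dist \<mu> \<rho> \<phi>" using d d2 by (simp add: field_simps)
  then have "(99/100)^3 \<le> (1 / scaled_dist \<mu> \<rho> \<phi>)^3" by (intro power_mono) auto
  moreover have "(97/100 :: real) \<le> (99/100)^3" by (simp add: power3_eq_cube)
  ultimately have w: "97/100 \<le> (1 / scaled_dist \<mu> \<rho> \<phi>)^3" by (rule order_trans[rotated])
  have v: "98/100 \<le> (1 - \<mu>) * (1 + \<mu> * \<rho> * cos \<phi>)"
    using mult_mono[of "99/100" "1 - \<mu>" "99/100" "1 + \<mu> * \<rho> * cos \<phi>"] assms a by simp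
  have "98/100 * (97/100) \<le> (1 - \<mu>) * (1 + \<mu> * \<rho> * cos \<phi>) * (1 / scaled_dist \<mu> \<rho> \<phi>) ^ 3"
    using v by (intro mult_mono[OF v w]) auto
  moreover have "0 \<le> \<mu> * (1 + (\<mu> - 1) * \<rho> * cos \<phi>) * (1 / scaled_dist (\<mu> - 1) \<rho> \<phi>) ^ 3"
    using assms b d by (intro mult_nonneg_nonneg) auto
  ultimately have "9/10 \<le> (1 - \<mu>) * (1 + \<mu> * \<rho> * cos \<phi>) * (1 / scaled_dist \<mu> \<rho> \<phi>) ^ 3
      + \<mu> * (1 + (\<mu> - 1) * \<rho> * cos \<phi>) * (1 / scaled_dist (\<mu> - 1) \<rho> \<phi>) ^ 3" by simp
  from mult_left_mono[OF this, of "\<rho>^2"] show ?thesis by (simp add: radial_pull_def mult.commute)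
qed

lemma abs_torque_le:
  assumes "0 < \<mu>" "\<mu> \<le> 1/128" "0 < \<rho>" "\<rho> \<le> 1/4"
  shows "\<bar>torque \<mu> \<rho> \<phi>\<bar> \<le> 4 * \<mu> * \<rho>^2"
proof -
  have d: "3/4 \<le> scaled_dist \<mu> \<rho> \<phi>" "3/4 \<le> scaled_dist (\<mu> - 1) \<rho> \<phi>"
    using assms scaled_dist_bounds'(1)[of \<rho> \<mu> \<phi>] scaled_dist_bounds'(1)[of \<rho> "\<mu> - 1" \<phi>] by auto
  have "1 / scaled_dist \<mu> \<rho> \<phi> \<le> 4/3" "1 / scaled_dist (\<mu> - 1) \<rho> \<phi> \<le> 4/3" using d by (auto simp: field_simps)
  then have "(1 / scaled_dist \<mu> \<rho> \<phi>)^3 \<le> (4/3)^3" "(1 / scaled_dist (\<mu> - 1) \<rho> \<phi>)^3 \<le> (4/3)^3"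
    "0 \<le> (1 / scaled_dist \<mu> \<rho> \<phi>)^3" "0 \<le> (1 / scaled_dist (\<mu> - 1) \<rho> \<phi>)^3" using d
    by (auto intro!: power_mono)
  moreover have four_thirds: "(4/3)^3 \<le> (4::real)" by (simp add: power3_eq_cube)
  ultimately have "\<bar>(1 / scaled_dist \<mu> \<rho> \<phi>)^3 - (1 / scaled_dist (\<mu> - 1) \<rho> \<phi>)^3\<bar> \<le> 4"
    using four_thirds by (intro abs_leI) linarith+
  then have "\<bar>torque \<mu> \<rho> \<phi>\<bar> \<le> \<mu> * 1 * \<rho>^2 * 1 * 4"
    unfolding torque_def abs_mult using assms by (intro mult_mono) auto
  then show ?thesis by simp
qed

text \<open>The bounds on \<open>G\<close> and \<open>\<mu>\<close> leave room for the drift: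
  \<open>1/8 + 8 * \<mu> \<le> 3/16\<close>, below the clamp at \<open>1/4\<close>.\<close>

locale far_orbit =
  fixes \<mu> h :: real and z :: "real \<Rightarrow> real \<times> real \<times> real \<times> real"
  assumes mu: "0 < \<mu>" "\<mu> \<le> 1/128"
    and sol: "\<And>t. 0 \<le> t \<Longrightarrow> (z has_vector_derivative far_field \<mu> (z t)) (at t within {0..})"
    and r0: "4 \<le> fst (z 0)"
    and P0: "0 < fst (snd (snd (z 0)))" "fst (snd (snd (z 0))) \<le> 1"
    and G0: "\<bar>snd (snd (snd (z 0)))\<bar> \<le> 1/8"
    and energy0: "polar_energy \<mu> (fst (z 0)) (fst (snd (z 0))) (fst (snd (snd (z 0)))) (snd (snd (snd (z 0)))) = h"
begin

definition "r t = fst (z t)"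
definition "\<phi> t = fst (snd (z t))"
definition "P t = fst (snd (snd (z t)))"
definition "G t = snd (snd (snd (z t)))"
definition "\<rho> t = 1 / max 4 (r t)"
definition "P' t = (clamp_abs (1/4) (G t))^2 * (\<rho> t) ^ 3 - radial_pull \<mu> (\<rho> t) (\<phi> t)"

lemma rho: "0 < \<rho> t" "\<rho> t \<le> 1/4" by (auto simp: \<rho>_def divide_le_eq)

lemma has_real_derivative_components:
  assumes "0 \<le> t"
  shows "(r has_real_derivative clamp_abs 2 (P t)) (at t within {0..})" (is ?A)
    and "(\<phi> has_real_derivative clamp_abs (1/4) (G t) * (\<rho> t)^2 - 1) (at t within {0..})" (is ?B)
    and "(P has_real_derivative P' t) (at t within {0..})" (is ?C)
    and "(G has_real_derivative torque \<mu> (\<rho> t) (\<phi> t)) (at t within {0..})" (is ?D)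
proof -
  have "bounded_linear (\<lambda>z :: real \<times> real \<times> real \<times> real. fst z)"
    "bounded_linear (\<lambda>z :: real \<times> real \<times> real \<times> real. fst (snd z))"
    "bounded_linear (\<lambda>z :: real \<times> real \<times> real \<times> real. fst (snd (snd z)))"
    "bounded_linear (\<lambda>z :: real \<times> real \<times> real \<times> real. snd (snd (snd z)))"
    by (intro bounded_linear_intros)+
  note this[THEN bounded_linear.has_vector_derivative, OF sol[OF assms]]
  then show ?A ?B ?C ?D
    unfolding has_real_derivative_iff_has_vector_derivative r_def[abs_def] \<phi>_def[abs_def] P_def[abs_def] G_def[abs_def]
    by (simp_all add: far_field_def \<rho>_def r_def P'_def \<phi>_def G_def)
qed

lemma at_within_ge: "0 < t \<Longrightarrow> at t within {0..} = at (t::real)"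
  by (rule at_within_interior) (simp add: interior_Ici[of "-1"])

lemma DERIV_components:
  assumes "0 < t"
  shows "DERIV r t :> clamp_abs 2 (P t)"
    and "DERIV \<phi> t :> clamp_abs (1/4) (G t) * (\<rho> t)^2 - 1"
    and "DERIV P t :> P' t"
    and "DERIV G t :> torque \<mu> (\<rho> t) (\<phi> t)"
  using has_real_derivative_components[of t] assms by (auto simp: at_within_ge)

lemma continuous_components:
  "continuous_on {0..} r" "continuous_on {0..} \<phi>" "continuous_on {0..} P" "continuous_on {0..} G"
  using has_real_derivative_components
  by (auto intro!: DERIV_continuous_on)

text \<open>The clamped centrifugal term is at most \<open>1/64\<close> of \<open>\<rho>^2\<close>,
  against a pull of at least \<open>9/10\<close> of it. The estimate needs no knowledge of whether
  the orbit is still outgoing.\<close>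

lemma P_deriv_le: "P' t \<le> - ((\<rho> t)^2 / 2)"
proof -
  have "(clamp_abs (1/4) (G t))^2 \<le> (1/4)^2"
    using clamp_abs_le[of "1/4" "G t"] by (intro abs_le_square_iff[THEN iffD1]) auto
  then have "(clamp_abs (1/4) (G t))^2 * ((\<rho> t)^2 * \<rho> t) \<le> (1/4)^2 * ((\<rho> t)^2 * (1/4))"
    using rho[of t] by (intro mult_mono) auto
  also have "\<dots> = (\<rho> t)^2 / 64" by (simp add: power2_eq_square)
  finally have "(clamp_abs (1/4) (G t))^2 * (\<rho> t) ^ 3 \<le> (\<rho> t)^2 / 64" by (simp add: power3_eq_cube power2_eq_square)
  then show ?thesis using radial_pull_ge[OF mu rho, of t "\<phi> t"] zero_le_power2[of "\<rho> t"] unfolding P'_def by linarith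
qed

lemma P_decreasing:
  assumes "0 \<le> s" "s < t" shows "P t < P s"
  using assms(2)
proof (rule DERIV_neg_imp_decreasing_open)
  fix x assume x: "s < x" "x < t"
  then show "\<exists>y. DERIV P x :> y \<and> y < 0"
    using DERIV_components(3)[of x] assms x
    by (intro exI[of _ "P' x"] conjI)
      (auto intro!: le_less_trans[OF P_deriv_le] simp del: diff_less_0_iff_less simp: rho(1)[THEN less_imp_neq, symmetric])
qed (use assms in \<open>auto intro: continuous_on_subset[OF continuous_components(3)]\<close>)

lemma P_decreasing': "0 \<le> s \<Longrightarrow> s \<le> t \<Longrightarrow> P t \<le> P s"
  using P_decreasing[of s t] by (cases "s = t") auto

text \<open>The torque is dominated by the radial deceleration, so the angular momentum varies at most by a multiple of
  \<open>\<mu>\<close> on the whole outgoing leg, however long it lasts.\<close>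

lemma G_change:
  assumes "0 \<le> t" shows "\<bar>G t - G 0\<bar> \<le> 8 * \<mu> * (P 0 - P t)"
proof (cases "t = 0")
  case False
  then have t: "0 < t" using assms by simp
  have b: "\<bar>torque \<mu> (\<rho> x) (\<phi> x)\<bar> \<le> - (8 * \<mu> * P' x)" for x
  proof -
    have "8 * \<mu> * ((\<rho> x)^2 / 2) \<le> 8 * \<mu> * - P' x"
      using P_deriv_le[of x] mu by (intro mult_left_mono) auto
    then show ?thesis using abs_torque_le[OF mu rho, of x "\<phi> x"] by (simp add: algebra_simps)
  qed
  have "G t + 8 * \<mu> * P t \<le> G 0 + 8 * \<mu> * P 0"
  proof (rule DERIV_nonpos_imp_decreasing_open[of 0 t "\<lambda>x. G x + 8 * \<mu> * P x"])
    show "continuous_on {0..t} (\<lambda>x. G x + 8 * \<mu> * P x)"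
      by (intro continuous_intros continuous_on_subset[OF continuous_components(3)] continuous_on_subset[OF continuous_components(4)]) auto
    fix x assume "0 < x" "x < t"
    then show "\<exists>y. DERIV (\<lambda>x. G x + 8 * \<mu> * P x) x :> y \<and> y \<le> 0"
      using b[of x] by (intro exI[of _ "torque \<mu> (\<rho> x) (\<phi> x) + 8 * \<mu> * P' x"] conjI DERIV_add DERIV_cmult DERIV_components) auto
  qed (use t in auto)
  moreover have "G t - 8 * \<mu> * P t \<ge> G 0 - 8 * \<mu> * P 0"
  proof (rule DERIV_nonneg_imp_increasing_open[of 0 t "\<lambda>x. G x - 8 * \<mu> * P x"])
    show "continuous_on {0..t} (\<lambda>x. G x - 8 * \<mu> * P x)"
      by (intro continuous_intros continuous_on_subset[OF continuous_components(3)] continuous_on_subset[OF continuous_components(4)]) auto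
    fix x assume "0 < x" "x < t"
    then show "\<exists>y. DERIV (\<lambda>x. G x - 8 * \<mu> * P x) x :> y \<and> 0 \<le> y"
      using b[of x] by (intro exI[of _ "torque \<mu> (\<rho> x) (\<phi> x) - 8 * \<mu> * P' x"] conjI DERIV_diff DERIV_cmult DERIV_components) auto
  qed (use t in auto)
  ultimately show ?thesis by (simp add: algebra_simps abs_le_iff)
qed auto

text \<open>Far out the inertial angular velocity is at most \<open>1/64\<close>, so the rotation of
  the frame with speed 1 dominates.\<close>

lemma phi_le:
  assumes "0 \<le> t" shows "\<phi> t \<le> \<phi> 0 - t / 2"
proof (cases "t = 0")
  case False
  have "\<phi> t + t / 2 \<le> \<phi> 0 + 0 / 2"
  proof (rule DERIV_nonpos_imp_decreasing_open[of 0 t "\<lambda>x. \<phi> x + x / 2"])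
    show "continuous_on {0..t} (\<lambda>x. \<phi> x + x / 2)"
      by (intro continuous_intros continuous_on_subset[OF continuous_components(2)]) auto
    fix x assume x: "0 < x" "x < t"
    have "clamp_abs (1/4) (G x) * (\<rho> x)^2 \<le> 1/4 * (1/4)^2"
      using clamp_abs_le[of "1/4" "G x"] rho[of x] by (intro mult_mono power_mono) auto
    then show "\<exists>y. DERIV (\<lambda>x. \<phi> x + x / 2) x :> y \<and> y \<le> 0"
      using x by (intro exI[of _ "clamp_abs (1/4) (G x) * (\<rho> x)^2 - 1 + 1 / 2"] conjI DERIV_add DERIV_cdivide DERIV_ident DERIV_components)
        (auto simp: power2_eq_square)
  qed (use assms in auto)
  then show ?thesis by simp
qed auto

lemma r_mono:
  assumes "0 \<le> P t" "0 \<le> s" "s \<le> t" shows "r s \<le> r t"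
proof (cases "s = t")
  case False
  show ?thesis
  proof (rule DERIV_nonneg_imp_increasing_open[of s t r])
    show "continuous_on {s..t} r" by (rule continuous_on_subset[OF continuous_components(1)]) (use assms in auto)
    fix x assume "s < x" "x < t"
    then show "\<exists>y. DERIV r x :> y \<and> 0 \<le> y"
      using P_decreasing'[of x t] assms by (intro exI[of _ "clamp_abs 2 (P x)"] conjI DERIV_components) (auto simp: clamp_abs_def)
  qed (use assms in auto)
qed auto

text \<open>Since \<open>P\<close> decreases, its sign at the single time \<open>t\<close> certifies
  the whole interval before \<open>t\<close>; there every clamp is inactive, and the cut-off field
  coincides with the true one.\<close>

lemma outgoing:
  assumes "0 \<le> P t" "0 \<le> s" "s \<le> t"
  shows "4 \<le> r s" "0 \<le> P s" "P s \<le> 1" "\<bar>G s - G 0\<bar> \<le> 8 * \<mu>" "\<bar>G s\<bar> \<le> 1/4" "\<rho> s = 1 / r s"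
proof -
  show P: "0 \<le> P s" using P_decreasing'[of s t] assms by auto
  show r: "4 \<le> r s" using r_mono[OF P, of 0] r0 assms by (auto simp: r_def)
  show "P s \<le> 1" using P_decreasing'[of 0 s] P0 assms by (auto simp: P_def)
  have "8 * \<mu> * (P 0 - P s) \<le> 8 * \<mu> * 1" using P P0 mu by (intro mult_left_mono) (auto simp: P_def)
  then show g: "\<bar>G s - G 0\<bar> \<le> 8 * \<mu>" using G_change[of s] assms by simp
  show "\<bar>G s\<bar> \<le> 1/4" using g G0 mu unfolding G_def by linarith
  show "\<rho> s = 1 / r s" using r by (simp add: \<rho>_def)
qed

lemma polar_sol_outgoing:
  assumes "0 \<le> t" "0 \<le> P t" shows "polar_sol \<mu> {0..t} r \<phi> P G"
  unfolding polar_sol_def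
proof (intro ballI conjI)
  fix s assume s: "s \<in> {0..t}"
  have o: "4 \<le> r s" "0 \<le> P s" "P s \<le> 1" "\<bar>G s\<bar> \<le> 1/4" "\<rho> s = 1 / r s" using outgoing[of t s] assms s by auto
  then have e: "clamp_abs 2 (P s) = P s" "clamp_abs (1/4) (G s) = G s" by (auto intro!: clamp_abs_eq)
  show "1 < r s" using o by simp
  note * = has_real_derivative_components[of s, unfolded P'_def e o(5)]
  show "(r has_real_derivative P s) (at s within {0..t})"
    "(\<phi> has_real_derivative G s * (1 / r s)^2 - 1) (at s within {0..t})"
    "(P has_real_derivative (G s)^2 * (1 / r s) ^ 3 - radial_pull \<mu> (1 / r s) (\<phi> s)) (at s within {0..t})"
    "(G has_real_derivative torque \<mu> (1 / r s) (\<phi> s)) (at s within {0..t})"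
    using s by (auto intro!: has_field_derivative_subset[OF *(1)] has_field_derivative_subset[OF *(2)]
       has_field_derivative_subset[OF *(3)] has_field_derivative_subset[OF *(4)])
qed

text \<open>Conservation is transferred from the Cartesian solution, which spares a second
  computation in polar coordinates.\<close>

lemma energy:
  assumes "0 \<le> t" "0 \<le> P t" shows "polar_energy \<mu> (r t) (\<phi> t) (P t) (G t) = h"
proof -
  have "cham \<mu> (of_real (r t) * cis (\<phi> t)) (Complex (P t) (G t / r t) * cis (\<phi> t))
    = cham \<mu> (of_real (r 0) * cis (\<phi> 0)) (Complex (P 0) (G 0 / r 0) * cis (\<phi> 0))"
    using polar_to_csol[OF polar_sol_outgoing[OF assms]] mu assms
    by (intro cham_constant[where I = "{0..t}"]) auto
  moreover have "r t > 0" "r 0 > 0" using outgoing(1)[OF assms(2), of t] outgoing(1)[OF assms(2), of 0] assms by auto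
  ultimately show ?thesis using energy0 by (simp add: cham_polar r_def \<phi>_def P_def G_def)
qed

text \<open>The effective central mass seen by the potential: \<open>m t / r t\<close> is the sum of
  the two attractive terms of the Hamiltonian.\<close>

definition "m t = (1 - \<mu>) * (1 / scaled_dist \<mu> (1 / r t) (\<phi> t)) + \<mu> * (1 / scaled_dist (\<mu> - 1) (1 / r t) (\<phi> t))"

lemma m_bounds:
  assumes "0 \<le> t" "0 \<le> P t" shows "9/10 \<le> m t" "m t \<le> 2"
proof -
  have r: "0 < \<rho> t" "\<rho> t \<le> 1/4" by (rule rho)+
  have e: "1 / r t = \<rho> t" using outgoing(6)[OF assms(2), of t] assms by auto
  have k: "\<mu> * \<rho> t \<le> 1/128 * (1/4)" using mu r by (intro mult_mono) auto
  have d: "3/4 \<le> scaled_dist \<mu> (\<rho> t) (\<phi> t)" "3/4 \<le> scaled_dist (\<mu> - 1) (\<rho> t) (\<phi> t)"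
    using mu r scaled_dist_bounds'(1)[of "\<rho> t" \<mu> "\<phi> t"] scaled_dist_bounds'(1)[of "\<rho> t" "\<mu> - 1" "\<phi> t"] by auto
  have d2: "scaled_dist \<mu> (\<rho> t) (\<phi> t) \<le> 1 + 1/512" using scaled_dist_bounds(2)[of "\<rho> t" \<mu> "\<phi> t"] mu r k by auto
  have a: "512/513 \<le> 1 / scaled_dist \<mu> (\<rho> t) (\<phi> t)" using d d2 by (simp add: field_simps)
  have b: "1 / scaled_dist \<mu> (\<rho> t) (\<phi> t) \<le> 4/3" "1 / scaled_dist (\<mu> - 1) (\<rho> t) (\<phi> t) \<le> 4/3"
    using d by (auto simp: field_simps)
  have "127/128 * (512/513) \<le> (1 - \<mu>) * (1 / scaled_dist \<mu> (\<rho> t) (\<phi> t))" using a mu by (intro mult_mono) auto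
  moreover have "0 \<le> \<mu> * (1 / scaled_dist (\<mu> - 1) (\<rho> t) (\<phi> t))" using mu d by (intro mult_nonneg_nonneg) auto
  ultimately show "9/10 \<le> m t" unfolding m_def e by linarith
  have "(1 - \<mu>) * (1 / scaled_dist \<mu> (\<rho> t) (\<phi> t)) \<le> 1 * (4/3)" "\<mu> * (1 / scaled_dist (\<mu> - 1) (\<rho> t) (\<phi> t)) \<le> 1/128 * (4/3)"
    using b mu d by (intro mult_mono; force)+
  then show "m t \<le> 2" unfolding m_def e by linarith
qed

text \<open>The terms are grouped so that the inertial energy \<open>h + G\<close> stands alone; the
  remainder is positive and at most of the order of the inverse distance, so far out the sign of
  \<open>h + G\<close> decides.\<close>

lemma energy':
  assumes "0 \<le> t" "0 \<le> P t" shows "(P t)^2 / 2 = h + G t + \<rho> t * (m t - (G t)^2 * \<rho> t / 2)"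
proof -
  have "\<rho> t = 1 / r t" using outgoing(6)[OF assms(2), of t] assms by auto
  then show ?thesis using energy[OF assms]
    by (simp add: polar_energy_def m_def power2_eq_square algebra_simps)
qed

text \<open>The drift leaves \<open>h + G\<close> at least \<open>9 * \<mu>\<close> up to a first
  zero of \<open>P\<close>, where the energy relation would then equate 0 with a positive
  number.\<close>

lemma hyperbolic:
  assumes "17 * \<mu> \<le> h + G 0" "0 \<le> t" shows "0 < P t"
proof (rule ccontr)
  assume "\<not> 0 < P t"
  then have "\<exists>s\<ge>0. s \<le> t \<and> P s = 0"
    using assms P0 by (intro IVT2') (auto simp: P_def[of 0] intro: continuous_on_subset[OF continuous_components(3)])
  then obtain s where s: "0 \<le> s" "P s = 0" by auto
  have "\<bar>G s - G 0\<bar> \<le> 8 * \<mu>" and g: "\<bar>G s\<bar> \<le> 1/4" using outgoing(4,5)[of s s] s by auto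
  then have "h + G s > 0" using assms mu by linarith
  have "(G s)^2 \<le> (1/4)^2" using g by (intro abs_le_square_iff[THEN iffD1]) auto
  then have "(G s)^2 * \<rho> s \<le> (1/4)^2 * (1/4)" using rho[of s] by (intro mult_mono) auto
  then have "0 < m s - (G s)^2 * \<rho> s / 2" using m_bounds[of s] s by (simp add: power2_eq_square)
  then have "0 < \<rho> s * (m s - (G s)^2 * \<rho> s / 2)" using rho[of s] by simp
  then show False using energy'[of s] s \<open>h + G s > 0\<close> by simp
qed

text \<open>On an orbit confined to distance \<open>B\<close> the deceleration is at least
  \<open>(1 / B)^2 / 2\<close>, which exhausts the radial momentum in finite time. The argument
  includes the parabolic borderline, to which it is applied later.\<close>

lemma escape:
  assumes "\<And>t. 0 \<le> t \<Longrightarrow> 0 < P t" shows "\<exists>t\<ge>0. B < r t"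
proof (rule ccontr)
  assume "\<not> (\<exists>t\<ge>0. B < r t)"
  then have B: "r t \<le> B" if "0 \<le> t" for t using that by force
  have B4: "4 \<le> B" using B[of 0] r0 by (simp add: r_def)
  define c where "c = (1 / B)^2 / 2"
  have c: "c > 0" using B4 by (simp add: c_def)
  define t where "t = P 0 / c"
  have t: "0 < t" using P0 c by (simp add: t_def P_def)
  have "P t + c * t \<le> P 0 + c * 0"
  proof (rule DERIV_nonpos_imp_decreasing_open[of 0 t "\<lambda>x. P x + c * x"])
    show "continuous_on {0..t} (\<lambda>x. P x + c * x)"
      by (intro continuous_intros continuous_on_subset[OF continuous_components(3)]) auto
    fix x assume x: "0 < x" "x < t"
    have "1 / B \<le> \<rho> x" using B[of x] B4 x by (auto simp: \<rho>_def intro!: divide_left_mono)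
    then have "(1 / B)^2 \<le> (\<rho> x)^2" using B4 by (intro power_mono) auto
    then show "\<exists>y. DERIV (\<lambda>x. P x + c * x) x :> y \<and> y \<le> 0"
      using P_deriv_le[of x] x
      by (intro exI[of _ "P' x + c * 1"] conjI DERIV_add DERIV_cmult DERIV_ident DERIV_components) (auto simp: c_def)
  qed (use t in auto)
  then have "P t \<le> 0" using c by (simp add: t_def)
  then show False using assms[of t] t by simp
qed

lemma elliptic:
  assumes "h + G 0 \<le> - 17 * \<mu>" shows "\<exists>t\<ge>0. P t \<le> 0"
proof (rule ccontr)
  assume "\<not> (\<exists>t\<ge>0. P t \<le> 0)"
  then have pos: "0 < P t" if "0 \<le> t" for t using that by force
  \<comment> \<open>At this distance the remainder in the energy relation is below
    \<open>\<mu>\<close>, too small to offset \<open>h + G \<le> - \<mu>\<close>.\<close>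
  obtain t where t: "0 \<le> t" "2 / \<mu> < r t" using escape[OF pos] by blast
  have Pt: "0 \<le> P t" using pos[OF t(1)] by simp
  have "h + G t \<le> - \<mu>" using outgoing(4)[OF Pt, of t] t assms mu by auto
  moreover have "\<rho> t * (m t - (G t)^2 * \<rho> t / 2) \<le> \<rho> t * 2"
    using m_bounds[OF t(1) Pt] rho[of t] by (intro mult_left_mono) (auto intro: order_trans[of _ "m t"])
  moreover have "0 \<le> (P t)^2 / 2" by simp
  ultimately have "\<mu> \<le> 2 * \<rho> t" using energy'[OF t(1) Pt] by linarith
  moreover have "\<rho> t = 1 / r t" "4 \<le> r t" using outgoing(1,6)[OF Pt, of t] t by auto
  ultimately have "r t * \<mu> \<le> 2" by (simp add: field_simps)
  then show False using t mu by (simp add: field_simps)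
qed

end

section \<open>Apocentres on the axis of symmetry\<close>

lemma continuous_on_dist_bound:
  assumes "continuous_on S g" "\<And>x y. x \<in> S \<Longrightarrow> y \<in> S \<Longrightarrow> dist (f x) (f y) \<le> C * dist (g x) (g y)"
  shows "continuous_on S f"
  unfolding continuous_on_def
proof
  fix x assume x: "x \<in> S"
  have "((\<lambda>y. C * dist (g y) (g x)) \<longlongrightarrow> C * dist (g x) (g x)) (at x within S)"
    using assms(1) x by (intro tendsto_intros) (auto simp: continuous_on_def)
  then have "((\<lambda>y. C * dist (g y) (g x)) \<longlongrightarrow> 0) (at x within S)" by simp
  then have "((\<lambda>y. dist (f y) (f x)) \<longlongrightarrow> 0) (at x within S)"
    by (rule Lim_null_comparison[rotated]) (use assms(2) x in \<open>auto simp: eventually_at_filter\<close>)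
  then show "(f \<longlongrightarrow> f x) (at x within S)" by (rule tendsto_dist_iff[THEN iffD2])
qed

lemma global_flow:
  fixes F :: "'a::euclidean_space \<Rightarrow> 'a"
  assumes lip: "L-lipschitz_on UNIV F"
  obtains Z where "\<And>x. Z x 0 = x"
    "\<And>x t. 0 \<le> t \<Longrightarrow> (Z x has_vector_derivative F (Z x t)) (at t within {0..})"
    "\<And>x y t. 0 \<le> t \<Longrightarrow> dist (Z x t) (Z y t) \<le> exp (L * t) * dist x y"
proof -
  obtain Z where Z: "\<And>x. Z x 0 = x"
    "\<And>x t. 0 \<le> t \<Longrightarrow> (Z x has_vector_derivative F (Z x t)) (at t within {0..})"
    using global_solution[OF lip] by metis
  have "dist (Z x t) (Z y t) \<le> exp (L * t) * dist x y" if "0 \<le> t" for x y t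
  proof -
    have "(Z x has_vector_derivative F (Z x s)) (at s within {0..t})" if "s \<in> {0..t}" for x s
      using that by (intro has_vector_derivative_within_subset[OF Z(2)]) auto
    from solutions_dist[OF lip this this] show ?thesis using that Z(1) by simp
  qed
  with Z show ?thesis using that by blast
qed

text \<open>Applies to any continuous curve \<open>z0\<close> of initial data whose inertial energy
  changes sign decisively, without control of how often it does so in between. Taking the first
  non-returning parameter \<open>c\<close> ensures that every parameter in \<open>{a..<c}\<close>
  has an apocentre.\<close>

lemma exists_apocentre_on_axis:
  fixes z0 :: "real \<Rightarrow> real \<times> real \<times> real \<times> real"
  assumes mu: "0 < \<mu>" "\<mu> \<le> 1/128" and ab: "a \<le> b" and cont: "continuous_on {a..b} z0"
    and init: "\<And>\<alpha>. \<alpha> \<in> {a..b} \<Longrightarrow> 4 \<le> fst (z0 \<alpha>) \<and> 0 < fst (snd (snd (z0 \<alpha>))) \<and> fst (snd (snd (z0 \<alpha>))) \<le> 1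
      \<and> \<bar>snd (snd (snd (z0 \<alpha>)))\<bar> \<le> 1/8
      \<and> polar_energy \<mu> (fst (z0 \<alpha>)) (fst (snd (z0 \<alpha>))) (fst (snd (snd (z0 \<alpha>)))) (snd (snd (snd (z0 \<alpha>)))) = h"
    and ell: "h + snd (snd (snd (z0 a))) \<le> - 17 * \<mu>"
    and hyp: "17 * \<mu> \<le> h + snd (snd (snd (z0 b)))"
  shows "\<exists>\<alpha>\<in>{a..b}. \<exists>z T. z 0 = z0 \<alpha> \<and> 0 < T \<and> far_orbit \<mu> h z \<and>
    fst (snd (snd (z T))) = 0 \<and> sin (fst (snd (z T))) = 0 \<and> B < fst (z T)"
proof -
  obtain L where lip: "L-lipschitz_on UNIV (far_field \<mu>)"
    using far_field_lipschitz[of \<mu>] mu by auto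
  obtain Z' where Z': "\<And>x. Z' x 0 = x"
    "\<And>x t. 0 \<le> t \<Longrightarrow> (Z' x has_vector_derivative far_field \<mu> (Z' x t)) (at t within {0..})"
    "\<And>x y t. 0 \<le> t \<Longrightarrow> dist (Z' x t) (Z' y t) \<le> exp (L * t) * dist x y"
    using global_flow[OF lip] by metis
  define Z where "Z \<alpha> = Z' (z0 \<alpha>)" for \<alpha>
  have Zd: "dist (Z \<alpha> t) (Z \<beta> t) \<le> exp (L * t) * dist (z0 \<alpha>) (z0 \<beta>)" if "0 \<le> t" for \<alpha> \<beta> t
    using Z'(3)[OF that] by (simp add: Z_def)
  define r where "r \<alpha> t = fst (Z \<alpha> t)" for \<alpha> t
  define \<phi> where "\<phi> \<alpha> t = fst (snd (Z \<alpha> t))" for \<alpha> t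
  define P where "P \<alpha> t = fst (snd (snd (Z \<alpha> t)))" for \<alpha> t
  have fo: "far_orbit \<mu> h (Z \<alpha>)" if "\<alpha> \<in> {a..b}" for \<alpha>
    using init[OF that] mu Z'(1,2) by unfold_locales (auto simp: Z_def)
  have defs: "far_orbit.r (Z \<alpha>) = r \<alpha>" "far_orbit.\<phi> (Z \<alpha>) = \<phi> \<alpha>" "far_orbit.P (Z \<alpha>) = P \<alpha>"
    "far_orbit.G (Z \<alpha>) 0 = snd (snd (snd (z0 \<alpha>)))"
    if "\<alpha> \<in> {a..b}" for \<alpha>
    using far_orbit.r_def[OF fo[OF that]] far_orbit.\<phi>_def[OF fo[OF that]] far_orbit.P_def[OF fo[OF that]]
      far_orbit.G_def[OF fo[OF that]] Z'(1)
    by (auto simp: fun_eq_iff r_def \<phi>_def P_def Z_def)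
  have Pdec: "P \<alpha> t < P \<alpha> s" if "\<alpha> \<in> {a..b}" "0 \<le> s" "s < t" for \<alpha> s t
    using far_orbit.P_decreasing[OF fo[OF that(1)] that(2,3)] defs[OF that(1)] by simp
  have Pc: "continuous_on {0..} (P \<alpha>)" if "\<alpha> \<in> {a..b}" for \<alpha>
    using far_orbit.continuous_components(3)[OF fo[OF that]] defs[OF that] by simp
  have Zc: "continuous_on {0..} (Z \<alpha>)" for \<alpha>
    using Z'(2)[of _ "z0 \<alpha>"]
    by (auto intro!: has_vector_derivative_continuous simp: continuous_on_eq_continuous_within Z_def)
  have Zcont: "continuous_on {a..b} (\<lambda>\<alpha>. Z \<alpha> t)" if "0 \<le> t" for t
    by (rule continuous_on_dist_bound[OF cont Zd[OF that]])
  have Pcont: "continuous_on {a..b} (\<lambda>\<alpha>. P \<alpha> t)" if "0 \<le> t" for t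
    unfolding P_def by (intro continuous_intros Zcont that)
  have rcont: "continuous_on {a..b} (\<lambda>\<alpha>. r \<alpha> t)" if "0 \<le> t" for t
    unfolding r_def by (intro continuous_intros Zcont that)
  \<comment> \<open>The parameters of the orbits that never turn back. The weak inequality makes
    \<open>N\<close> an intersection of closed sets, one for each time.\<close>
  define N where "N = {\<alpha>\<in>{a..b}. \<forall>t\<in>{0..}. 0 \<le> P \<alpha> t}"
  have N_eq: "N = (\<Inter>t\<in>{0..}. {a..b} \<inter> (\<lambda>\<alpha>. P \<alpha> t) -` {0..})"
  proof (rule set_eqI)
    fix \<alpha>
    have "(0::real) \<in> {0..}" by simp
    then show "\<alpha> \<in> N \<longleftrightarrow> \<alpha> \<in> (\<Inter>t\<in>{0..}. {a..b} \<inter> (\<lambda>\<alpha>. P \<alpha> t) -` {0..})"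
      unfolding N_def mem_Collect_eq INT_iff Int_iff vimage_eq atLeast_iff[of "P _ _"] atLeast_iff[of 0 "P _ _"] by blast
  qed
  have cl: "closed ({a..b} \<inter> (\<lambda>\<alpha>. P \<alpha> t) -` {0..})" if "0 \<le> t" for t
    by (rule continuous_closed_preimage[OF Pcont[OF that]]) auto
  have "closed N"
    unfolding N_eq by (rule closed_INT, rule ballI, rule cl, erule atLeast_iff[THEN iffD1])
  have bN: "b \<in> N"
  proof -
    have b: "b \<in> {a..b}" using ab by auto
    show ?thesis using far_orbit.hyperbolic[OF fo[OF b]] hyp b by (force simp: N_def defs[OF b])
  qed
  \<comment> \<open>Strict monotonicity of \<open>P\<close> upgrades the weak inequality: a zero at
    \<open>t\<close> would force a negative value at \<open>t + 1\<close>.\<close>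
  have Npos: "0 < P \<alpha> t" if "\<alpha> \<in> N" "0 \<le> t" for \<alpha> t
  proof -
    have "\<alpha> \<in> {a..b}" "0 \<le> P \<alpha> (t + 1)" using that unfolding N_def by auto
    then show ?thesis using Pdec[of \<alpha> t "t + 1"] that by simp
  qed
  have aN: "a \<notin> N"
  proof -
    have a: "a \<in> {a..b}" using ab by auto
    show ?thesis using far_orbit.elliptic[OF fo[OF a]] ell a Npos[of a] by (force simp: defs[OF a])
  qed
  define c where "c = Inf N"
  have bdd: "bdd_below N" by (auto simp: N_def intro: bdd_belowI)
  have cN: "c \<in> N" unfolding c_def using bN bdd \<open>closed N\<close> by (intro closed_contains_Inf) auto
  then have c: "c \<in> {a..b}" by (auto simp: N_def)
  have ac: "a < c" using cN aN c by (cases "a = c") auto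
  have ltc: "\<alpha> \<in> {a..b}" "\<alpha> \<notin> N" if "\<alpha> \<in> {a..<c}" for \<alpha>
    using that c cInf_lower[OF _ bdd, of \<alpha>] by (auto simp: c_def)
  have sub: "{a..<c} \<subseteq> {a..b}" using ltc(1) by blast
  have "\<exists>T>0. P \<alpha> T = 0" if \<alpha>: "\<alpha> \<in> {a..<c}" for \<alpha>
  proof -
    have P0: "0 < P \<alpha> 0" using init[OF ltc(1)[OF \<alpha>]] Z'(1) by (simp add: P_def Z_def)
    obtain t where t: "0 \<le> t" "P \<alpha> t < 0" using ltc[OF \<alpha>] by (force simp: N_def)
    have "\<exists>s\<ge>0. s \<le> t \<and> P \<alpha> s = 0"
      using P0 t by (intro IVT2') (auto intro: continuous_on_subset[OF Pc[OF ltc(1)[OF \<alpha>]]])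
    then show ?thesis using P0 by (metis less_eq_real_def less_irrefl)
  qed
  then obtain T where T: "\<And>\<alpha>. \<alpha> \<in> {a..<c} \<Longrightarrow> 0 < T \<alpha>" "\<And>\<alpha>. \<alpha> \<in> {a..<c} \<Longrightarrow> P \<alpha> (T \<alpha>) = 0"
    by metis
  have less_T: "t < T \<alpha>" if "\<alpha> \<in> {a..<c}" "0 \<le> t" "0 < P \<alpha> t" for \<alpha> t
    using Pdec[OF ltc(1)[OF that(1)], of "T \<alpha>" t] T[OF that(1)] that by (cases "t = T \<alpha>") force+
  have T_less: "T \<alpha> < t" if "\<alpha> \<in> {a..<c}" "0 \<le> t" "P \<alpha> t < 0" for \<alpha> t
    using Pdec[OF ltc(1)[OF that(1)], of t "T \<alpha>"] T[OF that(1)] that by (cases "t = T \<alpha>") force+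
  \<comment> \<open>The sign of \<open>P \<alpha> y\<close> tells whether \<open>y\<close> lies
    before or after \<open>T \<alpha>\<close>; it is stable in \<open>\<alpha>\<close> for fixed
    \<open>y\<close>, and this gives continuity of \<open>T\<close>.\<close>
  have Tcont: "continuous_on {a..<c} T"
    unfolding continuous_on_def
  proof (intro ballI order_tendstoI)
    fix \<alpha> y assume \<alpha>: "\<alpha> \<in> {a..<c}"
    have Plim: "((\<lambda>\<beta>. P \<beta> t) \<longlongrightarrow> P \<alpha> t) (at \<alpha> within {a..<c})" if "0 \<le> t" for t
      using continuous_on_subset[OF Pcont[OF that] sub] \<alpha> by (auto simp: continuous_on_def)
    have ev: "\<forall>\<^sub>F \<beta> in at \<alpha> within {a..<c}. \<beta> \<in> {a..<c}" by (simp add: eventually_at_filter)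
    show "\<forall>\<^sub>F \<beta> in at \<alpha> within {a..<c}. y < T \<beta>" if y: "y < T \<alpha>"
    proof (cases "0 \<le> y")
      case True
      then have "0 < P \<alpha> y" using Pdec[OF ltc(1)[OF \<alpha>], of y "T \<alpha>"] T[OF \<alpha>] y by simp
      from order_tendstoD(1)[OF Plim[OF True] this] ev show ?thesis
        by eventually_elim (use less_T True in auto)
    next
      case False
      then show ?thesis using ev T(1) by (auto elim!: eventually_mono) (meson less_trans not_le)
    qed
    show "\<forall>\<^sub>F \<beta> in at \<alpha> within {a..<c}. T \<beta> < y" if y: "T \<alpha> < y"
    proof -
      have y0: "0 \<le> y" using T(1)[OF \<alpha>] y by simp
      then have "P \<alpha> y < 0" using Pdec[OF ltc(1)[OF \<alpha>], of "T \<alpha>" y] T[OF \<alpha>] y by simp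
      from order_tendstoD(2)[OF Plim[OF y0] this] ev show ?thesis
        by eventually_elim (use T_less y0 in auto)
    qed
  qed
  \<comment> \<open>Split into the motion of one fixed orbit at the moving time
    \<open>T \<beta>\<close> and the distance of two orbits at that time; the growth factor
    \<open>exp (L * T \<beta>)\<close> stays bounded because \<open>T\<close> is continuous.\<close>
  have ZT: "continuous_on {a..<c} (\<lambda>\<alpha>. Z \<alpha> (T \<alpha>))"
    unfolding continuous_on_def
  proof
    fix \<alpha> assume \<alpha>: "\<alpha> \<in> {a..<c}"
    have ev: "\<forall>\<^sub>F \<beta> in at \<alpha> within {a..<c}. \<beta> \<in> {a..<c}" by (simp add: eventually_at_filter)
    have Tl: "(T \<longlongrightarrow> T \<alpha>) (at \<alpha> within {a..<c})" using Tcont \<alpha> by (auto simp: continuous_on_def)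
    have zl: "(z0 \<longlongrightarrow> z0 \<alpha>) (at \<alpha> within {a..<c})"
      using continuous_on_subset[OF cont sub] \<alpha> by (auto simp: continuous_on_def)
    have "continuous_on {a..<c} (\<lambda>\<beta>. Z \<alpha> (T \<beta>))"
      by (rule continuous_on_compose2[OF Zc Tcont]) (use T(1) in \<open>auto intro: less_imp_le\<close>)
    then have 1: "((\<lambda>\<beta>. Z \<alpha> (T \<beta>)) \<longlongrightarrow> Z \<alpha> (T \<alpha>)) (at \<alpha> within {a..<c})"
      using \<alpha> by (auto simp: continuous_on_def)
    have "((\<lambda>\<beta>. exp (L * T \<beta>) * dist (z0 \<beta>) (z0 \<alpha>)) \<longlongrightarrow> exp (L * T \<alpha>) * dist (z0 \<alpha>) (z0 \<alpha>)) (at \<alpha> within {a..<c})"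
      by (intro tendsto_intros Tl zl)
    then have "((\<lambda>\<beta>. exp (L * T \<beta>) * dist (z0 \<beta>) (z0 \<alpha>)) \<longlongrightarrow> 0) (at \<alpha> within {a..<c})" by simp
    then have "((\<lambda>\<beta>. Z \<beta> (T \<beta>) - Z \<alpha> (T \<beta>)) \<longlongrightarrow> 0) (at \<alpha> within {a..<c})"
      by (rule Lim_null_comparison[rotated])
        (use ev Zd T(1) in \<open>auto elim!: eventually_mono simp: dist_norm less_imp_le\<close>)
    from Lim_transform[OF 1 this] show "((\<lambda>\<alpha>. Z \<alpha> (T \<alpha>)) \<longlongrightarrow> Z \<alpha> (T \<alpha>)) (at \<alpha> within {a..<c})" .
  qed
  have \<phi>T: "continuous_on {a..<c} (\<lambda>\<alpha>. \<phi> \<alpha> (T \<alpha>))"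
    unfolding \<phi>_def by (intro continuous_intros ZT)
  \<comment> \<open>The limiting orbit \<open>c\<close> escapes, so it passes distance
    \<open>B\<close> at some time; nearby orbits inherit this at the same time.\<close>
  obtain tB where tB: "0 \<le> tB" "B < r c tB"
    using far_orbit.escape[OF fo[OF c], of B] Npos[OF cN] by (auto simp: defs[OF c])
  \<comment> \<open>Just to the left of \<open>c\<close> an orbit is still outgoing at any
    prescribed time, so its apocentre time tends to infinity.\<close>
  have near: "\<exists>\<alpha>1. a \<le> \<alpha>1 \<and> \<alpha>1 < c \<and> (\<forall>\<alpha>\<in>{\<alpha>1..<c}. B < r \<alpha> tB \<and> 0 < P \<alpha> t)" if t: "0 \<le> t" for t
  proof -
    have "((\<lambda>\<alpha>. P \<alpha> t) \<longlongrightarrow> P c t) (at c within {a..b})" "((\<lambda>\<alpha>. r \<alpha> tB) \<longlongrightarrow> r c tB) (at c within {a..b})"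
      using Pcont[OF t] rcont[OF tB(1)] c by (auto simp: continuous_on_def)
    then have "\<forall>\<^sub>F \<alpha> in at c within {a..b}. B < r \<alpha> tB \<and> 0 < P \<alpha> t"
      using Npos[OF cN t] tB by (auto intro!: eventually_conj dest: order_tendstoD(1))
    then obtain d where d: "d > 0" "\<And>\<alpha>. \<alpha> \<in> {a..b} \<Longrightarrow> \<alpha> \<noteq> c \<Longrightarrow> dist \<alpha> c < d \<Longrightarrow> B < r \<alpha> tB \<and> 0 < P \<alpha> t"
      unfolding eventually_at by blast
    show ?thesis
      by (rule exI[of _ "max a (c - d / 2)"]) (use d ac c in \<open>auto simp: dist_real_def intro!: d(2)\<close>)
  qed
  obtain \<alpha>1 where \<alpha>1: "a \<le> \<alpha>1" "\<alpha>1 < c" "\<And>\<alpha>. \<alpha> \<in> {\<alpha>1..<c} \<Longrightarrow> B < r \<alpha> tB \<and> 0 < P \<alpha> tB"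
    using near[OF tB(1)] by blast
  obtain K where K: "\<And>\<alpha>. \<alpha> \<in> {a..b} \<Longrightarrow> fst (snd (z0 \<alpha>)) \<le> K"
  proof -
    have "continuous_on {a..b} (\<lambda>\<alpha>. fst (snd (z0 \<alpha>)))" by (intro continuous_intros cont)
    then obtain x where "\<forall>y\<in>{a..b}. fst (snd (z0 y)) \<le> fst (snd (z0 x))"
      using continuous_attains_sup[of "{a..b}" "\<lambda>\<alpha>. fst (snd (z0 \<alpha>))"] ab by auto
    then show ?thesis using that by blast
  qed
  obtain n :: nat where n: "- \<phi> \<alpha>1 (T \<alpha>1) / pi < n" using reals_Archimedean2 by blast
  \<comment> \<open>The target angle: a multiple of \<open>pi\<close> not above the apocentre angle
    of \<open>\<alpha>1\<close>.\<close>
  define y where "y = - (real n * pi)"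
  have y: "y \<le> \<phi> \<alpha>1 (T \<alpha>1)" using n by (simp add: y_def field_simps)
  \<comment> \<open>An apocentre later than this time has an angle below \<open>y\<close>, because
    the angle starts at most at \<open>K\<close> and falls at least at rate
    \<open>1/2\<close>.\<close>
  define t where "t = max 0 (2 * (K - y))"
  have t: "0 \<le> t" "K - t / 2 \<le> y" by (auto simp: t_def max_def field_simps)
  obtain \<alpha>3 where \<alpha>3: "a \<le> \<alpha>3" "\<alpha>3 < c" "\<And>\<alpha>. \<alpha> \<in> {\<alpha>3..<c} \<Longrightarrow> 0 < P \<alpha> t"
    using near[OF t(1)] by blast
  define \<alpha>2 where "\<alpha>2 = max \<alpha>1 \<alpha>3"
  have \<alpha>2: "\<alpha>1 \<le> \<alpha>2" "\<alpha>2 \<in> {a..<c}" "0 < P \<alpha>2 t" using \<alpha>1 \<alpha>3 by (auto simp: \<alpha>2_def)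
  have "\<phi> \<alpha>2 (T \<alpha>2) \<le> K - T \<alpha>2 / 2"
  proof -
    have "\<phi> \<alpha>2 (T \<alpha>2) \<le> \<phi> \<alpha>2 0 - T \<alpha>2 / 2"
      using far_orbit.phi_le[OF fo[OF ltc(1)[OF \<alpha>2(2)]], of "T \<alpha>2"] T(1)[OF \<alpha>2(2)]
      unfolding defs[OF ltc(1)[OF \<alpha>2(2)]] by simp
    moreover have "\<phi> \<alpha>2 0 = fst (snd (z0 \<alpha>2))" by (simp add: \<phi>_def Z_def Z'(1))
    ultimately show ?thesis using K[OF ltc(1)[OF \<alpha>2(2)]] by simp
  qed
  also have "\<dots> \<le> y" using less_T[OF \<alpha>2(2) t(1) \<alpha>2(3)] t by simp
  finally have "\<exists>\<alpha>\<ge>\<alpha>1. \<alpha> \<le> \<alpha>2 \<and> \<phi> \<alpha> (T \<alpha>) = y"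
    using y \<alpha>1 \<alpha>2 by (intro IVT2') (auto intro: continuous_on_subset[OF \<phi>T])
  then obtain \<alpha> where \<alpha>: "\<alpha>1 \<le> \<alpha>" "\<alpha> \<le> \<alpha>2" "\<phi> \<alpha> (T \<alpha>) = y" by blast
  have \<alpha>c: "\<alpha> \<in> {a..<c}" "\<alpha> \<in> {\<alpha>1..<c}" using \<alpha> \<alpha>1 \<alpha>2 by auto
  have "tB < T \<alpha>" using less_T[OF \<alpha>c(1) tB(1)] \<alpha>1(3)[OF \<alpha>c(2)] by blast
  \<comment> \<open>The distance at the apocentre is at least that at the earlier time
    \<open>tB\<close>, which already exceeds \<open>B\<close>.\<close>
  then have "r \<alpha> tB \<le> r \<alpha> (T \<alpha>)"
    using far_orbit.r_mono[OF fo[OF ltc(1)[OF \<alpha>c(1)]], of "T \<alpha>" tB] tB T[OF \<alpha>c(1)]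
    by (simp add: defs[OF ltc(1)[OF \<alpha>c(1)]])
  then have "B < fst (Z \<alpha> (T \<alpha>))" using \<alpha>1(3)[OF \<alpha>c(2)] by (simp add: r_def)
  moreover have "fst (snd (snd (Z \<alpha> (T \<alpha>)))) = 0" using T(2)[OF \<alpha>c(1)] by (simp add: P_def)
  moreover have "sin (fst (snd (Z \<alpha> (T \<alpha>)))) = 0"
    using \<alpha>(3) by (simp add: \<phi>_def y_def)
  moreover have "Z \<alpha> 0 = z0 \<alpha>" by (simp add: Z_def Z'(1))
  ultimately show ?thesis
    using ltc(1)[OF \<alpha>c(1)] T(1)[OF \<alpha>c(1)] fo[OF ltc(1)[OF \<alpha>c(1)]] by blast
qed

section \<open>The kick given by the planet\<close>

text \<open>For \<open>\<mu> = 0\<close> and \<open>h = 0\<close> the ejection orbits are the parabolic radial ones, with distance \<open>s ^ 2 / 2\<close> from the Sun at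
  time \<open>s ^ 3 / 6\<close> in terms of the regularized time \<open>s\<close>. They reach distance 1 at \<open>s = sqrt 2\<close>, and \<open>\<beta>\<close> is the angle from
  the planet at that moment. The kick is the integrated torque of the planet, up to \<open>s = 4\<close>.\<close>

definition phase :: "real \<Rightarrow> real \<Rightarrow> real" where "phase \<beta> s = \<beta> + sqrt 2 / 3 - s ^ 3 / 6"

definition planet_dist :: "real \<Rightarrow> real \<Rightarrow> real" where
  "planet_dist \<beta> s = sqrt (1 + (s^2 / 2)^2 - s^2 * cos (phase \<beta> s))"

text \<open>The torque about the Sun divided by \<open>\<mu>\<close>, times
  \<open>dt/ds = s^2 / 2\<close>. The term 1 in the last factor comes from the acceleration of the
  Sun by the planet, since the Sun-centred frame is not inertial.\<close>

definition kick_density :: "real \<Rightarrow> real \<Rightarrow> real" where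
  "kick_density \<beta> s = (s^2 / 2)^2 * sin (phase \<beta> s) * (1 - (1 / planet_dist \<beta> s) ^ 3)"

text \<open>The disturbing function of perturbation theory, direct minus indirect part, times
  \<open>dt/ds\<close>. Its derivative in \<open>\<beta>\<close> is
  \<open>kick_density\<close>.\<close>

definition potential_density :: "real \<Rightarrow> real \<Rightarrow> real" where
  "potential_density \<beta> s = (s^2 / 2) / planet_dist \<beta> s - (s^2 / 2)^2 * cos (phase \<beta> s)"

definition kick :: "real \<Rightarrow> real" where "kick \<beta> = integral {0..4} (kick_density \<beta>)"
definition potential :: "real \<Rightarrow> real" where "potential \<beta> = integral {0..4} (potential_density \<beta>)"

text \<open>Separates the radial from the angular offset to the planet. For positive
  \<open>s\<close> the expression vanishes only if \<open>s = sqrt 2\<close> and the angle is a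
  multiple of \<open>2 * pi\<close>.\<close>

lemma planet_dist_radicand:
  "1 + (s^2 / 2)^2 - s^2 * cos \<psi> = (s^2 / 2 - 1)^2 + s^2 * (1 - cos \<psi>)" for s \<psi> :: real
  by (simp add: power2_eq_square algebra_simps)

lemma planet_dist_radicand_pos:
  assumes "0 < \<beta>" "\<beta> < 2 * pi" "0 \<le> s"
  shows "0 < 1 + (s^2 / 2)^2 - s^2 * cos (phase \<beta> s)"
proof (cases "s^2 = 2")
  case True
  then have s: "s = sqrt 2" using assms by (metis real_sqrt_unique)
  then have "s ^ 3 = 2 * sqrt 2" by (simp add: power3_eq_cube)
  then have ph: "phase \<beta> s = \<beta>" by (simp add: phase_def)
  have "cos \<beta> \<noteq> 1"
  proof
    assume "cos \<beta> = 1"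
    then obtain n :: int where n: "\<beta> = n * 2 * pi" using cos_one_2pi_int by auto
    then have "0 < real_of_int n" "real_of_int n < 1" using assms by (auto simp: zero_less_mult_iff)
    then show False by simp
  qed
  then have "cos \<beta> < 1" by (metis order_less_le cos_le_one)
  then show ?thesis unfolding planet_dist_radicand ph True by simp
next
  case False
  then have "0 < (s^2 / 2 - 1)^2" by simp
  moreover have "0 \<le> s^2 * (1 - cos (phase \<beta> s))" by simp
  ultimately show ?thesis unfolding planet_dist_radicand by linarith
qed

lemma planet_dist_pos: "0 < \<beta> \<Longrightarrow> \<beta> < 2 * pi \<Longrightarrow> 0 \<le> s \<Longrightarrow> 0 < planet_dist \<beta> s"
  unfolding planet_dist_def using planet_dist_radicand_pos by simp

lemma planet_dist_nz: "0 < \<beta> \<Longrightarrow> \<beta> < 2 * pi \<Longrightarrow> 0 \<le> s \<Longrightarrow> planet_dist \<beta> s \<noteq> 0"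
  using planet_dist_pos[of \<beta> s] by simp

lemma continuous_on_planet_dist [continuous_intros]:
  fixes f g :: "'a::t2_space \<Rightarrow> real" shows
  "continuous_on A f \<Longrightarrow> continuous_on A g \<Longrightarrow> continuous_on A (\<lambda>x. planet_dist (f x) (g x))"
  unfolding planet_dist_def phase_def by (auto intro!: continuous_intros)

lemma continuous_on_kick_density:
  "continuous_on ({0<..<2*pi} \<times> {0..}) (\<lambda>(\<beta>, s). kick_density \<beta> s)"
  unfolding kick_density_def split_beta phase_def
  by (intro continuous_intros) (auto simp: planet_dist_nz)

lemma continuous_on_kick_density_snd:
  assumes "0 < \<beta>" "\<beta> < 2 * pi" "A \<subseteq> {0..}" shows "continuous_on A (kick_density \<beta>)"
  unfolding kick_density_def[abs_def] phase_def
  by (intro continuous_intros) (use assms in \<open>auto simp: planet_dist_nz\<close>)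

lemma continuous_on_potential_density_snd:
  assumes "0 < \<beta>" "\<beta> < 2 * pi" "A \<subseteq> {0..}" shows "continuous_on A (potential_density \<beta>)"
  unfolding potential_density_def[abs_def] phase_def
  by (intro continuous_intros) (use assms in \<open>auto simp: planet_dist_nz\<close>)

lemma potential_density_deriv:
  assumes "0 < \<beta>" "\<beta> < 2 * pi" "0 \<le> s"
  shows "((\<lambda>\<beta>. potential_density \<beta> s) has_real_derivative kick_density \<beta> s) (at \<beta> within U)"
proof -
  have ph: "((\<lambda>\<beta>. phase \<beta> s) has_real_derivative 1) (at \<beta> within U)"
    unfolding phase_def by (auto intro!: derivative_eq_intros)
  have X: "((\<lambda>\<beta>. 1 + (s^2 / 2)^2 - s^2 * cos (phase \<beta> s)) has_real_derivative s^2 * sin (phase \<beta> s)) (at \<beta> within U)"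
    by (auto intro!: derivative_eq_intros ph)
  have 1: "((\<lambda>\<beta>. (s^2 / 2) / planet_dist \<beta> s) has_real_derivative
     - ((s^2 / 2) / planet_dist \<beta> s ^ 3 * (s^2 * sin (phase \<beta> s)) / 2)) (at \<beta> within U)"
    unfolding planet_dist_def
    by (rule has_real_derivative_inverse_sqrt[OF X]) (rule planet_dist_radicand_pos[OF assms])
  have 2: "((\<lambda>\<beta>. (s^2 / 2)^2 * cos (phase \<beta> s)) has_real_derivative - ((s^2 / 2)^2 * sin (phase \<beta> s))) (at \<beta> within U)"
    by (auto intro!: derivative_eq_intros ph)
  show ?thesis unfolding potential_density_def
    by (rule DERIV_cong[OF DERIV_diff[OF 1 2]])
       (simp add: kick_density_def power_divide power2_eq_square algebra_simps)
qed

lemma potential_deriv: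
  assumes "0 < \<beta>" "\<beta> < 2 * pi"
  shows "DERIV potential \<beta> :> kick \<beta>"
proof -
  have "((\<lambda>\<beta>. integral (cbox 0 4) (potential_density \<beta>)) has_field_derivative integral (cbox 0 4) (kick_density \<beta>))
     (at \<beta> within {0<..<2*pi})"
  proof (rule leibniz_rule_field_derivative)
    show "continuous_on ({0<..<2*pi} \<times> cbox 0 4) (\<lambda>(\<beta>, s). kick_density \<beta> s)"
      by (rule continuous_on_subset[OF continuous_on_kick_density]) auto
    show "potential_density \<beta> integrable_on cbox 0 4" if "\<beta> \<in> {0<..<2*pi}" for \<beta>
      using that by (intro integrable_continuous continuous_on_potential_density_snd) auto
  qed (use assms potential_density_deriv in auto)
  moreover have "at \<beta> within {0<..<2*pi} = at \<beta>" using assms by (intro at_within_open) auto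
  ultimately show ?thesis by (simp add: potential_def[abs_def] kick_def)
qed

text \<open>The logarithmic singularity: \<open>\<beta> = 0\<close> and \<open>\<beta> = 2 * pi\<close> both correspond to the unperturbed parabolic
  ejection orbit that runs into the planet, at \<open>s = sqrt 2\<close>.\<close>

lemma potential_ge:
  assumes b: "0 < \<beta>" "\<beta> < 2 * pi" and e: "\<beta> = \<epsilon> \<or> \<beta> = 2 * pi - \<epsilon>" "0 < \<epsilon>"
  shows "- ln \<epsilon> / 8 - 256 \<le> potential \<beta>"
proof -
  let ?a = "sqrt 2" and ?b = "sqrt 2 + 1"
  have s2: "1 \<le> sqrt 2" "sqrt 2 \<le> 3/2"
    by simp (rule real_le_lsqrt, auto simp: power2_eq_square)
  \<comment> \<open>At time \<open>\<sigma> = s - sqrt 2\<close> after reaching distance 1, the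
    distance from the planet is at most \<open>2 * (\<epsilon> + 4 * \<sigma>)\<close> and the
    numerator of \<open>f\<close> is at least 1. The integral of \<open>g\<close> over a unit
    interval is explicit and produces the logarithm.\<close>
  define g where "g s = 1 / (2 * (\<epsilon> + 4 * (s - sqrt 2)))" for s
  define f where "f s = (s^2 / 2) / planet_dist \<beta> s" for s
  have fc: "continuous_on A f" if "A \<subseteq> {0..}" for A
    unfolding f_def by (intro continuous_intros) (use that b in \<open>auto simp: planet_dist_nz\<close>)
  have gc: "continuous_on {?a..?b} g"
    unfolding g_def by (intro continuous_intros) (use e in auto)
  have "g s \<le> f s" if s: "s \<in> {?a..?b}" for s
  proof -
    define \<sigma> where "\<sigma> = s - sqrt 2"
    have \<sigma>: "0 \<le> \<sigma>" "\<sigma> \<le> 1" using s by (auto simp: \<sigma>_def)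
    have se: "s = sqrt 2 + \<sigma>" by (simp add: \<sigma>_def)
    have s2': "s^2 = 2 + 2 * (sqrt 2 * \<sigma>) + \<sigma>^2" unfolding se by (simp add: power2_sum)
    have s3: "s ^ 3 = 2 * sqrt 2 + \<sigma> * (6 + 3 * sqrt 2 * \<sigma> + \<sigma>^2)"
      unfolding se by (simp add: power3_eq_cube power2_eq_square algebra_simps)
    have q: "\<sigma>^2 \<le> \<sigma>" using \<sigma> by (simp add: power2_eq_square mult_left_le)
    have q2: "sqrt 2 * \<sigma> \<le> 3/2 * \<sigma>" using s2 \<sigma> by (intro mult_right_mono) auto
    have "s ^ 3 / 6 - sqrt 2 / 3 = \<sigma> * (6 + 3 * sqrt 2 * \<sigma> + \<sigma>^2) / 6"
      by (simp add: s3 add_divide_distrib)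
    also have "\<dots> \<le> \<sigma> * 12 / 6" using \<sigma> q q2 by (intro divide_right_mono mult_left_mono) auto
    finally have A: "s ^ 3 / 6 - sqrt 2 / 3 \<le> 2 * \<sigma>" by simp
    have A0: "0 \<le> s ^ 3 / 6 - sqrt 2 / 3" using \<sigma> s2 by (simp add: s3)
    have n: "0 \<le> sqrt 2 * \<sigma>" using \<sigma> by simp
    \<comment> \<open>The quadratic term \<open>\<sigma>^2\<close> and the product
      \<open>sqrt 2 * \<sigma>\<close> become variables here, which turns the bounds into linear
      arithmetic.\<close>
    have lin: "(2 + 2 * \<tau> + \<xi>) / 2 - 1 \<le> 2 * x \<and> 0 \<le> (2 + 2 * \<tau> + \<xi>) / 2 - 1 \<and> 2 + 2 * \<tau> + \<xi> \<le> 8"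
      if "\<xi> \<le> x" "\<tau> \<le> 3/2 * x" "0 \<le> x" "x \<le> 1" "0 \<le> \<tau>" "0 \<le> \<xi>" for \<tau> \<xi> x :: real
      using that by (auto simp: field_simps)
    have B: "s^2 / 2 - 1 \<le> 2 * \<sigma>" "0 \<le> s^2 / 2 - 1" "s^2 \<le> 8" using lin[OF q q2 \<sigma> n zero_le_power2[of \<sigma>]] unfolding s2' by auto
    \<comment> \<open>Reduces the phase modulo \<open>2 * pi\<close> and up to sign, so that both
      ends of the parameter interval are treated by one small angle.\<close>
    have "\<exists>\<psi>. cos (phase \<beta> s) = cos \<psi> \<and> \<bar>\<psi>\<bar> \<le> \<epsilon> + 2 * \<sigma>"
    proof (cases "\<beta> = \<epsilon>")
      case True
      then show ?thesis using A A0 e by (intro exI[of _ "phase \<beta> s"]) (auto simp: phase_def)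
    next
      case False
      then have b2: "\<beta> = 2 * pi - \<epsilon>" using e by auto
      have "cos (phase \<beta> s) = cos (\<epsilon> + (s ^ 3 / 6 - sqrt 2 / 3))"
        using cos_minus[of "\<epsilon> + (s ^ 3 / 6 - sqrt 2 / 3)"] cos_periodic[of "- (\<epsilon> + (s ^ 3 / 6 - sqrt 2 / 3))"]
        by (simp add: phase_def b2 algebra_simps)
      then show ?thesis using A A0 e by (intro exI[of _ "\<epsilon> + (s ^ 3 / 6 - sqrt 2 / 3)"]) auto
    qed
    then obtain \<psi> where \<psi>: "cos (phase \<beta> s) = cos \<psi>" "\<bar>\<psi>\<bar> \<le> \<epsilon> + 2 * \<sigma>" by blast
    have "1 - cos \<psi> = 2 * (sin (\<psi> / 2))^2" using cos_double_sin[of "\<psi> / 2"] by simp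
    also have "(sin (\<psi> / 2))^2 \<le> (\<psi> / 2)^2" using abs_sin_x_le_abs_x[of "\<psi> / 2"] by (simp only: abs_le_square_iff)
    finally have c: "1 - cos \<psi> \<le> \<psi>^2 / 2" by (simp add: power2_eq_square)
    have "s^2 * (1 - cos \<psi>) \<le> 8 * (\<psi>^2 / 2)" using B c by (intro mult_mono) auto
    also have "\<psi>^2 \<le> (\<epsilon> + 2 * \<sigma>)^2" using \<psi>(2) by (simp add: abs_le_square_iff[symmetric])
    finally have 1: "s^2 * (1 - cos \<psi>) \<le> 4 * (\<epsilon> + 2 * \<sigma>)^2" by simp
    have 2: "(s^2 / 2 - 1)^2 \<le> (2 * \<sigma>)^2" using B by (intro power_mono) auto
    have "0 \<le> \<epsilon> * \<sigma>" "0 \<le> \<sigma>^2" using e \<sigma> by auto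
    then have "(2 * \<sigma>)^2 + 4 * (\<epsilon> + 2 * \<sigma>)^2 \<le> (2 * (\<epsilon> + 4 * \<sigma>))^2"
      by (simp add: power2_eq_square algebra_simps)
    then have "planet_dist \<beta> s \<le> 2 * (\<epsilon> + 4 * \<sigma>)"
      unfolding planet_dist_def planet_dist_radicand \<psi>(1) using 1 2 e \<sigma> by (intro real_le_lsqrt) auto
    moreover have "0 < planet_dist \<beta> s" using b \<sigma> by (intro planet_dist_pos) (auto simp: se)
    ultimately show ?thesis using B(2) unfolding g_def f_def \<sigma>_def[symmetric] by (intro frac_le) auto
  qed
  then have "integral {?a..?b} g \<le> integral {?a..?b} f"
    using s2 by (intro integral_le integrable_continuous_real gc fc) auto
  also have "\<dots> \<le> integral {0..4} f"
    using s2 b by (intro integral_subset_le integrable_continuous_real fc)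
      (auto simp: f_def planet_dist_pos less_imp_le)
  finally have 1: "integral {?a..?b} g \<le> integral {0..4} f" .
  have "(g has_integral ln (\<epsilon> + 4 * (?b - sqrt 2)) / 8 - ln (\<epsilon> + 4 * (?a - sqrt 2)) / 8) {?a..?b}"
    unfolding g_def using e
    by (intro fundamental_theorem_of_calculus)
       (auto intro!: derivative_eq_intros simp: has_real_derivative_iff_has_vector_derivative[symmetric] field_simps)
  then have "integral {?a..?b} g = ln (\<epsilon> + 4) / 8 - ln \<epsilon> / 8" by (simp add: integral_unique)
  moreover have "0 \<le> ln (\<epsilon> + 4)" using e by (intro ln_ge_zero) auto
  ultimately have 2: "- ln \<epsilon> / 8 \<le> integral {0..4} f" using 1 by simp
  \<comment> \<open>The indirect part has no singularity: its density is at most 64 on an interval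
    of length 4, which is the source of 256.\<close>
  define k where "k s = (s^2 / 2)^2 * cos (phase \<beta> s)" for s
  have kc: "continuous_on {0..4} k" unfolding k_def phase_def by (intro continuous_intros) auto
  have "integral {0..4} k \<le> integral {0..4} (\<lambda>s::real. 64)"
  proof (intro integral_le integrable_continuous_real kc)
    fix s :: real assume s: "s \<in> {0..4}"
    have "s^2 \<le> 4^2" using s by (intro power_mono) auto
    then have "(s^2 / 2)^2 \<le> 8^2" by (intro power_mono) auto
    then have "(s^2 / 2)^2 * cos (phase \<beta> s) \<le> 8^2 * 1"
      by (intro order_trans[OF mult_left_mono[OF cos_le_one]]) auto
    then show "k s \<le> 64" by (simp add: k_def)
  qed auto
  then have 3: "integral {0..4} k \<le> 256" by simp
  have "potential \<beta> = integral {0..4} f - integral {0..4} k"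
    unfolding potential_def potential_density_def[abs_def] f_def[symmetric] k_def[symmetric]
    by (intro integral_diff integrable_continuous_real fc kc) auto
  then show ?thesis using 2 3 by simp
qed

text \<open>The potential exceeds its value at \<open>pi\<close> by any amount near both ends of the
  interval, so the mean value theorem on either half yields steep slopes of opposite signs. The size
  30 covers all errors of order \<open>\<mu>\<close> made later.\<close>

lemma kick_both_signs:
  obtains \<beta>1 \<beta>2 where "0 < \<beta>1" "\<beta>1 < \<beta>2" "\<beta>2 < 2 * pi" "kick \<beta>1 \<le> - 30" "30 \<le> kick \<beta>2"
proof -
  define X where "X = \<bar>potential pi\<bar> + 30 * pi"
  \<comment> \<open>Chosen so that the logarithmic lower bound at distance \<open>\<epsilon>\<close>
    from either end equals \<open>X\<close>.\<close>
  define \<epsilon> where "\<epsilon> = exp (- (8 * (X + 256)))"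
  have X: "0 \<le> X" "potential pi + 30 * pi \<le> X" by (auto simp: X_def)
  have eps: "0 < \<epsilon>" "\<epsilon> < 1" using X by (auto simp: \<epsilon>_def)
  have pi2: "2 \<le> pi" using pi_ge_two .
  have eq: "- ln \<epsilon> / 8 - 256 = X" by (simp add: \<epsilon>_def add_divide_distrib)
  have lo: "potential pi + 30 * pi \<le> potential \<epsilon>" "potential pi + 30 * pi \<le> potential (2 * pi - \<epsilon>)"
    using potential_ge[of \<epsilon> \<epsilon>] potential_ge[of "2 * pi - \<epsilon>" \<epsilon>] eps pi2 eq X by auto
  have d: "DERIV potential x :> kick x" if "\<epsilon> \<le> x" "x \<le> 2 * pi - \<epsilon>" for x
    using potential_deriv that eps by auto
  obtain x where x: "\<epsilon> < x" "x < pi" "potential pi - potential \<epsilon> = (pi - \<epsilon>) * kick x"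
    using MVT2[of \<epsilon> pi potential kick] d eps pi2 by auto
  obtain y where y: "pi < y" "y < 2 * pi - \<epsilon>" "potential (2 * pi - \<epsilon>) - potential pi = (2 * pi - \<epsilon> - pi) * kick y"
    using MVT2[of pi "2 * pi - \<epsilon>" potential kick] d eps pi2 by auto
  have 1: "(pi - \<epsilon>) * kick x \<le> - (30 * pi)" "30 * pi \<le> (pi - \<epsilon>) * kick y" using lo x y by auto
  have kx: "kick x \<le> - 30"
  proof (rule ccontr)
    assume "\<not> kick x \<le> - 30"
    then have "(pi - \<epsilon>) * (- 30) < (pi - \<epsilon>) * kick x" using eps pi2 by (intro mult_strict_left_mono) auto
    then show False using 1 eps by (simp add: algebra_simps)
  qed
  have ky: "30 \<le> kick y"
  proof (rule ccontr)
    assume "\<not> 30 \<le> kick y"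
    then have "(pi - \<epsilon>) * kick y < (pi - \<epsilon>) * 30" using eps pi2 by (intro mult_strict_left_mono) auto
    then show False using 1 eps by (simp add: algebra_simps)
  qed
  show ?thesis using that[of x y] x y kx ky eps by auto
qed

section \<open>Levi-Civita regularization at the Sun\<close>

type_synonym lc_state = "complex \<times> complex \<times> real \<times> real \<times> real \<times> real"

text \<open>The variables are \<open>q + \<mu> = u^2\<close> and \<open>w = 2 * cnj u * (p + \<i> * \<mu>)\<close>, with time \<open>dt = (cmod u)^2 ds\<close>; \<open>k\<close> is the inverse
  distance from the planet. The singular term of the equation for \<open>w\<close> has been removed by means of the energy relation.
  The remaining components of the state are \<open>\<mu>\<close> and \<open>h\<close> (constant, so that continuous dependence on parameters becomes
  dependence on initial values), the physical time, and the angular momentum about the Sun divided by \<open>\<mu>\<close>.\<close>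

definition lc_rhs :: "complex \<Rightarrow> complex \<Rightarrow> real \<Rightarrow> real \<Rightarrow> real \<Rightarrow> lc_state" where
  "lc_rhs u w \<mu> h k =
    ((1/4) * w - (\<i> / 2) * of_real (Re (u * cnj u)) * u,
     u * of_real (Im (cnj u * w) - 2 * \<mu> * Re (u^2) + 2 * \<mu> * k + \<mu>^2 + 2 * h)
       - (\<i> / 2) * of_real (Re (u * cnj u)) * w
       - of_real (2 * \<mu> * Re (u * cnj u)) * cnj u * (1 + (u^2 - 1) * of_real (k ^ 3)),
     0, 0, Re (u * cnj u), Re (u * cnj u) * Im (u^2) * (1 - k ^ 3))"

definition clampc :: "real \<Rightarrow> complex \<Rightarrow> complex" where
  "clampc N u = of_real (clamp_abs N (Re u)) + \<i> * of_real (clamp_abs N (Im u))"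

lemma clampc_eq:
  assumes "cmod u \<le> N" shows "clampc N u = u"
proof -
  have "\<bar>Re u\<bar> \<le> N" "\<bar>Im u\<bar> \<le> N" using assms abs_Re_le_cmod[of u] abs_Im_le_cmod[of u] by linarith+
  then show ?thesis by (simp add: clampc_def clamp_abs_eq complex_eq_iff)
qed

lemma bdd_lip_clampc: "lip f \<Longrightarrow> 0 \<le> N \<Longrightarrow> bdd_lip (\<lambda>x. clampc N (f x))"
  unfolding clampc_def by (intro bdd_lip_intros bdd_lip_clamp_abs lip_Re lip_Im)

text \<open>The cut at \<open>\<delta>\<close> removes the singularity at the planet. The bound 5
  leaves space around the parabolic orbits, on which \<open>cmod u \<le> 15/4\<close> and
  \<open>cmod w \<le> 3\<close> up to \<open>s = 5\<close>.\<close>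

definition near_field :: "real \<Rightarrow> lc_state \<Rightarrow> lc_state" where
  "near_field \<delta> z = lc_rhs (clampc 5 (fst z)) (clampc 5 (fst (snd z)))
     (clamp_abs 1 (fst (snd (snd z)))) (clamp_abs 1 (fst (snd (snd (snd z)))))
     (1 / max \<delta> (cmod ((clampc 5 (fst z))^2 - 1)))"

lemma near_field_lipschitz:
  assumes "0 < \<delta>"
  obtains L where "L-lipschitz_on UNIV (near_field \<delta>)"
proof -
  have u: "bdd_lip (\<lambda>z :: lc_state. clampc 5 (fst z))" "bdd_lip (\<lambda>z :: lc_state. clampc 5 (fst (snd z)))"
    by (intro bdd_lip_clampc lip_fst lip_snd lip_id; simp)+
  have m: "bdd_lip (\<lambda>z :: lc_state. clamp_abs 1 (fst (snd (snd z))))" "bdd_lip (\<lambda>z :: lc_state. clamp_abs 1 (fst (snd (snd (snd z)))))"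
    by (intro bdd_lip_clamp_abs lip_fst lip_snd lip_id; simp)+
  have "lip (\<lambda>z :: lc_state. max \<delta> (cmod ((clampc 5 (fst z))^2 - 1)))"
    by (intro lip_max lip_norm bdd_lip_lip bdd_lip_intros u)
  then have k: "bdd_lip (\<lambda>z :: lc_state. 1 / max \<delta> (cmod ((clampc 5 (fst z))^2 - 1)))"
    by (rule bdd_lip_inverse[OF _ assms]) simp
  have "bdd_lip (near_field \<delta>)"
    unfolding near_field_def[abs_def] lc_rhs_def by (intro bdd_lip_intros u m k)
  then show ?thesis using that by (auto simp: bdd_lip_def lip_def)
qed

lemma near_field_eq:
  assumes "cmod u \<le> 5" "cmod w \<le> 5" "\<bar>\<mu>\<bar> \<le> 1" "\<bar>h\<bar> \<le> 1" "\<delta> \<le> cmod (u^2 - 1)"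
  shows "near_field \<delta> (u, w, \<mu>, h, x) = lc_rhs u w \<mu> h (1 / cmod (u^2 - 1))"
  using assms by (simp add: near_field_def clampc_eq clamp_abs_eq max_absorb2)

text \<open>The explicit solution for \<open>\<mu> = h = 0\<close>. Because the angular momentum is
  stored divided by \<open>\<mu>\<close>, its last component does not vanish but equals
  \<open>kick \<beta>\<close> at \<open>s = 4\<close>.\<close>

definition parabolic_ejection :: "real \<Rightarrow> real \<Rightarrow> lc_state" where
  "parabolic_ejection \<beta> s = (of_real (sqrt 2 / 2 * s) * cis (phase \<beta> s / 2), of_real (2 * sqrt 2) * cis (phase \<beta> s / 2),
     0, 0, s ^ 3 / 6, integral {0..s} (kick_density \<beta>))"

lemma cis_half_square: "(cis (x / 2))^2 = cis x"
  unfolding power2_eq_square cis_mult by simp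

lemma parabolic_square: "(of_real (sqrt 2 / 2 * s) * cis (phase \<beta> s / 2))^2 = of_real (s^2 / 2) * cis (phase \<beta> s)"
  by (simp add: power_mult_distrib cis_half_square power_divide flip: of_real_power)

lemma cmod_parabolic: "cmod (of_real (s^2 / 2) * cis (phase \<beta> s) - 1) = planet_dist \<beta> s"
proof -
  have "(s^2 / 2 * cos (phase \<beta> s) - 1)^2 + (s^2 / 2 * sin (phase \<beta> s))^2
    = 1 + (s^2 / 2)^2 * ((cos (phase \<beta> s))^2 + (sin (phase \<beta> s))^2) - s^2 * cos (phase \<beta> s)"
    by (simp only: power_mult_distrib distrib_left power2_diff) (simp add: algebra_simps)
  then show ?thesis unfolding planet_dist_def cmod_def by simp
qed

lemma parabolic_ejection_solution:
  assumes b: "0 < \<beta>" "\<beta> < 2 * pi" and d: "\<And>s. s \<in> {0..5} \<Longrightarrow> \<delta> \<le> planet_dist \<beta> s" and s: "s \<in> {0..5}"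
  shows "(parabolic_ejection \<beta> has_vector_derivative near_field \<delta> (parabolic_ejection \<beta> s)) (at s within {0..5})"
proof -
  define c where "c = cis (phase \<beta> s / 2)"
  define u where "u = of_real (sqrt 2 / 2 * s) * c"
  define w where "w = of_real (2 * sqrt 2) * c"
  have s2: "sqrt 2 \<le> 3/2" by (rule real_le_lsqrt) (auto simp: power2_eq_square)
  have "sqrt 2 * s \<le> 3/2 * 5" using s s2 by (intro mult_mono) auto
  then have "cmod u \<le> 5" using s by (simp add: u_def c_def norm_mult)
  moreover have "cmod w \<le> 5" using s2 by (simp add: w_def c_def norm_mult)
  moreover have u2: "u^2 = of_real (s^2 / 2) * cis (phase \<beta> s)" unfolding u_def c_def by (rule parabolic_square)
  then have k: "cmod (u^2 - 1) = planet_dist \<beta> s" by (simp only: cmod_parabolic)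
  ultimately have nf: "near_field \<delta> (parabolic_ejection \<beta> s) = lc_rhs u w 0 0 (1 / planet_dist \<beta> s)"
    using near_field_eq[of u w 0 0 \<delta>] d[OF s] by (simp add: parabolic_ejection_def u_def w_def c_def)
  have cc: "c * cnj c = 1" by (simp add: c_def complex_norm_square[symmetric])
  have r: "u * cnj u = of_real (s^2 / 2)"
  proof -
    have "u * cnj u = of_real ((sqrt 2 / 2 * s)^2) * (c * cnj c)" by (simp add: u_def power2_eq_square)
    then show ?thesis by (simp add: cc power_mult_distrib power_divide)
  qed
  have g: "Im (cnj u * w) = 0"
  proof -
    have "cnj u * w = of_real (sqrt 2 / 2 * s * (2 * sqrt 2)) * (c * cnj c)" by (simp add: u_def w_def)
    then show ?thesis by (simp only: cc mult_1_right Im_complex_of_real)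
  qed
  have I: "Im (u^2) = s^2 / 2 * sin (phase \<beta> s)" unfolding u2 by simp
  have rhs: "lc_rhs u w 0 0 (1 / planet_dist \<beta> s) =
    ((1/4) * w - (\<i> / 2) * of_real (s^2 / 2) * u, - ((\<i> / 2) * of_real (s^2 / 2) * w), 0, 0, s^2 / 2, kick_density \<beta> s)"
    unfolding lc_rhs_def g r I by (simp add: kick_density_def power2_eq_square)
  have ph: "((\<lambda>s. phase \<beta> s / 2) has_real_derivative - (s^2 / 4)) (at s within {0..5})"
    unfolding phase_def by (auto intro!: derivative_eq_intros simp: power2_eq_square)
  have c': "((\<lambda>s. cis (phase \<beta> s / 2)) has_vector_derivative of_real (- (s^2 / 4)) * (\<i> * c)) (at s within {0..5})"
    unfolding c_def by (rule has_vector_derivative_cis[OF ph])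
  have u': "((\<lambda>s. of_real (sqrt 2 / 2 * s) * cis (phase \<beta> s / 2)) has_vector_derivative
     of_real (sqrt 2 / 2 * s) * (of_real (- (s^2 / 4)) * (\<i> * c)) + of_real (sqrt 2 / 2) * cis (phase \<beta> s / 2)) (at s within {0..5})"
    by (intro has_vector_derivative_mult c' has_vector_derivative_of_real)
       (auto intro!: derivative_eq_intros simp: has_real_derivative_iff_has_vector_derivative[symmetric])
  have w': "((\<lambda>s. of_real (2 * sqrt 2) * cis (phase \<beta> s / 2)) has_vector_derivative
     of_real (2 * sqrt 2) * (of_real (- (s^2 / 4)) * (\<i> * c))) (at s within {0..5})"
    by (intro has_vector_derivative_mult_right c')
  have t': "((\<lambda>s. s ^ 3 / 6) has_vector_derivative s^2 / 2) (at s within {0..5})"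
    by (auto intro!: derivative_eq_intros simp: has_real_derivative_iff_has_vector_derivative[symmetric])
  have G': "((\<lambda>s. integral {0..s} (kick_density \<beta>)) has_vector_derivative kick_density \<beta> s) (at s within {0..5})"
    by (intro integral_has_vector_derivative continuous_on_kick_density_snd b s) auto
  have e1: "of_real (sqrt 2 / 2 * s) * (of_real (- (s^2 / 4)) * (\<i> * c)) + of_real (sqrt 2 / 2) * cis (phase \<beta> s / 2)
     = (1/4) * w - (\<i> / 2) * of_real (s^2 / 2) * u"
    unfolding u_def w_def c_def[symmetric] by (simp add: algebra_simps)
  have e2: "of_real (2 * sqrt 2) * (of_real (- (s^2 / 4)) * (\<i> * c)) = - ((\<i> / 2) * of_real (s^2 / 2) * w)"
    unfolding w_def by (simp add: algebra_simps)
  show ?thesis unfolding nf rhs unfolding parabolic_ejection_def[abs_def]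
    by (intro has_vector_derivative_Pair u'[unfolded e1] w'[unfolded e2] t' G' has_vector_derivative_const)
qed

lemma planet_dist_lower_bound:
  assumes "0 < \<beta>1" "\<beta>1 \<le> \<beta>2" "\<beta>2 < 2 * pi"
  obtains \<delta> where "0 < \<delta>" "\<And>\<beta> s. \<beta> \<in> {\<beta>1..\<beta>2} \<Longrightarrow> s \<in> {0..5} \<Longrightarrow> \<delta> \<le> planet_dist \<beta> s"
proof -
  have "compact ({\<beta>1..\<beta>2} \<times> {0..5::real})" by (intro compact_Times compact_Icc)
  moreover have "{\<beta>1..\<beta>2} \<times> {0..5::real} \<noteq> {}" using assms by auto
  moreover have "continuous_on ({\<beta>1..\<beta>2} \<times> {0..5::real}) (\<lambda>x. planet_dist (fst x) (snd x))"
    by (intro continuous_intros)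
  ultimately obtain x where x: "x \<in> {\<beta>1..\<beta>2} \<times> {0..5::real}"
    "\<forall>y\<in>{\<beta>1..\<beta>2} \<times> {0..5}. planet_dist (fst x) (snd x) \<le> planet_dist (fst y) (snd y)"
    using continuous_attains_inf by blast
  show ?thesis
    by (rule that[of "planet_dist (fst x) (snd x)"]) (use x assms in \<open>auto intro!: planet_dist_pos\<close>)
qed

text \<open>At \<open>u = 0\<close> the regularized energy relation reads
  \<open>(cmod w)^2 = 8 * (1 - \<mu>)\<close>, so an ejection orbit is determined by the direction
  of \<open>w\<close> alone; \<open>\<beta>\<close> encodes this direction.\<close>

definition near_ejection :: "real \<Rightarrow> real \<Rightarrow> real \<Rightarrow> real \<Rightarrow> (real \<Rightarrow> lc_state) \<Rightarrow> bool" where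
  "near_ejection \<mu> h \<beta> \<epsilon> z \<longleftrightarrow> z 0 = (0, of_real (sqrt (8 * (1 - \<mu>))) * cis (phase \<beta> 0 / 2), \<mu>, h, 0, 0) \<and>
          (\<forall>s\<in>{0..5}. (z has_vector_derivative
              lc_rhs (fst (z s)) (fst (snd (z s))) \<mu> h (1 / cmod ((fst (z s))^2 - 1))) (at s within {0..5}) \<and>
            (fst (z s))^2 \<noteq> 1 \<and> (0 < s \<longrightarrow> fst (z s) \<noteq> 0) \<and>
            dist (z s) (parabolic_ejection \<beta> s) \<le> \<epsilon>)"

definition near_family :: "real \<Rightarrow> real \<Rightarrow> real set \<Rightarrow> real \<Rightarrow> (real \<Rightarrow> real \<Rightarrow> lc_state) \<Rightarrow> bool" where
  "near_family \<mu> h A \<epsilon> Z \<longleftrightarrow> continuous_on A (\<lambda>\<beta>. Z \<beta> 4) \<and> (\<forall>\<beta>\<in>A. near_ejection \<mu> h \<beta> \<epsilon> (Z \<beta>))"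

text \<open>Comparison with the parabolic orbits on the fixed interval \<open>{0..5}\<close>,
  uniformly in \<open>\<beta>\<close>. It extends past the matching point \<open>s = 4\<close> so
  that this point is interior.\<close>

lemma near_orbits:
  assumes b: "0 < \<beta>1" "\<beta>1 \<le> \<beta>2" "\<beta>2 < 2 * pi" and \<epsilon>: "0 < \<epsilon>" "\<epsilon> \<le> 1"
  obtains \<mu>0 where "0 < \<mu>0"
    "\<And>\<mu> h. 0 < \<mu> \<Longrightarrow> \<mu> < \<mu>0 \<Longrightarrow> \<bar>h\<bar> < \<mu> \<Longrightarrow> \<exists>Z. near_family \<mu> h {\<beta>1..\<beta>2} \<epsilon> Z"
proof -
  obtain \<delta>' where \<delta>': "0 < \<delta>'" "\<And>\<beta> s. \<beta> \<in> {\<beta>1..\<beta>2} \<Longrightarrow> s \<in> {0..5} \<Longrightarrow> \<delta>' \<le> planet_dist \<beta> s"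
    using planet_dist_lower_bound[OF b] by blast
  \<comment> \<open>Half of the unperturbed clearance, so that a small deviation does not reach the
    cut-off at the planet.\<close>
  define \<delta> where "\<delta> = \<delta>' / 2"
  have \<delta>: "0 < \<delta>" using \<delta>' by (simp add: \<delta>_def)
  \<comment> \<open>The constant depends on \<open>\<delta>\<close> alone and thus serves all
    \<open>\<beta>\<close>, \<open>\<mu>\<close> and \<open>h\<close>.\<close>
  obtain L where lip: "L-lipschitz_on UNIV (near_field \<delta>)" using near_field_lipschitz[OF \<delta>] .
  have L: "0 \<le> L" using lip by (rule lipschitz_on_nonneg)
  obtain Z' where Z': "\<And>x. Z' x 0 = x"
    "\<And>x t. 0 \<le> t \<Longrightarrow> (Z' x has_vector_derivative near_field \<delta> (Z' x t)) (at t within {0..})"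
    "\<And>x y t. 0 \<le> t \<Longrightarrow> dist (Z' x t) (Z' y t) \<le> exp (L * t) * dist x y"
    using global_flow[OF lip] by metis
  \<comment> \<open>Three demands on the deviation: the requested accuracy, a change of
    \<open>u^2\<close> of at most \<open>10 * e \<le> \<delta>\<close>, and
    \<open>L * e \<le> 1/2\<close>, which excludes a return of \<open>u\<close> to 0.\<close>
  define e where "e = min \<epsilon> (min (\<delta> / 10) (1 / (2 * (L + 1))))"
  have e: "0 < e" "e \<le> \<epsilon>" "e \<le> \<delta> / 10" "e \<le> 1" "L * e \<le> 1/2"
  proof -
    show "0 < e" using \<epsilon> \<delta> L by (simp add: e_def)
    show "e \<le> \<epsilon>" "e \<le> \<delta> / 10" by (auto simp: e_def)
    show "e \<le> 1" using \<epsilon> by (auto simp: e_def)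
    have "L * e \<le> L * (1 / (2 * (L + 1)))" using L by (intro mult_left_mono) (auto simp: e_def)
    also have "\<dots> \<le> 1/2" using L by (simp add: field_simps)
    finally show "L * e \<le> 1/2" .
  qed
  \<comment> \<open>The initial data differ by at most \<open>5 * \<mu>\<close>, and the distance
    grows by at most \<open>exp (L * 5)\<close>.\<close>
  define \<mu>0 where "\<mu>0 = min 1 (e / (5 * exp (L * 5)))"
  have \<mu>0: "0 < \<mu>0" using e by (simp add: \<mu>0_def)
  show ?thesis
  proof (rule that[OF \<mu>0])
    fix \<mu> h :: real assume mu: "0 < \<mu>" "\<mu> < \<mu>0" and h: "\<bar>h\<bar> < \<mu>"
    have mu1: "\<mu> < 1" "5 * exp (L * 5) * \<mu> < e" using mu by (auto simp: \<mu>0_def field_simps)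
    define z0 :: "real \<Rightarrow> lc_state" where "z0 \<beta> = (0, of_real (sqrt (8 * (1 - \<mu>))) * cis (phase \<beta> 0 / 2), \<mu>, h, 0, 0)" for \<beta>
    define Z where "Z \<beta> = Z' (z0 \<beta>)" for \<beta>
    have z0c: "continuous_on {\<beta>1..\<beta>2} z0"
      unfolding z0_def phase_def by (intro continuous_intros) auto
    have "continuous_on {\<beta>1..\<beta>2} (\<lambda>\<beta>. Z \<beta> 4)"
      using Z'(3)[of 4] by (intro continuous_on_dist_bound[OF z0c, where C = "exp (L * 4)"]) (simp add: Z_def)
    moreover have "near_ejection \<mu> h \<beta> \<epsilon> (Z \<beta>)" if \<beta>: "\<beta> \<in> {\<beta>1..\<beta>2}" for \<beta>
      unfolding near_ejection_def
    proof (intro conjI ballI impI)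
      show Z0: "Z \<beta> 0 = (0, of_real (sqrt (8 * (1 - \<mu>))) * cis (phase \<beta> 0 / 2), \<mu>, h, 0, 0)"
        by (simp add: Z_def Z'(1) z0_def)
      have b': "0 < \<beta>" "\<beta> < 2 * pi" using \<beta> b by auto
      define Y where "Y = parabolic_ejection \<beta>"
      have Y': "(Y has_vector_derivative near_field \<delta> (Y s)) (at s within {0..5})" if "s \<in> {0..5}" for s
        unfolding Y_def using \<delta>'(2)[OF \<beta>] \<delta> that by (intro parabolic_ejection_solution b') (fastforce simp: \<delta>_def)+
      have ZZ: "(Z \<beta> has_vector_derivative near_field \<delta> (Z \<beta> s)) (at s within {0..5})" if "s \<in> {0..5}" for s
        unfolding Z_def using that by (intro has_vector_derivative_within_subset[OF Z'(2)]) auto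
      have "sqrt 2 \<le> 3/2" by (rule real_le_lsqrt) (auto simp: power2_eq_square)
      then have s2: "0 \<le> sqrt 2" "sqrt 2 \<le> 3/2" by auto
      have init: "dist (Z \<beta> 0) (Y 0) \<le> 5 * \<mu>"
      proof -
        define c where "c = cis (phase \<beta> 0 / 2)"
        have Y0: "Y 0 = (0, of_real (2 * sqrt 2) * c, 0, 0, 0, 0)" by (simp add: Y_def parabolic_ejection_def c_def)
        have s8: "sqrt (8 * (1 - \<mu>)) = 2 * sqrt 2 * sqrt (1 - \<mu>)"
        proof -
          have "sqrt 8 = 2 * sqrt 2" by (rule real_sqrt_unique) (auto simp: power_mult_distrib)
          then show ?thesis by (simp only: real_sqrt_mult)
        qed
        have "(1 - \<mu>)^2 \<le> 1 - \<mu>" using mu mu1 by (simp add: power2_eq_square mult_left_le)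
        then have "1 - \<mu> \<le> sqrt (1 - \<mu>)" by (rule real_le_rsqrt)
        moreover have "sqrt (1 - \<mu>) \<le> 1" using mu by simp
        ultimately have "2 * sqrt 2 * (1 - sqrt (1 - \<mu>)) \<le> 3 * \<mu>" "0 \<le> 2 * sqrt 2 * (1 - sqrt (1 - \<mu>))"
          using s2 mult_mono[of "2 * sqrt 2" 3 "1 - sqrt (1 - \<mu>)" \<mu>] by auto
        then have 1: "\<bar>sqrt (8 * (1 - \<mu>)) - 2 * sqrt 2\<bar> \<le> 3 * \<mu>" unfolding s8 by (simp add: algebra_simps)
        let ?d = "of_real (sqrt (8 * (1 - \<mu>))) * c - of_real (2 * sqrt 2) * c"
        have "?d = of_real (sqrt (8 * (1 - \<mu>)) - 2 * sqrt 2) * c"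
          by (simp add: algebra_simps)
        then have 2: "cmod (?d) \<le> 3 * \<mu>"
          using 1 by (simp add: norm_mult c_def del: of_real_diff)
        have "dist (Z \<beta> 0) (Y 0) = norm (0::complex, ?d, \<mu>, h, 0::real, 0::real)"
          unfolding Z0 Y0 c_def[symmetric] dist_norm by (simp only: diff_Pair diff_zero diff_self zero_prod_def)
        also have "\<dots> \<le> cmod (?d) + (\<bar>\<mu>\<bar> + \<bar>h\<bar>)"
          using norm_Pair_le[of "?d" "(\<mu>, h, 0::real, 0::real)"]
            norm_Pair_le[of \<mu> "(h, 0::real, 0::real)"] by (simp add: norm_Pair)
        finally show ?thesis using 2 mu h by linarith
      qed
      have dist: "dist (Z \<beta> s) (Y s) \<le> e" if s: "s \<in> {0..5}" for s
      proof -
        have "dist (Z \<beta> s) (Y s) \<le> exp (L * s) * dist (Z \<beta> 0) (Y 0)"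
          by (rule solutions_dist[OF lip ZZ Y' s])
        also have "\<dots> \<le> exp (L * 5) * (5 * \<mu>)"
          using s L init by (intro mult_mono) (auto intro: mult_left_mono)
        finally show ?thesis using mu1 by simp
      qed
      have comp: "((\<lambda>s. fst (snd (snd (Z \<beta> s)))) has_real_derivative 0) (at s within {0..5})"
        "((\<lambda>s. fst (snd (snd (snd (Z \<beta> s))))) has_real_derivative 0) (at s within {0..5})" if "s \<in> {0..5}" for s
      proof -
        have bl: "bounded_linear (\<lambda>z :: lc_state. fst (snd (snd z)))" "bounded_linear (\<lambda>z :: lc_state. fst (snd (snd (snd z))))"
          by (intro bounded_linear_intros)+
        show "((\<lambda>s. fst (snd (snd (Z \<beta> s)))) has_real_derivative 0) (at s within {0..5})"
          "((\<lambda>s. fst (snd (snd (snd (Z \<beta> s))))) has_real_derivative 0) (at s within {0..5})"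
          using bl[THEN bounded_linear.has_vector_derivative, OF ZZ[OF that]]
          unfolding has_real_derivative_iff_has_vector_derivative by (simp_all add: near_field_def lc_rhs_def)
      qed
      have const: "fst (snd (snd (Z \<beta> s))) = \<mu>" "fst (snd (snd (snd (Z \<beta> s)))) = h" if s: "s \<in> {0..5}" for s
      proof -
        obtain c where "\<forall>s\<in>{0..5}. fst (snd (snd (Z \<beta> s))) = c"
          using has_field_derivative_zero_constant[OF _ comp(1)] by auto
        then show "fst (snd (snd (Z \<beta> s))) = \<mu>" using s Z0 by (metis atLeastAtMost_iff fst_conv le_numeral_extra(3) snd_conv zero_le_numeral)
        obtain c where "\<forall>s\<in>{0..5}. fst (snd (snd (snd (Z \<beta> s)))) = c"
          using has_field_derivative_zero_constant[OF _ comp(2)] by auto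
        then show "fst (snd (snd (snd (Z \<beta> s)))) = h" using s Z0 by (metis atLeastAtMost_iff fst_conv le_numeral_extra(3) snd_conv zero_le_numeral)
      qed
      fix s :: real assume s: "s \<in> {0..5}"
      show "dist (Z \<beta> s) (parabolic_ejection \<beta> s) \<le> \<epsilon>" using dist[OF s] e by (simp add: Y_def)
      define u w where "u = fst (Z \<beta> s)" "w = fst (snd (Z \<beta> s))"
      define u0 where "u0 = of_real (sqrt 2 / 2 * s) * cis (phase \<beta> s / 2)"
      define w0 where "w0 = of_real (2 * sqrt 2) * cis (phase \<beta> s / 2)"
      have du: "cmod (u - u0) \<le> e" "cmod (w - w0) \<le> e"
        using dist[OF s] dist_fst_le[of "Z \<beta> s" "Y s"] dist_snd_le[of "Z \<beta> s" "Y s"] dist_fst_le[of "snd (Z \<beta> s)" "snd (Y s)"]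
        by (auto simp: u_w_def u0_def w0_def Y_def parabolic_ejection_def dist_norm)
      have "sqrt 2 * s \<le> 3/2 * 5" using s s2 by (intro mult_mono) auto
      moreover have cu0: "cmod u0 = sqrt 2 / 2 * s" using s by (simp add: u0_def norm_mult)
      ultimately have n0: "cmod u0 \<le> 15/4" "cmod w0 \<le> 3" using s2 by (auto simp: w0_def norm_mult)
      have n: "cmod u \<le> 5" "cmod w \<le> 5"
        using norm_triangle_sub[of u u0] norm_triangle_sub[of w w0] du n0 e by linarith+
      have "cmod (u0^2 - 1) \<ge> 2 * \<delta>"
        using \<delta>'(2)[OF \<beta> s] unfolding u0_def parabolic_square cmod_parabolic by (simp add: \<delta>_def)
      moreover have "cmod (u^2 - u0^2) \<le> \<delta>"
      proof -
        have "u^2 - u0^2 = (u - u0) * (u + u0)" by (simp add: power2_eq_square algebra_simps)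
        then have "cmod (u^2 - u0^2) \<le> e * (5 + 5)"
          using du n n0 e(1) norm_triangle_ineq[of u u0] by (simp only: norm_mult) (intro mult_mono; simp)
        then show ?thesis using e by simp
      qed
      ultimately have ud: "\<delta> \<le> cmod (u^2 - 1)"
        using norm_triangle_sub[of "u0^2 - 1" "u^2 - 1"] by (simp add: norm_minus_commute)
      then show "(fst (Z \<beta> s))^2 \<noteq> 1" using \<delta> by (auto simp: u_w_def)
      have "Z \<beta> s = (u, w, \<mu>, h, snd (snd (snd (snd (Z \<beta> s)))))"
        using const[OF s] by (auto simp: u_w_def prod_eq_iff)
      then have "near_field \<delta> (Z \<beta> s) = lc_rhs u w \<mu> h (1 / cmod (u^2 - 1))"
        using near_field_eq[OF n _ _ ud, of \<mu> h "snd (snd (snd (snd (Z \<beta> s))))"] mu mu1 h by simp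
      then show "(Z \<beta> has_vector_derivative
              lc_rhs (fst (Z \<beta> s)) (fst (snd (Z \<beta> s))) \<mu> h (1 / cmod ((fst (Z \<beta> s))^2 - 1))) (at s within {0..5})"
        using ZZ[OF s] by (simp add: u_w_def)
      assume s0: "0 < s"
      \<comment> \<open>Uniform closeness says nothing near \<open>s = 0\<close>, where the
        unperturbed \<open>u\<close> vanishes too. Comparing derivatives instead makes the deviation
        at most \<open>s / 2\<close>, below the unperturbed modulus
        \<open>sqrt 2 / 2 * s\<close>.\<close>
      have "norm ((Z \<beta> s - Y s) - (Z \<beta> 0 - Y 0)) \<le> L * e * norm (s - 0)"
      proof (rule differentiable_bound[of "{0..5}" "\<lambda>s. Z \<beta> s - Y s" "\<lambda>s x. x *\<^sub>R (near_field \<delta> (Z \<beta> s) - near_field \<delta> (Y s))"])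
        fix x :: real assume x: "x \<in> {0..5}"
        show "((\<lambda>s. Z \<beta> s - Y s) has_derivative (\<lambda>s. s *\<^sub>R (near_field \<delta> (Z \<beta> x) - near_field \<delta> (Y x)))) (at x within {0..5})"
          using has_vector_derivative_diff[OF ZZ[OF x] Y'[OF x]] by (simp add: has_vector_derivative_def)
        have "norm (near_field \<delta> (Z \<beta> x) - near_field \<delta> (Y x)) \<le> L * dist (Z \<beta> x) (Y x)"
          using lipschitz_onD[OF lip, of "Z \<beta> x" "Y x"] by (simp add: dist_norm)
        also have "\<dots> \<le> L * e" using L dist[OF x] by (intro mult_left_mono)
        finally show "onorm (\<lambda>s. s *\<^sub>R (near_field \<delta> (Z \<beta> x) - near_field \<delta> (Y x))) \<le> L * e"
          by (intro onorm_le) (simp add: mult.commute[of _ "\<bar>_\<bar>"] mult_left_mono)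
      qed (use s in auto)
      moreover have "cmod ((u - u0) - 0) \<le> norm ((Z \<beta> s - Y s) - (Z \<beta> 0 - Y 0))"
      proof -
        define A where "A = (Z \<beta> s - Y s) - (Z \<beta> 0 - Y 0)"
        have fA: "fst A = (u - u0) - 0" by (simp add: A_def Z0 u_w_def u0_def Y_def parabolic_ejection_def)
        have "cmod (fst A) \<le> norm A" using norm_fst_le[of "fst A" "snd A"] by simp
        then show ?thesis unfolding A_def[symmetric] fA[symmetric] .
      qed
      moreover have "L * e * s \<le> 1/2 * s" using e s by (intro mult_right_mono) auto
      ultimately have "cmod (u - u0) \<le> s / 2" using s by simp
      moreover note cu0
      moreover have "1 * s < sqrt 2 * s" using s0 by (intro mult_strict_right_mono) auto
      ultimately have "cmod (u - u0) < cmod u0" by simp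
      then show "fst (Z \<beta> s) \<noteq> 0" by (auto simp: u_w_def)
    qed
    ultimately show "\<exists>Z. near_family \<mu> h {\<beta>1..\<beta>2} \<epsilon> Z"
      unfolding near_family_def by blast
  qed
qed

section \<open>Back to physical time\<close>

text \<open>The computation behind the equation for the momentum, with \<open>v\<close> for
  \<open>cnj u\<close>, \<open>w'\<close> for \<open>cnj w\<close> and \<open>m\<close> for
  \<open>\<mu>\<close>. Treating conjugates as independent variables leaves an identity of rational
  functions; the hypothesis on \<open>E\<close> is the energy relation, which restores the singular
  solar term.\<close>

lemma momentum_equation_algebra:
  fixes u v w w' E m k :: complex
  assumes "u \<noteq> 0" "v \<noteq> 0" and E: "E * (u * v) = w * w' / 4 - 2 * (1 - m)"
  shows "(u * E - (\<i> / 2) * (u * v) * w - (2 * m * (u * v)) * v * (1 + (u^2 - 1) * k)) * (inverse v / 2)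
      + w / 2 * (((1/4) * w' + (\<i> / 2) * (u * v) * v) * - ((inverse v)^2))
    = (u * v) * (- \<i> * (w / (2 * v) - \<i> * m) - ((1 - m) / (u * v) ^ 3 * u^2 + m * k * (u^2 - 1)))"
proof -
  have "(u * E - (\<i> / 2) * (u * v) * w - (2 * m * (u * v)) * v * (1 + (u^2 - 1) * k)) * (inverse v / 2)
      + w / 2 * (((1/4) * w' + (\<i> / 2) * (u * v) * v) * - ((inverse v)^2))
    = ((E * (u * v) - w * w' / 4) - \<i> * u * v^2 * w - 2 * m * u * v ^ 3 * (1 + (u^2 - 1) * k)) / (2 * v^2)"
    using assms(1,2) by (simp add: divide_simps) (simp add: power2_eq_square power3_eq_cube algebra_simps)
  also have "\<dots> = (u * v) * (- \<i> * (w / (2 * v) - \<i> * m) - ((1 - m) / (u * v) ^ 3 * u^2 + m * k * (u^2 - 1)))"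
    unfolding E using assms(1,2) by (simp add: divide_simps) (simp add: power2_eq_square power3_eq_cube algebra_simps)
  finally show ?thesis .
qed

locale near_orbit =
  fixes \<mu> h \<theta> :: real and Z :: "real \<Rightarrow> lc_state"
  assumes mu: "0 < \<mu>" "\<mu> < 1"
    and Z0: "Z 0 = (0, of_real (sqrt (8 * (1 - \<mu>))) * cis \<theta>, \<mu>, h, 0, 0)"
    and sol: "\<And>s. s \<in> {0..5} \<Longrightarrow> (Z has_vector_derivative
              lc_rhs (fst (Z s)) (fst (snd (Z s))) \<mu> h (1 / cmod ((fst (Z s))^2 - 1))) (at s within {0..5})"
    and no_planet: "\<And>s. s \<in> {0..5} \<Longrightarrow> (fst (Z s))^2 \<noteq> 1"
    and no_sun: "\<And>s. 0 < s \<Longrightarrow> s \<le> 5 \<Longrightarrow> fst (Z s) \<noteq> 0"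
begin

definition "u s = fst (Z s)"
definition "w s = fst (snd (Z s))"
definition "t s = fst (snd (snd (snd (snd (Z s)))))"
definition "\<Gamma> s = snd (snd (snd (snd (snd (Z s)))))"
definition "k s = 1 / cmod ((u s)^2 - 1)"
definition "u' s = fst (lc_rhs (u s) (w s) \<mu> h (k s))"
definition "w' s = fst (snd (lc_rhs (u s) (w s) \<mu> h (k s)))"

lemma derivs:
  assumes "s \<in> {0..5}"
  shows "(u has_vector_derivative u' s) (at s within {0..5})" (is ?A)
    and "(w has_vector_derivative w' s) (at s within {0..5})" (is ?B)
    and "(t has_real_derivative (cmod (u s))^2) (at s within {0..5})" (is ?C)
    and "(\<Gamma> has_real_derivative (cmod (u s))^2 * Im ((u s)^2) * (1 - k s ^ 3)) (at s within {0..5})" (is ?D)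
proof -
  have "bounded_linear (\<lambda>z :: lc_state. fst z)" "bounded_linear (\<lambda>z :: lc_state. fst (snd z))"
    "bounded_linear (\<lambda>z :: lc_state. fst (snd (snd (snd (snd z)))))" "bounded_linear (\<lambda>z :: lc_state. snd (snd (snd (snd (snd z)))))"
    by (intro bounded_linear_intros)+
  note * = this[THEN bounded_linear.has_vector_derivative, OF sol[OF assms]]
  have r: "Re (u s * cnj (u s)) = (cmod (u s))^2" by (simp add: complex_norm_square[symmetric])
  show ?A ?B
    using *(1,2) by (simp_all add: u_def[abs_def] w_def[abs_def] u'_def w'_def k_def)
  show ?C ?D
    unfolding r[symmetric] has_real_derivative_iff_has_vector_derivative
    using *(3,4) by (simp_all add: t_def[abs_def] \<Gamma>_def[abs_def] k_def u_def w_def lc_rhs_def del: Re_complex_of_real)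
qed

definition "E s = Im (cnj (u s) * w s) - 2 * \<mu> * Re ((u s)^2) + 2 * \<mu> * k s + \<mu>^2 + 2 * h"

text \<open>Both relations are first integrals that vanish at ejection. The first validates the use
  of the energy in eliminating the singular term; the second identifies \<open>\<Gamma>\<close> as
  the angular momentum about the Sun over \<open>\<mu>\<close>.\<close>

lemma conserved:
  assumes s: "s \<in> {0..5}"
  shows "(cmod (w s))^2 / 4 - 2 * (1 - \<mu>) = (cmod (u s))^2 * E s"
    and "Im (cnj (u s) * w s) / 2 = \<mu> * \<Gamma> s"
proof -
  define a b c d where "a s = Re (u s)" and "b s = Im (u s)" and "c s = Re (w s)" and "d s = Im (w s)" for s
  define H where "H s = a s * d s - b s * c s - 2 * \<mu> * ((a s)^2 - (b s)^2) + 2 * \<mu> * k s + \<mu>^2 + 2 * h" for s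
  \<comment> \<open>Away from the Sun this is \<open>2 * (cmod u)^2\<close> times the difference of
    the Hamiltonian and \<open>h\<close>; multiplied out, it is regular at collision.\<close>
  define K where "K s = ((c s)^2 + (d s)^2) / 4 - 2 * (1 - \<mu>) - ((a s)^2 + (b s)^2) * H s" for s
  define g where "g s = (a s * d s - b s * c s) / 2 - \<mu> * \<Gamma> s" for s
  have D: "(K has_real_derivative 0) (at s within {0..5}) \<and> (g has_real_derivative 0) (at s within {0..5})"
    if s: "s \<in> {0..5}" for s
  proof -
    define X where "X s = (a s)^2 - (b s)^2 - 1" for s
    define Y where "Y s = 2 * a s * b s" for s
    define r where "r = (a s)^2 + (b s)^2"
    define A where "A = c s / 4 + r * b s / 2"
    define B where "B = d s / 4 - r * a s / 2"
    define k3 where "k3 = k s ^ 3"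
    have XY: "(X s)^2 + (Y s)^2 = (cmod ((u s)^2 - 1))^2" for s
      unfolding cmod_power2 by (simp add: X_def Y_def a_def b_def Re_power2 Im_power2)
    have kk: "k s = 1 / sqrt ((X s)^2 + (Y s)^2)" for s
      unfolding XY by (simp add: k_def)
    have pos: "(X s)^2 + (Y s)^2 > 0"
      unfolding XY using no_planet[OF s] by (simp add: u_def)
    have a': "(a has_real_derivative A) (at s within {0..5})"
      using has_real_derivative_Re[OF derivs(1)[OF s]]
      by (simp add: A_def a_def[abs_def] b_def c_def r_def u'_def lc_rhs_def power2_eq_square)
    have b': "(b has_real_derivative B) (at s within {0..5})"
      using has_real_derivative_Im[OF derivs(1)[OF s]]
      by (simp add: B_def a_def b_def[abs_def] d_def r_def u'_def lc_rhs_def power2_eq_square)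
    have c': "(c has_real_derivative a s * H s + r * d s / 2 - 2 * \<mu> * r * (a s * (1 + X s * k3) + b s * (Y s * k3))) (at s within {0..5})"
      using has_real_derivative_Re[OF derivs(2)[OF s]] unfolding c_def[abs_def]
      by (rule DERIV_cong) (simp add: a_def b_def c_def d_def r_def X_def Y_def H_def k3_def w'_def lc_rhs_def power2_eq_square field_simps)
    have d': "(d has_real_derivative b s * H s - r * c s / 2 - 2 * \<mu> * r * (a s * (Y s * k3) - b s * (1 + X s * k3))) (at s within {0..5})"
      using has_real_derivative_Im[OF derivs(2)[OF s]] unfolding d_def[abs_def]
      by (rule DERIV_cong) (simp add: a_def b_def c_def d_def r_def X_def Y_def H_def k3_def w'_def lc_rhs_def power2_eq_square algebra_simps)
    have k': "(k has_real_derivative - (k3 * (2 * X s * (2 * a s * A - 2 * b s * B)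
        + 2 * Y s * (2 * A * b s + 2 * a s * B)) / 2)) (at s within {0..5})"
    proof -
      have k3: "k3 = 1 / sqrt ((X s)^2 + (Y s)^2) ^ 3" by (simp add: k3_def kk power_divide)
      show ?thesis unfolding kk[abs_def] k3
        by (rule has_real_derivative_inverse_sqrt[where X = "\<lambda>s. (X s)^2 + (Y s)^2" and t = s, OF _ pos])
           (auto simp: X_def[abs_def] Y_def[abs_def] intro!: derivative_eq_intros a' b', simp add: field_simps)
    qed
    have r': "((\<lambda>s. (a s)^2 + (b s)^2) has_real_derivative (a s * c s + b s * d s) / 2) (at s within {0..5})"
      by (auto intro!: derivative_eq_intros a' b' simp: A_def B_def field_simps)
    have g0': "((\<lambda>s. a s * d s - b s * c s) has_real_derivative 2 * \<mu> * r * Y s * (1 - k3)) (at s within {0..5})"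
      by (rule DERIV_cong[OF DERIV_diff[OF DERIV_mult[OF a' d'] DERIV_mult[OF b' c']]])
         (simp add: A_def B_def r_def X_def Y_def field_simps power2_eq_square)
    have z': "((\<lambda>s. (c s)^2 + (d s)^2) has_real_derivative
       2 * ((a s * c s + b s * d s) * H s - 2 * \<mu> * r * (c s * (a s * (1 + X s * k3) + b s * (Y s * k3))
          + d s * (a s * (Y s * k3) - b s * (1 + X s * k3))))) (at s within {0..5})"
      by (auto intro!: derivative_eq_intros c' d' simp: algebra_simps)
    have X': "((\<lambda>s. (a s)^2 - (b s)^2) has_real_derivative (a s * c s - b s * d s) / 2 + 2 * r * a s * b s) (at s within {0..5})"
      by (auto intro!: derivative_eq_intros a' b' simp: A_def B_def field_simps)
    have H': "(H has_real_derivative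
        2 * \<mu> * r * Y s * (1 - k3) - 2 * \<mu> * ((a s * c s - b s * d s) / 2 + 2 * r * a s * b s)
        + 2 * \<mu> * (- (k3 * (2 * X s * (2 * a s * A - 2 * b s * B)
        + 2 * Y s * (2 * A * b s + 2 * a s * B)) / 2)) + 0 + 0) (at s within {0..5})"
      unfolding H_def[abs_def] by (intro DERIV_add DERIV_diff DERIV_cmult g0' X' k' DERIV_const)
    have "(K has_real_derivative 0) (at s within {0..5})"
      unfolding K_def[abs_def]
      by (rule DERIV_cong[OF DERIV_diff[OF DERIV_diff[OF DERIV_cdivide[OF z'] DERIV_const] DERIV_mult[OF r' H']]])
         (simp add: A_def B_def Y_def X_def r_def power2_eq_square field_simps)
    moreover have "(g has_real_derivative 0) (at s within {0..5})"
      unfolding g_def[abs_def]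
      by (rule DERIV_cong[OF DERIV_diff[OF DERIV_cdivide[OF g0'] DERIV_cmult[OF derivs(4)[OF s]]]])
         (simp add: k3_def r_def Y_def a_def b_def cmod_power2 Im_power2)
    ultimately show ?thesis ..
  qed
  have init: "K 0 = 0" "g 0 = 0"
  proof -
    have "(cmod (w 0))^2 = 8 * (1 - \<mu>)" using mu by (simp add: w_def Z0 norm_mult)
    then have "(c 0)^2 + (d 0)^2 = 8 * (1 - \<mu>)" by (simp add: c_def d_def cmod_power2)
    then show "K 0 = 0" by (simp add: K_def a_def b_def u_def Z0)
    show "g 0 = 0" by (simp add: g_def a_def b_def u_def \<Gamma>_def Z0)
  qed
  have "K s = 0"
  proof -
    obtain x where "\<forall>s\<in>{0..5}. K s = x"
      using has_field_derivative_zero_constant[of "{0..5}" K] D by auto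
    then show ?thesis using s init(1) by force
  qed
  then show "(cmod (w s))^2 / 4 - 2 * (1 - \<mu>) = (cmod (u s))^2 * E s"
    by (simp add: K_def H_def E_def a_def b_def c_def d_def cmod_power2 Re_power2)
  have "g s = 0"
  proof -
    obtain x where "\<forall>s\<in>{0..5}. g s = x"
      using has_field_derivative_zero_constant[of "{0..5}" g] D by auto
    then show ?thesis using s init(2) by force
  qed
  then show "Im (cnj (u s) * w s) / 2 = \<mu> * \<Gamma> s"
    by (simp add: g_def a_def b_def c_def d_def)
qed

definition "Q s = (u s)^2 - of_real \<mu>"
definition "P s = w s / (2 * cnj (u s)) - \<i> * of_real \<mu>"

lemma at_interior: "0 < s \<Longrightarrow> s < 5 \<Longrightarrow> at s within {0..5} = at (s::real)"
  by (rule at_within_interior) simp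

lemma uu: "complex_of_real (Re (u s * cnj (u s))) = u s * cnj (u s)"
  by (simp add: complex_eq_iff)

lemma Q_deriv:
  assumes s: "0 < s" "s < 5"
  shows "(Q has_vector_derivative (cmod (u s))^2 *\<^sub>R (P s - \<i> * Q s)) (at s)"
proof -
  have u: "u s \<noteq> 0" using no_sun s by (simp add: u_def)
  have d: "(u has_vector_derivative u' s) (at s)" using derivs(1)[of s] s by (simp add: at_interior)
  have "(Q has_vector_derivative (u s * u' s + u' s * u s) - 0) (at s)"
    unfolding Q_def[abs_def] power2_eq_square
    by (intro has_vector_derivative_diff has_vector_derivative_mult d has_vector_derivative_const)
  moreover have "(u s * u' s + u' s * u s) - 0 = (cmod (u s))^2 *\<^sub>R (P s - \<i> * Q s)"
    unfolding scaleR_conv_of_real complex_norm_square P_def Q_def u'_def lc_rhs_def fst_conv uu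
    using u by (simp add: field_simps power2_eq_square)
  ultimately show ?thesis by simp
qed

lemma P_deriv:
  assumes s: "0 < s" "s < 5"
  shows "(P has_vector_derivative (cmod (u s))^2 *\<^sub>R (- \<i> * P s - attraction \<mu> (Q s))) (at s)"
proof -
  have u: "u s \<noteq> 0" "cnj (u s) \<noteq> 0" using no_sun s by (auto simp: u_def)
  have d: "(u has_vector_derivative u' s) (at s)" "(w has_vector_derivative w' s) (at s)"
    using derivs(1,2)[of s] s by (simp_all add: at_interior)
  have cn: "((\<lambda>s. cnj (u s)) has_vector_derivative cnj (u' s)) (at s)"
    by (rule bounded_linear.has_vector_derivative[OF bounded_linear_cnj d(1)])
  have inv: "((\<lambda>s. inverse (cnj (u s))) has_vector_derivative cnj (u' s) * - ((inverse (cnj (u s)))^2)) (at s)"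
    using field_vector_diff_chain_at[OF cn DERIV_inverse[OF u(2)]]
    by (simp add: o_def power2_eq_square numeral_2_eq_2)
  have dv: "((\<lambda>s. (1/2) * (w s * inverse (cnj (u s))) - \<i> * of_real \<mu>) has_vector_derivative
     (1/2) * (w s * (cnj (u' s) * - ((inverse (cnj (u s)))^2)) + w' s * inverse (cnj (u s))) - 0) (at s)"
    by (intro has_vector_derivative_diff has_vector_derivative_mult_right has_vector_derivative_mult d inv has_vector_derivative_const)
  have feq: "(\<lambda>s. (1/2) * (w s * inverse (cnj (u s))) - \<i> * of_real \<mu>) = P"
    unfolding P_def[abs_def] by (simp add: divide_simps)
  have veq: "(1/2) * (w s * (cnj (u' s) * - ((inverse (cnj (u s)))^2)) + w' s * inverse (cnj (u s))) - 0
     = (cmod (u s))^2 *\<^sub>R (- \<i> * P s - attraction \<mu> (Q s))"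
  proof -
    have E: "of_real (E s) * (u s * cnj (u s)) = w s * cnj (w s) / 4 - 2 * (1 - of_real \<mu>)"
    proof -
      have "of_real (E s) * (u s * cnj (u s)) = of_real ((cmod (u s))^2 * E s)"
        unfolding complex_norm_square[symmetric] by simp
      also have "\<dots> = of_real ((cmod (w s))^2 / 4 - 2 * (1 - \<mu>))" using conserved(1)[of s] s by simp
      also have "\<dots> = w s * cnj (w s) / 4 - 2 * (1 - of_real \<mu>)"
        unfolding complex_norm_square[symmetric] by simp
      finally show ?thesis .
    qed
    have w': "w' s = u s * of_real (E s) - (\<i> / 2) * (u s * cnj (u s)) * w s
        - (2 * of_real \<mu> * (u s * cnj (u s))) * cnj (u s) * (1 + ((u s)^2 - 1) * of_real (k s ^ 3))"
      unfolding w'_def lc_rhs_def fst_conv snd_conv E_def[symmetric] uu of_real_mult by simp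
    have u': "cnj (u' s) = (1/4) * cnj (w s) + (\<i> / 2) * (u s * cnj (u s)) * cnj (u s)"
      unfolding u'_def lc_rhs_def fst_conv uu by simp
    have "cmod (Q s + of_real \<mu>) = (cmod (u s))^2" by (simp add: Q_def norm_power)
    then have q: "complex_of_real (cmod (Q s + of_real \<mu>)) = u s * cnj (u s)" by (simp only: complex_norm_square)
    have e1: "of_real ((1 - \<mu>) / cmod (Q s + of_real \<mu>) ^ 3) = (1 - of_real \<mu>) / (u s * cnj (u s)) ^ 3"
      by (simp only: of_real_divide of_real_power of_real_diff of_real_1 q)
    have e2: "of_real (\<mu> / cmod (Q s + of_real (\<mu> - 1)) ^ 3) = of_real \<mu> * complex_of_real (k s ^ 3)"
      by (simp add: k_def Q_def power_divide)
    have att: "attraction \<mu> (Q s) = (1 - of_real \<mu>) / (u s * cnj (u s)) ^ 3 * (u s)^2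
        + of_real \<mu> * of_real (k s ^ 3) * ((u s)^2 - 1)"
      unfolding attraction_def e1 e2 by (simp add: Q_def)
    show ?thesis
      using momentum_equation_algebra[OF u E, of "of_real (k s ^ 3)"]
      unfolding w' u' att P_def scaleR_conv_of_real complex_norm_square by (simp add: algebra_simps)
  qed
  show ?thesis using dv unfolding feq veq .
qed

lemma cham_near:
  assumes s: "0 < s" "s \<le> 5"
  shows "cham \<mu> (Q s) (P s) = h"
proof -
  have u: "u s \<noteq> 0" using no_sun s by (auto simp: u_def)
  define y where "y = w s / (2 * cnj (u s))"
  define r where "r = (cmod (u s))^2"
  have r: "0 < r" using u by (simp add: r_def)
  have y2: "(cmod y)^2 = (cmod (w s))^2 / (4 * r)"
    by (simp add: y_def r_def norm_divide norm_mult power_divide power_mult_distrib)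
  have g: "cnj ((u s)^2) * y = cnj (u s) * w s / 2" using u by (simp add: y_def field_simps power2_eq_square)
  have q: "cmod (Q s + of_real \<mu>) = r" "\<mu> / cmod (Q s + of_real (\<mu> - 1)) = \<mu> * k s"
    by (simp_all add: Q_def norm_power r_def k_def)
  have p2: "(cmod (P s))^2 = (cmod y)^2 - 2 * \<mu> * Im y + \<mu>^2"
    unfolding P_def y_def[symmetric] cmod_power2 by (simp add: power2_diff)
  have "Im (cnj (Q s) * P s) = Im (cnj ((u s)^2) * y) - \<mu> * Re ((u s)^2) - \<mu> * Im y + \<mu>^2"
    unfolding P_def Q_def y_def[symmetric] by (simp add: algebra_simps power2_eq_square)
  then have G: "Im (cnj (Q s) * P s) = Im (cnj (u s) * w s) / 2 - \<mu> * Re ((u s)^2) - \<mu> * Im y + \<mu>^2"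
    unfolding g by simp
  have "cham \<mu> (Q s) (P s) = (cmod (w s))^2 / (8 * r) - \<mu> * Im y + \<mu>^2 / 2
     - (Im (cnj (u s) * w s) / 2 - \<mu> * Re ((u s)^2) - \<mu> * Im y + \<mu>^2) - (1 - \<mu>) / r - \<mu> * k s"
    unfolding cham_def p2 G q y2 by (simp add: field_simps)
  also have "\<dots> = ((cmod (w s))^2 / 4 - 2 * (1 - \<mu>)) / (2 * r) - (E s / 2 - h)"
    using r by (simp add: E_def field_simps)
  also have "\<dots> = h" using conserved(1)[of s] s r by (simp add: r_def field_simps)
  finally show ?thesis .
qed

text \<open>Physical time increases strictly with \<open>s\<close>, but its derivative vanishes at
  \<open>s = 0\<close>. Its inverse is therefore differentiated only for positive times; at 0 its
  continuity supplies the ejection limit.\<close>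

lemma near_csol:
  obtains q p t1 t2 where "0 < t1" "t1 < t2" "csol \<mu> {0<..<t2} q p" "q t1 = Q 4" "p t1 = P 4"
    "(q \<longlongrightarrow> - of_real \<mu>) (at_right 0)"
proof -
  have tc: "continuous_on {0..5} t" using derivs(3) by (rule DERIV_continuous_on)
  have t': "DERIV t s :> (cmod (u s))^2" if "0 < s" "s < 5" for s
    using derivs(3)[of s] that by (simp add: at_interior)
  have upos: "0 < (cmod (u s))^2" if "0 < s" "s \<le> 5" for s using no_sun[OF that] by (simp add: u_def)
  have mono: "t x < t y" if "0 \<le> x" "x < y" "y \<le> 5" for x y
    using that(2)
  proof (rule DERIV_pos_imp_increasing_open)
    fix z assume "x < z" "z < y"
    then show "\<exists>d. DERIV t z :> d \<and> 0 < d" using t'[of z] upos[of z] that by auto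
  qed (use that in \<open>auto intro: continuous_on_subset[OF tc]\<close>)
  have inj: "inj_on t {0..5}" by (rule linorder_inj_onI) (use mono in force)+
  define \<sigma> where "\<sigma> = the_inv_into {0..5} t"
  have \<sigma>t: "\<sigma> (t s) = s" if "s \<in> {0..5}" for s unfolding \<sigma>_def using inj that by (rule the_inv_into_f_f)
  have t0: "t 0 = 0" by (simp add: t_def Z0)
  have surj: "\<exists>s\<in>{0..5}. t s = \<tau>" if "\<tau> \<in> {0..t 5}" for \<tau>
    using IVT'[of t 0 \<tau> 5] that tc t0 by auto
  have \<sigma>: "\<sigma> \<tau> \<in> {0..5}" "t (\<sigma> \<tau>) = \<tau>" if "\<tau> \<in> {0..t 5}" for \<tau> using surj[OF that] \<sigma>t by auto
  have \<sigma>c: "continuous_on {0..t 5} \<sigma>"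
  proof -
    have "continuous_on (t ` {0..5}) \<sigma>" by (rule continuous_on_inv[OF tc]) (auto simp: \<sigma>t)
    then show ?thesis by (rule continuous_on_subset) (use surj in force)
  qed
  have \<sigma>i: "0 < \<sigma> \<tau>" "\<sigma> \<tau> < 5" if "0 < \<tau>" "\<tau> < t 5" for \<tau>
  proof -
    have *: "\<sigma> \<tau> \<in> {0..5}" "t (\<sigma> \<tau>) = \<tau>" using \<sigma>[of \<tau>] that by auto
    have "\<sigma> \<tau> \<noteq> 0" "\<sigma> \<tau> \<noteq> 5" using * that t0 by auto
    then show "0 < \<sigma> \<tau>" "\<sigma> \<tau> < 5" using * by auto
  qed
  have \<sigma>': "(\<sigma> has_vector_derivative inverse ((cmod (u (\<sigma> \<tau>)))^2)) (at \<tau>)" if \<tau>: "0 < \<tau>" "\<tau> < t 5" for \<tau>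
    unfolding has_real_derivative_iff_has_vector_derivative[symmetric]
  proof (rule DERIV_inverse_function[where f = t and g = \<sigma> and x = \<tau>, OF t'[OF \<sigma>i[OF \<tau>]] _ \<tau>])
    show "(cmod (u (\<sigma> \<tau>)))^2 \<noteq> 0" using upos[of "\<sigma> \<tau>"] \<sigma>i[OF \<tau>] by simp
    show "isCont \<sigma> \<tau>" using continuous_on_interior[OF \<sigma>c] \<tau> by simp
  qed (use \<sigma> in auto)
  have "csol \<mu> {0<..<t 5} (\<lambda>\<tau>. Q (\<sigma> \<tau>)) (\<lambda>\<tau>. P (\<sigma> \<tau>))"
    unfolding csol_def
  proof (intro ballI conjI)
    fix \<tau> assume "\<tau> \<in> {0<..<t 5}"
    then have \<tau>: "0 < \<tau>" "\<tau> < t 5" by auto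
    note i = \<sigma>i[OF \<tau>]
    have n0: "(cmod (u (\<sigma> \<tau>)))^2 \<noteq> 0" using upos[of "\<sigma> \<tau>"] i by simp
    show "Q (\<sigma> \<tau>) + of_real \<mu> \<noteq> 0" using n0 by (simp add: Q_def)
    show "Q (\<sigma> \<tau>) + of_real (\<mu> - 1) \<noteq> 0" using no_planet[of "\<sigma> \<tau>"] i by (simp add: Q_def u_def)
    have "((\<lambda>\<tau>. Q (\<sigma> \<tau>)) has_vector_derivative P (\<sigma> \<tau>) - \<i> * Q (\<sigma> \<tau>)) (at \<tau>)"
      using vector_diff_chain_at[OF \<sigma>'[OF \<tau>] Q_deriv[OF i]] n0 by (simp add: o_def)
    then show "((\<lambda>\<tau>. Q (\<sigma> \<tau>)) has_vector_derivative P (\<sigma> \<tau>) - \<i> * Q (\<sigma> \<tau>)) (at \<tau> within {0<..<t 5})"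
      by (rule has_vector_derivative_at_within)
    have "((\<lambda>\<tau>. P (\<sigma> \<tau>)) has_vector_derivative - \<i> * P (\<sigma> \<tau>) - attraction \<mu> (Q (\<sigma> \<tau>))) (at \<tau>)"
      using vector_diff_chain_at[OF \<sigma>'[OF \<tau>] P_deriv[OF i]] n0 by (simp add: o_def)
    then show "((\<lambda>\<tau>. P (\<sigma> \<tau>)) has_vector_derivative - \<i> * P (\<sigma> \<tau>) - attraction \<mu> (Q (\<sigma> \<tau>))) (at \<tau> within {0<..<t 5})"
      by (rule has_vector_derivative_at_within)
  qed
  moreover have "((\<lambda>\<tau>. Q (\<sigma> \<tau>)) \<longlongrightarrow> - of_real \<mu>) (at_right 0)"
  proof -
    have t5: "0 < t 5" using mono[of 0 5] t0 by simp
    have uc: "continuous_on {0..5} u"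
      unfolding continuous_on_eq_continuous_within by (blast intro: has_vector_derivative_continuous derivs(1))
    have "continuous_on {0..t 5} (\<lambda>\<tau>. Q (\<sigma> \<tau>))"
      unfolding Q_def using \<sigma>(1) by (intro continuous_intros continuous_on_compose2[OF uc \<sigma>c]) auto
    then have "((\<lambda>\<tau>. Q (\<sigma> \<tau>)) \<longlongrightarrow> Q (\<sigma> 0)) (at 0 within {0..t 5})" using t5 by (auto simp: continuous_on_def)
    moreover have "\<sigma> 0 = 0" using \<sigma>t[of 0] t0 by simp
    moreover have "at 0 within {0..t 5} = at_right 0" using t5 by (rule at_within_Icc_at_right)
    ultimately show ?thesis by (simp add: Q_def u_def Z0)
  qed
  ultimately show ?thesis
    using that[of "t 4" "t 5" "\<lambda>\<tau>. Q (\<sigma> \<tau>)" "\<lambda>\<tau>. P (\<sigma> \<tau>)"] mono[of 0 4] mono[of 4 5] t0 \<sigma>t[of 4] by simp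
qed

end

section \<open>Matching and reflection\<close>

text \<open>Polar data of the matching point \<open>s = 4\<close>. The angle is measured from the unperturbed one, which gives a lift that
  is continuous in \<open>\<beta>\<close>.\<close>

definition polar_r :: "real \<Rightarrow> complex \<Rightarrow> real" where
  "polar_r \<mu> u = cmod (u^2 - of_real \<mu>)"
definition polar_\<phi> :: "real \<Rightarrow> real \<Rightarrow> complex \<Rightarrow> real" where
  "polar_\<phi> \<mu> \<beta> u = phase \<beta> 4 + Im (Ln ((u^2 - of_real \<mu>) / (8 * cis (phase \<beta> 4))))"
definition polar_P :: "real \<Rightarrow> complex \<Rightarrow> complex \<Rightarrow> real" where
  "polar_P \<mu> u w = Re ((w / (2 * cnj u) - \<i> * of_real \<mu>) * cnj (u^2 - of_real \<mu>)) / polar_r \<mu> u"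
definition polar_G :: "real \<Rightarrow> complex \<Rightarrow> complex \<Rightarrow> real" where
  "polar_G \<mu> u w = Im ((w / (2 * cnj u) - \<i> * of_real \<mu>) * cnj (u^2 - of_real \<mu>))"

text \<open>At \<open>s = 4\<close> the unperturbed \<open>u\<close> and \<open>w\<close> coincide
  and have modulus \<open>2 * sqrt 2\<close>, so one centre serves for both.\<close>

locale near_parabolic =
  fixes \<mu> \<beta> :: real and u w :: complex
  assumes mu: "0 < \<mu>" "\<mu> \<le> 1/1000"
    and u: "cmod (u - of_real (2 * sqrt 2) * cis (phase \<beta> 4 / 2)) \<le> 1/100"
    and w: "cmod (w - of_real (2 * sqrt 2) * cis (phase \<beta> 4 / 2)) \<le> 1/100"
begin

abbreviation "u0 \<equiv> of_real (2 * sqrt 2) * cis (phase \<beta> 4 / 2)"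
abbreviation "q0 \<equiv> 8 * cis (phase \<beta> 4)"
abbreviation "q \<equiv> u^2 - complex_of_real \<mu>"
abbreviation "p \<equiv> w / (2 * cnj u) - \<i> * complex_of_real \<mu>"

lemma sqrt2: "141/100 \<le> sqrt 2" "sqrt 2 \<le> 142/100"
  by (rule real_le_rsqrt, simp add: power2_eq_square, rule real_le_lsqrt, auto simp: power2_eq_square)

lemma norms: "cmod u0 \<le> 284/100" "282/100 \<le> cmod u0" "cmod u \<le> 285/100" "281/100 \<le> cmod u" "cmod w \<le> 285/100"
proof -
  have *: "cmod u0 = 2 * sqrt 2" by (simp add: norm_mult)
  show 1: "cmod u0 \<le> 284/100" "282/100 \<le> cmod u0" unfolding * using sqrt2 by auto
  show "cmod u \<le> 285/100" "281/100 \<le> cmod u" "cmod w \<le> 285/100"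
    using 1 u w norm_triangle_sub[of u u0] norm_triangle_sub[of u0 u] norm_triangle_sub[of w u0]
    unfolding norm_minus_commute[of u0 u] by linarith+
qed

lemma u_nz: "u \<noteq> 0" using norms by auto

lemma u0_square: "u0^2 = q0"
  by (simp add: power_mult_distrib cis_half_square flip: of_real_power)

lemma q_close: "cmod (q - q0) \<le> 1/10"
proof -
  have "u^2 - u0^2 = (u - u0) * (u + u0)" by (simp add: power2_eq_square algebra_simps)
  moreover have "cmod (u + u0) \<le> 285/100 + 284/100"
    using norm_triangle_ineq[of u u0] norms by linarith
  ultimately have "cmod (u^2 - u0^2) \<le> 1/100 * (285/100 + 284/100)"
    using u by (simp only: norm_mult) (intro mult_mono; simp)
  moreover have "cmod (q - q0) \<le> cmod (u^2 - u0^2) + cmod (complex_of_real \<mu>)"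
    unfolding u0_square using norm_triangle_ineq4[of "u^2 - q0" "of_real \<mu>"] by (simp add: algebra_simps)
  ultimately show ?thesis using mu by simp
qed

lemma q_norm: "79/10 \<le> polar_r \<mu> u" "polar_r \<mu> u \<le> 81/10"
proof -
  have "cmod q0 = 8" by (simp add: norm_mult)
  then show "79/10 \<le> polar_r \<mu> u" "polar_r \<mu> u \<le> 81/10"
    unfolding polar_r_def using q_close norm_triangle_sub[of q q0] norm_triangle_sub[of q0 q]
    unfolding norm_minus_commute[of q0 q] by linarith+
qed

text \<open>The position lies within relative distance \<open>1/80\<close> of the unperturbed one,
  so the principal logarithm in \<open>polar_\<phi>\<close> stays off its branch cut and the angle
  is continuous.\<close>

lemma Re_quotient: "0 < Re (q / q0)"
proof -
  have e: "q / q0 - 1 = (q - q0) / q0" by (simp add: field_simps)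
  have "cmod (q / q0 - 1) \<le> 1/80" unfolding e using q_close by (simp add: norm_divide norm_mult)
  then have "\<bar>Re (q / q0 - 1)\<bar> \<le> 1/80" using abs_Re_le_cmod order_trans by blast
  moreover have "Re (q / q0 - 1) = Re (q / q0) - 1" by simp
  ultimately show ?thesis by linarith
qed

lemma q_polar: "q = of_real (polar_r \<mu> u) * cis (polar_\<phi> \<mu> \<beta> u)"
proof -
  define z where "z = q / q0"
  have nz: "z \<noteq> 0" using Re_quotient unfolding z_def by (metis less_irrefl zero_complex.sel(1))
  then have "z = of_real (cmod z) * cis (Im (Ln z))"
    using exp_eq_polar[of "Ln z"] by (simp add: Re_Ln)
  then have "q / q0 = of_real (cmod (q / q0)) * cis (Im (Ln (q / q0)))" unfolding z_def .
  also have "cmod (q / q0) = polar_r \<mu> u / 8" by (simp add: norm_divide norm_mult polar_r_def)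
  finally have e: "q / q0 = of_real (polar_r \<mu> u / 8) * cis (Im (Ln (q / q0)))" .
  have "q = q0 * (q / q0)" by simp
  also have "\<dots> = q0 * (of_real (polar_r \<mu> u / 8) * cis (Im (Ln (q / q0))))" by (rule arg_cong[OF e])
  also have "\<dots> = of_real (polar_r \<mu> u) * (cis (phase \<beta> 4) * cis (Im (Ln (q / q0))))" by simp
  finally show ?thesis unfolding cis_mult polar_\<phi>_def .
qed

lemma p_polar: "p = Complex (polar_P \<mu> u w) (polar_G \<mu> u w / polar_r \<mu> u) * cis (polar_\<phi> \<mu> \<beta> u)"
proof -
  have r: "polar_r \<mu> u \<noteq> 0" using q_norm by auto
  have "Complex (polar_P \<mu> u w) (polar_G \<mu> u w / polar_r \<mu> u) = p * cnj q / of_real (polar_r \<mu> u)"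
    unfolding complex_eq_iff polar_P_def polar_G_def by (simp only: complex.sel Re_divide_of_real Im_divide_of_real simp_thms)
  also have "\<dots> = p * cnj (cis (polar_\<phi> \<mu> \<beta> u))" 
  proof -
    have e: "p * cnj q = p * cnj (of_real (polar_r \<mu> u) * cis (polar_\<phi> \<mu> \<beta> u))"
      using q_polar by (rule arg_cong)
    show ?thesis unfolding e using r by simp
  qed
  finally have "Complex (polar_P \<mu> u w) (polar_G \<mu> u w / polar_r \<mu> u) * cis (polar_\<phi> \<mu> \<beta> u)
    = p * (cis (polar_\<phi> \<mu> \<beta> u) * cnj (cis (polar_\<phi> \<mu> \<beta> u)))" by (simp only: mult_ac)
  also have "cis (polar_\<phi> \<mu> \<beta> u) * cnj (cis (polar_\<phi> \<mu> \<beta> u)) = 1" by (simp add: complex_norm_square[symmetric])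
  finally show ?thesis by simp
qed

text \<open>The real and imaginary parts of \<open>p * cnj q\<close> give radial and angular
  momentum. Moving the origin from the Sun to the barycentre alters the product only by
  \<open>e\<close>, of order \<open>\<mu>\<close>; the main term is close to 4.\<close>

lemma moment:
  obtains e where "p * cnj q = w * cnj u / 2 + e" "cmod e \<le> 10 * \<mu>" "cmod (w * cnj u - 8) \<le> 6/100"
proof -
  define e where "e = of_real \<mu> * (- (w / (2 * cnj u)) - \<i> * (cnj u)^2 + \<i> * of_real \<mu>)"
  have 1: "p * cnj q = w * cnj u / 2 + e" unfolding e_def using u_nz
    by (simp add: field_simps power2_eq_square)
  have "cmod (w / (2 * cnj u)) \<le> 285/100 / (2 * (281/100))"
    using norms by (simp only: norm_divide norm_mult complex_mod_cnj) (intro frac_le; simp)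
  moreover have "cmod (\<i> * (cnj u)^2) \<le> (285/100)^2"
    using norms by (simp add: norm_mult norm_power power_mono)
  moreover have "cmod (\<i> * of_real \<mu>) \<le> 1/1000" using mu by (simp add: norm_mult)
  ultimately have "cmod (- (w / (2 * cnj u)) - \<i> * (cnj u)^2 + \<i> * of_real \<mu>) \<le> 10"
    using norm_triangle_ineq[of "- (w / (2 * cnj u)) - \<i> * (cnj u)^2" "\<i> * of_real \<mu>"]
      norm_triangle_ineq4[of "- (w / (2 * cnj u))" "\<i> * (cnj u)^2"]
    unfolding norm_minus_cancel by (simp only: power2_eq_square) simp
  then have 2: "cmod e \<le> 10 * \<mu>" unfolding e_def norm_mult using mu by simp
  have "u0 * cnj u0 = of_real ((cmod u0)^2)" by (simp only: complex_norm_square)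
  also have "(cmod u0)^2 = 8" by (simp add: norm_mult power_mult_distrib)
  finally have "w * cnj u - 8 = (w - u0) * cnj u + u0 * cnj (u - u0)" by (simp add: algebra_simps)
  then have "cmod (w * cnj u - 8) \<le> cmod (w - u0) * cmod u + cmod u0 * cmod (u - u0)"
    by (metis norm_triangle_ineq norm_mult complex_mod_cnj)
  also have "\<dots> \<le> 1/100 * (285/100) + 284/100 * (1/100)"
    using norms u w by (intro add_mono mult_mono) auto
  finally have "cmod (w * cnj u - 8) \<le> 6/100" by simp
  with 1 2 show ?thesis using that by blast
qed

text \<open>The unperturbed values are \<open>r = 8\<close>, \<open>P = 1/2\<close> and
  \<open>G = 0\<close>, well inside the requirements of the outgoing leg.\<close>

lemma polar_bounds:
  "4 \<le> polar_r \<mu> u" "0 < polar_P \<mu> u w" "polar_P \<mu> u w \<le> 1" "\<bar>polar_G \<mu> u w\<bar> \<le> 1/8"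
  "\<bar>polar_G \<mu> u w - Im (cnj u * w) / 2\<bar> \<le> 10 * \<mu>"
proof -
  obtain e where e: "p * cnj q = w * cnj u / 2 + e" "cmod e \<le> 10 * \<mu>" "cmod (w * cnj u - 8) \<le> 6/100"
    by (rule moment)
  show "4 \<le> polar_r \<mu> u" using q_norm by simp
  have ee: "\<bar>Re e\<bar> \<le> 10 * \<mu>" "\<bar>Im e\<bar> \<le> 10 * \<mu>"
    using e(2) abs_Re_le_cmod[of e] abs_Im_le_cmod[of e] by linarith+
  have ww: "\<bar>Re (w * cnj u) - 8\<bar> \<le> 6/100" "\<bar>Im (w * cnj u)\<bar> \<le> 6/100"
    using e(3) abs_Re_le_cmod[of "w * cnj u - 8"] abs_Im_le_cmod[of "w * cnj u - 8"] by simp_all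
  have Re: "Re (p * cnj q) = Re (w * cnj u) / 2 + Re e" and Im: "Im (p * cnj q) = Im (w * cnj u) / 2 + Im e"
    unfolding e(1) plus_complex.sel Re_divide_numeral Im_divide_numeral by (rule refl)+
  have "0 < Re (p * cnj q)" "Re (p * cnj q) \<le> 79/10" unfolding Re using ww(1) ee(1) mu by linarith+
  then show "0 < polar_P \<mu> u w" "polar_P \<mu> u w \<le> 1"
    unfolding polar_P_def using q_norm by (auto simp del: times_complex.sel simp: divide_le_eq)
  show "\<bar>polar_G \<mu> u w\<bar> \<le> 1/8" unfolding polar_G_def Im using ww(2) ee(2) mu by linarith
  have c: "Im (cnj u * w) = Im (w * cnj u)" by (simp only: mult.commute)
  show "\<bar>polar_G \<mu> u w - Im (cnj u * w) / 2\<bar> \<le> 10 * \<mu>" unfolding polar_G_def Im c using ee(2) by linarith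
qed

end

lemma continuous_on_polar:
  assumes np: "\<And>\<beta>. \<beta> \<in> A \<Longrightarrow> near_parabolic \<mu> \<beta> (u \<beta>) (w \<beta>)"
    and c: "continuous_on A u" "continuous_on A w"
  shows "continuous_on A (\<lambda>\<beta>. (polar_r \<mu> (u \<beta>), polar_\<phi> \<mu> \<beta> (u \<beta>), polar_P \<mu> (u \<beta>) (w \<beta>), polar_G \<mu> (u \<beta>) (w \<beta>)))"
proof -
  have nz: "u \<beta> \<noteq> 0" "polar_r \<mu> (u \<beta>) \<noteq> 0" if "\<beta> \<in> A" for \<beta>
    using near_parabolic.u_nz[OF np[OF that]] near_parabolic.q_norm[OF np[OF that]] by auto
  have ln: "((u \<beta>)^2 - of_real \<mu>) / (8 * cis (phase \<beta> 4)) \<notin> \<real>\<^sub>\<le>\<^sub>0" if "\<beta> \<in> A" for \<beta>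
    using near_parabolic.Re_quotient[OF np[OF that]] complex_nonpos_Reals_iff by fastforce
  have ph: "continuous_on A (\<lambda>\<beta>. phase \<beta> 4)" unfolding phase_def by (intro continuous_intros) auto
  have r: "continuous_on A (\<lambda>\<beta>. polar_r \<mu> (u \<beta>))" unfolding polar_r_def by (intro continuous_intros c)
  have pq: "continuous_on A (\<lambda>\<beta>. (w \<beta> / (2 * cnj (u \<beta>)) - \<i> * of_real \<mu>) * cnj ((u \<beta>)^2 - of_real \<mu>))"
    by (intro continuous_intros c) (use nz in auto)
  have f: "continuous_on A (\<lambda>\<beta>. polar_\<phi> \<mu> \<beta> (u \<beta>))"
    unfolding polar_\<phi>_def by (intro continuous_intros c ph ln continuous_on_cis) auto
  show ?thesis
    unfolding polar_P_def polar_G_def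
    by (intro continuous_on_Pair r f continuous_on_divide continuous_on_Re continuous_on_Im pq) (use nz in auto)
qed

section \<open>Reversal, translation and gluing of solutions\<close>

lemma attraction_cnj: "attraction \<mu> (cnj q) = cnj (attraction \<mu> q)"
proof -
  have *: "cmod (cnj q + of_real x) = cmod (q + of_real x)" for x
    using complex_mod_cnj[of "q + of_real x"] by simp
  show ?thesis unfolding attraction_def * by simp
qed

lemma csol_subset: "csol \<mu> I q p \<Longrightarrow> J \<subseteq> I \<Longrightarrow> csol \<mu> J q p"
  unfolding csol_def by (blast intro: has_vector_derivative_within_subset)

lemma csol_shift:
  assumes sol: "csol \<mu> I q p" and J: "\<And>t. t \<in> J \<Longrightarrow> t - d \<in> I"
  shows "csol \<mu> J (\<lambda>t. q (t - d)) (\<lambda>t. p (t - d))"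
proof -
  have *: "((\<lambda>t. f (t - d)) has_vector_derivative f') (at t within J)"
    if "(f has_vector_derivative f') (at (t - d) within I)" for f :: "real \<Rightarrow> complex" and f' t
  proof -
    have "((\<lambda>t. t - d) has_vector_derivative 1) (at t within J)" by (auto intro!: derivative_eq_intros)
    moreover have "(f has_vector_derivative f') (at (t - d) within (\<lambda>t. t - d) ` J)"
      by (rule has_vector_derivative_within_subset[OF that]) (use J in auto)
    ultimately show ?thesis using vector_diff_chain_within[of "\<lambda>t. t - d" 1 t J f f'] by (simp add: o_def)
  qed
  show ?thesis using sol J unfolding csol_def by (auto intro!: *)
qed

lemma csol_reverse:
  assumes sol: "csol \<mu> I q p" and J: "\<And>t. t \<in> J \<Longrightarrow> d - t \<in> I"
  shows "csol \<mu> J (\<lambda>t. cnj (q (d - t))) (\<lambda>t. - cnj (p (d - t)))"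
  unfolding csol_def
proof (intro ballI conjI)
  fix t assume t: "t \<in> J"
  have *: "((\<lambda>t. cnj (f (d - t))) has_vector_derivative - cnj f') (at t within J)"
    if "(f has_vector_derivative f') (at (d - t) within I)" for f f'
  proof -
    have "((\<lambda>t. d - t) has_vector_derivative - 1) (at t within J)" by (auto intro!: derivative_eq_intros)
    moreover have "(f has_vector_derivative f') (at (d - t) within (\<lambda>t. d - t) ` J)"
      by (rule has_vector_derivative_within_subset[OF that]) (use J in auto)
    ultimately have "((\<lambda>t. f (d - t)) has_vector_derivative - f') (at t within J)"
      using vector_diff_chain_within[of "\<lambda>t. d - t" "-1" t J f f'] by (simp add: o_def)
    from bounded_linear.has_vector_derivative[OF bounded_linear_cnj this] show ?thesis by simp
  qed
  have s: "q (d - t) + of_real \<mu> \<noteq> 0" "q (d - t) + of_real (\<mu> - 1) \<noteq> 0"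
    "(q has_vector_derivative p (d - t) - \<i> * q (d - t)) (at (d - t) within I)"
    "(p has_vector_derivative - \<i> * p (d - t) - attraction \<mu> (q (d - t))) (at (d - t) within I)"
    using sol J[OF t] by (auto simp: csol_def)
  have "cnj (q (d - t)) + of_real x = cnj (q (d - t) + of_real x)" for x by simp
  then show "cnj (q (d - t)) + of_real \<mu> \<noteq> 0" "cnj (q (d - t)) + of_real (\<mu> - 1) \<noteq> 0"
    using s(1,2) by (metis complex_cnj_zero_iff)+
  show "((\<lambda>t. cnj (q (d - t))) has_vector_derivative - cnj (p (d - t)) - \<i> * cnj (q (d - t))) (at t within J)"
    using *[OF s(3)] by simp
  show "((\<lambda>t. - cnj (p (d - t))) has_vector_derivative - \<i> * - cnj (p (d - t)) - attraction \<mu> (cnj (q (d - t)))) (at t within J)"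
    using has_vector_derivative_minus[OF *[OF s(4)]] by (simp add: attraction_cnj)
qed

lemma has_vector_derivative_glue:
  fixes f g :: "real \<Rightarrow> 'a::real_normed_vector"
  assumes f: "\<And>x. x \<in> S \<Longrightarrow> (f has_vector_derivative f' x) (at x within S)"
    and g: "\<And>x. x \<in> T \<Longrightarrow> (g has_vector_derivative g' x) (at x within T)"
    and S: "S \<subseteq> {..c}" "c \<in> S" and T: "T \<subseteq> {c..}" "c \<in> T" and eq: "f c = g c" "f' c = g' c" and x: "x \<in> S \<union> T"
  shows "((\<lambda>t. if t \<le> c then f t else g t) has_vector_derivative (if x \<le> c then f' x else g' x)) (at x within S \<union> T)"
proof -
  have cl: "closure S \<subseteq> {..c}" "closure T \<subseteq> {c..}"
    by (rule closure_minimal[OF S(1)], simp, rule closure_minimal[OF T(1)], simp)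
  then have c1: "y = c" if "y \<in> closure S" "y \<in> closure T" for y using that by force
  then have ST: "S \<union> (closure S \<inter> closure T) = S" "T \<union> (closure S \<inter> closure T) = T" using S T by auto
  have iff: "t \<in> S \<longleftrightarrow> t \<le> c" if "t \<in> S \<union> T" for t using that S T by force
  have "((\<lambda>t. if t \<in> S then f t else g t) has_vector_derivative (if x \<in> S then f' x else g' x)) (at x within S \<union> T)"
    by (rule has_vector_derivative_If_within_closures[OF x refl]) (use ST f g c1 eq in auto)
  then have "((\<lambda>t. if t \<in> S then f t else g t) has_vector_derivative (if x \<le> c then f' x else g' x)) (at x within S \<union> T)"
    by (simp add: iff[OF x])
  then show ?thesis
    by (rule has_vector_derivative_transform[OF x, rotated]) (simp add: iff)
qed

text \<open>Equal states at \<open>c\<close> suffice: the equations of motion then make the two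
  one-sided derivatives agree.\<close>

lemma csol_glue:
  assumes 1: "csol \<mu> S q1 p1" and 2: "csol \<mu> T q2 p2"
    and S: "S \<subseteq> {..c}" "c \<in> S" and T: "T \<subseteq> {c..}" "c \<in> T" and eq: "q1 c = q2 c" "p1 c = p2 c"
  shows "csol \<mu> (S \<union> T) (\<lambda>t. if t \<le> c then q1 t else q2 t) (\<lambda>t. if t \<le> c then p1 t else p2 t)"
  unfolding csol_def
proof (intro ballI conjI)
  fix x assume x: "x \<in> S \<union> T"
  then have m: "x \<le> c \<Longrightarrow> x \<in> S" "\<not> x \<le> c \<Longrightarrow> x \<in> T" using S T by force+
  show "(if x \<le> c then q1 x else q2 x) + of_real \<mu> \<noteq> 0" "(if x \<le> c then q1 x else q2 x) + of_real (\<mu> - 1) \<noteq> 0"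
    using 1 2 m by (auto simp: csol_def)
  have "((\<lambda>t. if t \<le> c then q1 t else q2 t) has_vector_derivative
    (if x \<le> c then p1 x - \<i> * q1 x else p2 x - \<i> * q2 x)) (at x within S \<union> T)"
    using 1 2 eq by (intro has_vector_derivative_glue[OF _ _ S T _ _ x]) (auto simp: csol_def)
  then show "((\<lambda>t. if t \<le> c then q1 t else q2 t) has_vector_derivative
    (if x \<le> c then p1 x else p2 x) - \<i> * (if x \<le> c then q1 x else q2 x)) (at x within S \<union> T)"
    by (auto split: if_splits)
  have "((\<lambda>t. if t \<le> c then p1 t else p2 t) has_vector_derivative
    (if x \<le> c then - \<i> * p1 x - attraction \<mu> (q1 x) else - \<i> * p2 x - attraction \<mu> (q2 x))) (at x within S \<union> T)"
    using 1 2 eq by (intro has_vector_derivative_glue[OF _ _ S T _ _ x]) (auto simp: csol_def)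
  then show "((\<lambda>t. if t \<le> c then p1 t else p2 t) has_vector_derivative
    - \<i> * (if x \<le> c then p1 x else p2 x) - attraction \<mu> (if x \<le> c then q1 x else q2 x)) (at x within S \<union> T)"
    by (auto split: if_splits)
qed

text \<open>The conditions at \<open>c\<close> describe the fixed points of the reversing map
  \<open>(q, p) \<mapsto> (cnj q, - cnj p)\<close>, so the orbit continues as its own reflected time
  reversal and its limit at 0 reappears at \<open>2 * c\<close>.\<close>

lemma symmetric_orbit:
  assumes sol: "csol \<mu> {0<..c} q p" and c: "0 < c" and lim: "(q \<longlongrightarrow> l) (at_right 0)" and l: "cnj l = l"
    and sym: "Im (q c) = 0" "Re (p c) = 0"
  obtains q' p' where "csol \<mu> {0<..<2*c} q' p'" "(q' \<longlongrightarrow> l) (at_right 0)" "(q' \<longlongrightarrow> l) (at_left (2*c))"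
    "q' c = q c" "p' c = p c"
proof -
  define q' where "q' t = (if t \<le> c then q t else cnj (q (2*c - t)))" for t
  define p' where "p' t = (if t \<le> c then p t else - cnj (p (2*c - t)))" for t
  have "csol \<mu> ({0<..c} \<union> {c..<2*c}) q' p'"
    unfolding q'_def[abs_def] p'_def[abs_def]
    by (rule csol_glue[OF sol csol_reverse[OF sol]]) (use c sym in \<open>auto simp: complex_eq_iff\<close>)
  moreover have "{0<..c} \<union> {c..<2*c} = {0<..<2*c}" using c by auto
  moreover have "(q' \<longlongrightarrow> l) (at_right 0)"
    using lim by (rule Lim_transform_within[where d = c]) (use c in \<open>auto simp: q'_def dist_real_def\<close>)
  moreover have "(q' \<longlongrightarrow> l) (at_left (2*c))"
  proof -
    have "filterlim (\<lambda>t. 2*c - t) (at_right 0) (at_left (2*c))"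
      unfolding filterlim_at
      by (auto intro!: tendsto_eq_intros simp: eventually_at_filter)
    from tendsto_cnj[OF filterlim_compose[OF lim this]] have "((\<lambda>t. cnj (q (2*c - t))) \<longlongrightarrow> l) (at_left (2*c))"
      by (simp add: l)
    then show ?thesis
      by (rule Lim_transform_within[where d = c]) (use c in \<open>auto simp: q'_def dist_real_def\<close>)
  qed
  ultimately show ?thesis using that[of q' p'] by (simp add: q'_def p'_def)
qed

section \<open>Existence of the orbits\<close>

definition to_vec :: "complex \<Rightarrow> real^2" where "to_vec z = vector [Re z, Im z]"

lemma to_vec_nth [simp]: "to_vec z $ 1 = Re z" "to_vec z $ 2 = Im z"
  by (simp_all add: to_vec_def)

lemma bounded_linear_to_vec: "bounded_linear to_vec"
  unfolding linear_conv_bounded_linear[symmetric]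
  by (rule linearI) (simp_all add: vec_eq_iff forall_2)

lemma norm_real2: "norm (x :: real^2) = sqrt ((x $ 1)^2 + (x $ 2)^2)"
  by (simp add: norm_vec_def L2_set_def sum_2)

lemma norm_to_vec: "norm (to_vec z) = cmod z"
  by (simp add: norm_real2 cmod_def)

lemma sun_planet_nth [simp]: "sun \<mu> $ 1 = - \<mu>" "sun \<mu> $ 2 = 0" "planet \<mu> $ 1 = 1 - \<mu>" "planet \<mu> $ 2 = 0"
  by (simp_all add: sun_def planet_def)

lemma hamiltonian_components:
  "hamiltonian \<mu> q p = ((p $ 1)^2 + (p $ 2)^2) / 2 - q $ 1 * p $ 2 + q $ 2 * p $ 1
     - (1 - \<mu>) / sqrt ((q $ 1 + \<mu>)^2 + (q $ 2)^2) - \<mu> / sqrt ((q $ 1 + (\<mu> - 1))^2 + (q $ 2)^2)"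
proof -
  have e: "q $ 1 - (1 - \<mu>) = q $ 1 + (\<mu> - 1)" by simp
  show ?thesis unfolding hamiltonian_def norm_real2 vector_minus_component sun_planet_nth e by simp
qed

lemma hamiltonian_to_vec: "hamiltonian \<mu> (to_vec q) (to_vec p) = cham \<mu> q p"
  by (simp add: hamiltonian_components cham_Re_Im)

lemma axis_nth: "(axis 1 1 :: real^2) $ 1 = 1" "(axis 1 1 :: real^2) $ 2 = 0"
  "(axis 2 1 :: real^2) $ 1 = 0" "(axis 2 1 :: real^2) $ 2 = 1"
  by (simp_all add: axis_def)

lemma partials_momentum:
  "partials (\<lambda>y. hamiltonian \<mu> (to_vec q) y) (to_vec p) = to_vec (p - \<i> * q)"
proof -
  have "deriv (\<lambda>s. hamiltonian \<mu> (to_vec q) (to_vec p + s *\<^sub>R axis 1 1)) 0 = Re p + Im q"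
    unfolding hamiltonian_components
    by (rule DERIV_imp_deriv) (auto simp: axis_nth intro!: derivative_eq_intros)
  moreover have "deriv (\<lambda>s. hamiltonian \<mu> (to_vec q) (to_vec p + s *\<^sub>R axis 2 1)) 0 = Im p - Re q"
    unfolding hamiltonian_components
    by (rule DERIV_imp_deriv) (auto simp: axis_nth intro!: derivative_eq_intros)
  ultimately show ?thesis by (simp add: partials_def vec_eq_iff forall_2)
qed

lemma partials_position:
  assumes "q + of_real \<mu> \<noteq> 0" "q + of_real (\<mu> - 1) \<noteq> 0"
  shows "partials (\<lambda>x. hamiltonian \<mu> x (to_vec p)) (to_vec q) = to_vec (\<i> * p + attraction \<mu> q)"
proof -
  have pos: "(Re q + \<mu>)^2 + (Im q)^2 > 0" "(Re q + (\<mu> - 1))^2 + (Im q)^2 > 0"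
    using assms by (auto simp: complex_eq_iff sum_power2_gt_zero_iff)
  have inv: "((\<lambda>s. m / sqrt (X s)) has_real_derivative - (m / sqrt (X 0) ^ 3 * Y)) (at 0)"
    if "(X has_real_derivative 2 * Y) (at 0)" "X 0 > 0" for m Y and X :: "real \<Rightarrow> real"
    using has_real_derivative_inverse_sqrt[OF that, of m] by simp
  have x: "((\<lambda>s. (Re q + s + a)^2 + (Im q)^2) has_real_derivative 2 * (Re q + a)) (at 0)"
    and y: "((\<lambda>s. (Re q + a)^2 + (Im q + s)^2) has_real_derivative 2 * Im q) (at 0)" for a
    by (auto intro!: derivative_eq_intros)
  have r1: "((\<lambda>s. ((Re p)^2 + (Im p)^2) / 2 - (Re q + s) * Im p + Im q * Re p) has_real_derivative - Im p) (at 0)"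
    and r2: "((\<lambda>s. ((Re p)^2 + (Im p)^2) / 2 - Re q * Im p + (Im q + s) * Re p) has_real_derivative Re p) (at 0)"
    by (auto intro!: derivative_eq_intros)
  have "deriv (\<lambda>s. hamiltonian \<mu> (to_vec q + s *\<^sub>R axis 1 1) (to_vec p)) 0 = Re (\<i> * p + attraction \<mu> q)"
    unfolding hamiltonian_components
    using DERIV_diff[OF DERIV_diff[OF r1 inv[OF x, of \<mu> "1 - \<mu>"]] inv[OF x, of "\<mu> - 1" \<mu>]] pos
    by (intro DERIV_imp_deriv) (auto simp: axis_nth attraction_def cmod_def elim!: DERIV_cong)
  moreover have "deriv (\<lambda>s. hamiltonian \<mu> (to_vec q + s *\<^sub>R axis 2 1) (to_vec p)) 0 = Im (\<i> * p + attraction \<mu> q)"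
    unfolding hamiltonian_components
    using DERIV_diff[OF DERIV_diff[OF r2 inv[OF y, of \<mu> "1 - \<mu>"]] inv[OF y, of "\<mu> - 1" \<mu>]] pos
    by (intro DERIV_imp_deriv) (auto simp: axis_nth attraction_def cmod_def elim!: DERIV_cong)
  ultimately show ?thesis by (simp add: partials_def vec_eq_iff forall_2)
qed

lemma orbit_on_to_vec:
  assumes sol: "csol \<mu> I q p" and I: "open I"
  shows "orbit_on \<mu> I (\<lambda>t. to_vec (q t)) (\<lambda>t. to_vec (p t))"
  unfolding orbit_on_def
proof (intro ballI conjI)
  fix t assume t: "t \<in> I"
  have at: "at t within I = at t" using t I by (rule at_within_open)
  have s: "q t + of_real \<mu> \<noteq> 0" "q t + of_real (\<mu> - 1) \<noteq> 0"
    "(q has_vector_derivative p t - \<i> * q t) (at t)"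
    "(p has_vector_derivative - \<i> * p t - attraction \<mu> (q t)) (at t)"
    using sol[unfolded csol_def, rule_format, OF t, unfolded at] by auto
  show "to_vec (q t) \<noteq> sun \<mu>" "to_vec (q t) \<noteq> planet \<mu>"
    using s(1,2) by (auto simp: vec_eq_iff forall_2 complex_eq_iff)
  note bl = bounded_linear.has_vector_derivative[OF bounded_linear_to_vec]
  show "((\<lambda>t. to_vec (q t)) has_vector_derivative
      partials (\<lambda>y. hamiltonian \<mu> (to_vec (q t)) y) (to_vec (p t))) (at t)"
    unfolding partials_momentum using bl[OF s(3)] .
  have "- to_vec (\<i> * p t + attraction \<mu> (q t)) = to_vec (- \<i> * p t - attraction \<mu> (q t))"
    by (simp add: vec_eq_iff forall_2)
  then show "((\<lambda>t. to_vec (p t)) has_vector_derivative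
      - partials (\<lambda>x. hamiltonian \<mu> x (to_vec (p t))) (to_vec (q t))) (at t)"
    unfolding partials_position[OF s(1,2)] using bl[OF s(4)] by simp
qed

lemma csol_to_ejection_collision:
  assumes sol: "csol \<mu> {0<..<b} q p" and b: "0 < b"
    and lim: "(q \<longlongrightarrow> - of_real \<mu>) (at_right 0)" "(q \<longlongrightarrow> - of_real \<mu>) (at_left b)"
  shows "ejection_collision_orbit \<mu> 0 b (\<lambda>t. to_vec (q t)) (\<lambda>t. to_vec (p t))"
proof -
  have "to_vec (- of_real \<mu>) = sun \<mu>" by (simp add: vec_eq_iff forall_2)
  then show ?thesis
    using orbit_on_to_vec[OF sol] b bounded_linear.tendsto[OF bounded_linear_to_vec lim(1)]
      bounded_linear.tendsto[OF bounded_linear_to_vec lim(2)]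
    by (simp add: ejection_collision_orbit_def)
qed

section \<open>Assembly of the orbits\<close>

definition large_ejection_collision :: "real \<Rightarrow> real \<Rightarrow> real \<Rightarrow> real \<Rightarrow> (real \<Rightarrow> complex) \<Rightarrow> (real \<Rightarrow> complex) \<Rightarrow> bool" where
  "large_ejection_collision \<mu> h B b q p \<longleftrightarrow> csol \<mu> {0<..<b} q p \<and> (q \<longlongrightarrow> - of_real \<mu>) (at_right 0) \<and> (q \<longlongrightarrow> - of_real \<mu>) (at_left b) \<and>
     (\<forall>t\<in>{0<..<b}. cham \<mu> (q t) (p t) = h) \<and> (\<exists>s. 0 < s \<and> s < b \<and> B < cmod (q s))"

lemma ejection_collision_orbits:
  obtains \<mu>0 where "0 < \<mu>0" "\<mu>0 \<le> 1/2"
    "\<And>\<mu> h B. 0 < \<mu> \<Longrightarrow> \<mu> < \<mu>0 \<Longrightarrow> \<bar>h\<bar> < \<mu> \<Longrightarrow>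
      \<exists>q p b. large_ejection_collision \<mu> h B b q p"
proof -
  obtain \<beta>1 \<beta>2 where \<beta>: "0 < \<beta>1" "\<beta>1 < \<beta>2" "\<beta>2 < 2 * pi" "kick \<beta>1 \<le> - 30" "30 \<le> kick \<beta>2"
    by (rule kick_both_signs)
  obtain \<mu>1 where \<mu>1: "0 < \<mu>1"
    "\<And>\<mu> h. 0 < \<mu> \<Longrightarrow> \<mu> < \<mu>1 \<Longrightarrow> \<bar>h\<bar> < \<mu> \<Longrightarrow> \<exists>Z. near_family \<mu> h {\<beta>1..\<beta>2} (1/100) Z"
    by (rule near_orbits[of \<beta>1 \<beta>2 "1/100"]) (use \<beta> in auto)
  \<comment> \<open>The cap \<open>1/1000\<close> is what the numerical estimates at the matching
    point require; it is also below the \<open>1/128\<close> of the outgoing leg.\<close>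
  define \<mu>0 where "\<mu>0 = min \<mu>1 (1/1000)"
  show ?thesis
  proof (rule that[of \<mu>0])
    show "0 < \<mu>0" "\<mu>0 \<le> 1/2" using \<mu>1 by (auto simp: \<mu>0_def)
    fix \<mu> h B :: real assume mu: "0 < \<mu>" "\<mu> < \<mu>0" and h: "\<bar>h\<bar> < \<mu>"
    have mu': "\<mu> < \<mu>1" "\<mu> \<le> 1/1000" using mu by (auto simp: \<mu>0_def)
    obtain Z where Zf: "near_family \<mu> h {\<beta>1..\<beta>2} (1/100) Z"
      using \<mu>1(2)[OF mu(1) mu'(1) h] by blast
    then have Zc: "continuous_on {\<beta>1..\<beta>2} (\<lambda>\<beta>. Z \<beta> 4)"
      and Z: "\<And>\<beta>. \<beta> \<in> {\<beta>1..\<beta>2} \<Longrightarrow> near_ejection \<mu> h \<beta> (1/100) (Z \<beta>)"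
      by (auto simp: near_family_def)
    have no: "near_orbit \<mu> h (phase \<beta> 0 / 2) (Z \<beta>)" if "\<beta> \<in> {\<beta>1..\<beta>2}" for \<beta>
      using Z[OF that] mu mu' unfolding near_ejection_def by unfold_locales auto
    define u where "u \<beta> = fst (Z \<beta> 4)" for \<beta>
    define w where "w \<beta> = fst (snd (Z \<beta> 4))" for \<beta>
    define \<Gamma> where "\<Gamma> \<beta> = snd (snd (snd (snd (snd (Z \<beta> 4)))))" for \<beta>
    define cc where "cc \<beta> = of_real (2 * sqrt 2) * cis (phase \<beta> 4 / 2)" for \<beta>
    have Y: "parabolic_ejection \<beta> 4 = (cc \<beta>, cc \<beta>,
       0, 0, 4 ^ 3 / 6, kick \<beta>)" for \<beta> by (simp add: parabolic_ejection_def kick_def cc_def)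
    have close: "dist (u \<beta>) (cc \<beta>) \<le> 1/100"
      "dist (w \<beta>) (cc \<beta>) \<le> 1/100" "dist (\<Gamma> \<beta>) (kick \<beta>) \<le> 1/100"
      if "\<beta> \<in> {\<beta>1..\<beta>2}" for \<beta>
    proof -
      have d: "dist (Z \<beta> 4) (parabolic_ejection \<beta> 4) \<le> 1/100" using Z[OF that] by (simp add: near_ejection_def)
      show "dist (u \<beta>) (cc \<beta>) \<le> 1/100"
        using order_trans[OF dist_fst_le d] unfolding u_def Y fst_conv .
      show "dist (w \<beta>) (cc \<beta>) \<le> 1/100"
        using order_trans[OF dist_fst_le order_trans[OF dist_snd_le d]] unfolding w_def Y fst_conv snd_conv .
      have "dist (snd (snd (snd (snd (snd (Z \<beta> 4)))))) (snd (snd (snd (snd (snd (parabolic_ejection \<beta> 4)))))) \<le> 1/100"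
        by (intro order_trans[OF dist_snd_le] d)
      then show "dist (\<Gamma> \<beta>) (kick \<beta>) \<le> 1/100" unfolding \<Gamma>_def Y snd_conv .
    qed
    have np: "near_parabolic \<mu> \<beta> (u \<beta>) (w \<beta>)" if "\<beta> \<in> {\<beta>1..\<beta>2}" for \<beta>
      using close[OF that] mu mu' by unfold_locales (auto simp: dist_norm cc_def)
    define z0 where "z0 \<beta> = (polar_r \<mu> (u \<beta>), polar_\<phi> \<mu> \<beta> (u \<beta>), polar_P \<mu> (u \<beta>) (w \<beta>), polar_G \<mu> (u \<beta>) (w \<beta>))" for \<beta>
    have z0c: "continuous_on {\<beta>1..\<beta>2} z0"
      unfolding z0_def by (intro continuous_on_polar np) (auto simp: u_def w_def intro!: continuous_intros Zc)
    \<comment> \<open>The error is \<open>10 * \<mu>\<close> from the change of origin to the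
      barycentre, plus at most \<open>\<mu>\<close> from the deviation of \<open>\<Gamma>\<close>
      from the kick.\<close>
    have G: "\<bar>polar_G \<mu> (u \<beta>) (w \<beta>) - \<mu> * kick \<beta>\<bar> \<le> 11 * \<mu>" if "\<beta> \<in> {\<beta>1..\<beta>2}" for \<beta>
    proof -
      note n = no[OF that]
      have 1: "Im (cnj (u \<beta>) * w \<beta>) / 2 = \<mu> * \<Gamma> \<beta>"
        using near_orbit.conserved(2)[OF n, of 4]
        unfolding near_orbit.u_def[OF n] near_orbit.w_def[OF n] near_orbit.\<Gamma>_def[OF n] u_def w_def \<Gamma>_def by simp
      have "\<bar>\<mu> * \<Gamma> \<beta> - \<mu> * kick \<beta>\<bar> = \<mu> * \<bar>\<Gamma> \<beta> - kick \<beta>\<bar>" using mu by (simp add: abs_mult flip: right_diff_distrib)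
      also have "\<dots> \<le> \<mu> * 1" using close(3)[OF that] mu by (intro mult_left_mono) (auto simp: dist_real_def)
      finally show ?thesis using near_parabolic.polar_bounds(5)[OF np[OF that]] unfolding 1 by linarith
    qed
    have Qu: "near_orbit.Q \<mu> (Z \<beta>) 4 = (u \<beta>)^2 - of_real \<mu>" "near_orbit.P \<mu> (Z \<beta>) 4 = w \<beta> / (2 * cnj (u \<beta>)) - \<i> * of_real \<mu>"
      if "\<beta> \<in> {\<beta>1..\<beta>2}" for \<beta>
      using near_orbit.Q_def[OF no[OF that]] near_orbit.P_def[OF no[OF that]]
        near_orbit.u_def[OF no[OF that]] near_orbit.w_def[OF no[OF that]] by (simp_all add: u_def w_def)
    have Qp: "(u \<beta>)^2 - of_real \<mu> = of_real (polar_r \<mu> (u \<beta>)) * cis (polar_\<phi> \<mu> \<beta> (u \<beta>))"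
      "w \<beta> / (2 * cnj (u \<beta>)) - \<i> * of_real \<mu> =
         Complex (polar_P \<mu> (u \<beta>) (w \<beta>)) (polar_G \<mu> (u \<beta>) (w \<beta>) / polar_r \<mu> (u \<beta>)) * cis (polar_\<phi> \<mu> \<beta> (u \<beta>))"
      if "\<beta> \<in> {\<beta>1..\<beta>2}" for \<beta>
      using near_parabolic.q_polar[OF np[OF that]] near_parabolic.p_polar[OF np[OF that]] .
    have energy: "polar_energy \<mu> (polar_r \<mu> (u \<beta>)) (polar_\<phi> \<mu> \<beta> (u \<beta>)) (polar_P \<mu> (u \<beta>) (w \<beta>)) (polar_G \<mu> (u \<beta>) (w \<beta>)) = h"
      if "\<beta> \<in> {\<beta>1..\<beta>2}" for \<beta>
      using near_orbit.cham_near[OF no[OF that], of 4] near_parabolic.polar_bounds(1)[OF np[OF that]]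
      unfolding Qu[OF that] Qp[OF that] by (simp add: cham_polar)
    have "\<exists>\<alpha>\<in>{\<beta>1..\<beta>2}. \<exists>z T. z 0 = z0 \<alpha> \<and> 0 < T \<and> far_orbit \<mu> h z \<and>
      fst (snd (snd (z T))) = 0 \<and> sin (fst (snd (z T))) = 0 \<and> B < fst (z T)"
    proof (rule exists_apocentre_on_axis[OF mu(1) _ _ z0c])
      \<comment> \<open>The budget at work: \<open>- 30 + 11 + 1 = - 18\<close>, in units of
        \<open>\<mu>\<close>.\<close>
      show "h + snd (snd (snd (z0 \<beta>1))) \<le> - 17 * \<mu>"
      proof -
        have "\<mu> * kick \<beta>1 \<le> \<mu> * (- 30)" using \<beta> mu by (intro mult_left_mono) auto
        moreover have "\<beta>1 \<in> {\<beta>1..\<beta>2}" using \<beta> by simp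
        ultimately show ?thesis using G[of \<beta>1] h mu unfolding z0_def snd_conv by linarith
      qed
      show "17 * \<mu> \<le> h + snd (snd (snd (z0 \<beta>2)))"
      proof -
        have "\<mu> * 30 \<le> \<mu> * kick \<beta>2" using \<beta> mu by (intro mult_left_mono) auto
        moreover have "\<beta>2 \<in> {\<beta>1..\<beta>2}" using \<beta> by simp
        ultimately show ?thesis using G[of \<beta>2] h mu unfolding z0_def snd_conv by linarith
      qed
    qed (use mu' \<beta> near_parabolic.polar_bounds[OF np] energy in \<open>auto simp: z0_def\<close>)
    then obtain \<beta> z T where b: "\<beta> \<in> {\<beta>1..\<beta>2}" and z: "z 0 = z0 \<beta>" "0 < T" "far_orbit \<mu> h z"
      "fst (snd (snd (z T))) = 0" "sin (fst (snd (z T))) = 0" "B < fst (z T)" by blast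
    obtain q1 p1 t1 t2 where near: "0 < t1" "t1 < t2" "csol \<mu> {0<..<t2} q1 p1"
      "q1 t1 = near_orbit.Q \<mu> (Z \<beta>) 4" "p1 t1 = near_orbit.P \<mu> (Z \<beta>) 4" "(q1 \<longlongrightarrow> - of_real \<mu>) (at_right 0)"
      using near_orbit.near_csol[OF no[OF b]] by metis
    interpret far_orbit \<mu> h z by (rule z(3))
    define q2 where "q2 t = of_real (r t) * cis (\<phi> t)" for t
    define p2 where "p2 t = Complex (P t) (G t / r t) * cis (\<phi> t)" for t
    have PT: "P T = 0" using z(4) by (simp add: P_def)
    have far: "csol \<mu> {0..T} q2 p2"
      unfolding q2_def[abs_def] p2_def[abs_def]
      using polar_to_csol[OF polar_sol_outgoing[of T]] z(2) PT mu mu' by simp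
    have match: "q1 t1 = q2 0" "p1 t1 = p2 0"
      unfolding near(4,5) Qu[OF b] Qp[OF b] by (simp_all add: q2_def p2_def r_def \<phi>_def P_def G_def z(1) z0_def)
    \<comment> \<open>The moment of the apocentre, which is half of the lifetime of the
      orbit.\<close>
    define c where "c = t1 + T"
    define q where "q t = (if t \<le> t1 then q1 t else q2 (t - t1))" for t
    define p where "p t = (if t \<le> t1 then p1 t else p2 (t - t1))" for t
    have "csol \<mu> ({0<..t1} \<union> {t1..c}) q p"
      unfolding q_def[abs_def] p_def[abs_def]
    proof (rule csol_glue)
      show "csol \<mu> {0<..t1} q1 p1" by (rule csol_subset[OF near(3)]) (use near in auto)
      show "csol \<mu> {t1..c} (\<lambda>t. q2 (t - t1)) (\<lambda>t. p2 (t - t1))"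
        by (rule csol_shift[OF far]) (auto simp: c_def)
    qed (use near z match in \<open>auto simp: c_def\<close>)
    moreover have "{0<..t1} \<union> {t1..c} = {0<..c}" using near z by (auto simp: c_def)
    ultimately have sol: "csol \<mu> {0<..c} q p" by simp
    have lim: "(q \<longlongrightarrow> - of_real \<mu>) (at_right 0)"
      using near(6) by (rule Lim_transform_within[where d = t1]) (use near in \<open>auto simp: q_def dist_real_def\<close>)
    have qc: "q c = q2 T" "p c = p2 T" using z(2) by (auto simp: q_def p_def c_def)
    have sin: "sin (\<phi> T) = 0" using z(5) by (simp add: \<phi>_def)
    obtain q' p' where full: "csol \<mu> {0<..<2*c} q' p'" "(q' \<longlongrightarrow> - of_real \<mu>) (at_right 0)"
      "(q' \<longlongrightarrow> - of_real \<mu>) (at_left (2*c))" "q' c = q c" "p' c = p c"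
    proof (rule symmetric_orbit[OF sol _ lim])
      show "0 < c" using near z by (simp add: c_def)
      show "Im (q c) = 0" "Re (p c) = 0" unfolding qc q2_def p2_def by (simp_all add: sin PT)
    qed auto
    have c: "0 < c" using near z by (simp add: c_def)
    have rT: "0 < r T" "B < r T" using outgoing(1)[of T T] z PT by (auto simp: r_def)
    have "cham \<mu> (q' t) (p' t) = h" if "t \<in> {0<..<2*c}" for t
    proof -
      \<comment> \<open>One energy computation at the apocentre settles the level of both
        halves.\<close>
      have "cham \<mu> (q' t) (p' t) = cham \<mu> (q' c) (p' c)"
        by (rule cham_constant[OF full(1) _ that]) (use c in auto)
      also have "\<dots> = h"
        unfolding full(4,5) qc q2_def p2_def using cham_polar[OF rT(1)] energy[of T] z PT by simp
      finally show ?thesis .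
    qed
    moreover have "cmod (q' c) = r T" unfolding full(4) qc q2_def using rT by (simp add: norm_mult)
    ultimately show "\<exists>q p b. large_ejection_collision \<mu> h B b q p"
      unfolding large_ejection_collision_def
      using full(1-3) c rT by (intro exI[of _ q'] exI[of _ p'] exI[of _ "2*c"] exI[of _ c] conjI) auto
  qed
qed

theorem theorem1p7:
  "\<exists>\<eta> \<mu>0 :: real. 0 < \<eta> \<and> 0 < \<mu>0 \<and> \<mu>0 \<le> 1/2 \<and>
     (\<forall>\<mu> h :: real. 0 < \<mu> \<and> \<mu> < \<mu>0 \<and> - \<eta> * \<mu> < h \<and> h < \<eta> * \<mu> \<longrightarrow>
       (\<exists>(q :: nat \<Rightarrow> real \<Rightarrow> real^2) (p :: nat \<Rightarrow> real \<Rightarrow> real^2)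
          (t0 :: nat \<Rightarrow> real) (t1 :: nat \<Rightarrow> real).
          (\<forall>k. ejection_collision_orbit \<mu> (t0 k) (t1 k) (q k) (p k) \<and>
               (\<forall>t\<in>{t0 k<..<t1 k}. hamiltonian \<mu> (q k t) (p k t) = h)) \<and>
          limsup (\<lambda>k. SUP t\<in>{t0 k<..<t1 k}. ereal (norm (q k t))) = \<infinity>))"
proof -
  obtain \<mu>0 where \<mu>0: "0 < \<mu>0" "\<mu>0 \<le> 1/2"
    "\<And>\<mu> h B. 0 < \<mu> \<Longrightarrow> \<mu> < \<mu>0 \<Longrightarrow> \<bar>h\<bar> < \<mu> \<Longrightarrow>
      \<exists>q p b. large_ejection_collision \<mu> h B b q p"
    by (rule ejection_collision_orbits) blast
  show ?thesis
  \<comment> \<open>The size of the kicks was fixed with \<open>\<bar>h\<bar> < \<mu>\<close> in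
    view, hence \<open>\<eta> = 1\<close>.\<close>
  proof (rule exI[of _ 1], rule exI[of _ \<mu>0], intro conjI allI impI)
    fix \<mu> h :: real assume "0 < \<mu> \<and> \<mu> < \<mu>0 \<and> - 1 * \<mu> < h \<and> h < 1 * \<mu>"
    then have mu: "0 < \<mu>" "\<mu> < \<mu>0" "\<bar>h\<bar> < \<mu>" by auto
    \<comment> \<open>The \<open>k\<close>-th orbit is one that goes beyond distance
      \<open>k\<close>.\<close>
    have "\<forall>k :: nat. \<exists>q p b. large_ejection_collision \<mu> h (real k) b q p" using \<mu>0(3)[OF mu] by blast
    then obtain q p b where qpb: "\<And>k :: nat. large_ejection_collision \<mu> h (real k) (b k) (q k) (p k)" by metis
    then have "\<forall>k. \<exists>s. 0 < s \<and> s < b k \<and> real k < cmod (q k s)" unfolding large_ejection_collision_def by blast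
    then obtain s where s: "\<And>k. 0 < s k" "\<And>k. s k < b k" "\<And>k. real k < cmod (q k (s k))" by metis
    let ?f = "\<lambda>k. SUP t\<in>{0<..<b k}. ereal (norm (to_vec (q k t)))"
    have "ereal (real k) \<le> ?f k" for k
    proof -
      have "ereal (real k) \<le> ereal (norm (to_vec (q k (s k))))" using s(3)[of k] by (simp add: norm_to_vec)
      also have "\<dots> \<le> ?f k" by (rule SUP_upper) (use s in auto)
      finally show ?thesis .
    qed
    then have "limsup (\<lambda>k. ereal (real k)) \<le> limsup ?f" by (intro Limsup_mono) auto
    moreover have "limsup (\<lambda>k. ereal (real k)) = \<infinity>"
      by (rule lim_imp_Limsup[OF _ id_nat_ereal_tendsto_PInf]) simp
    ultimately have sup: "limsup ?f = \<infinity>" by simp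
    have "ejection_collision_orbit \<mu> 0 (b k) (\<lambda>t. to_vec (q k t)) (\<lambda>t. to_vec (p k t)) \<and>
        (\<forall>t\<in>{0<..<b k}. hamiltonian \<mu> (to_vec (q k t)) (to_vec (p k t)) = h)" for k
      using qpb[of k] less_trans[OF s(1,2)] unfolding large_ejection_collision_def hamiltonian_to_vec
      by (blast intro: csol_to_ejection_collision)
    then show "\<exists>(q :: nat \<Rightarrow> real \<Rightarrow> real^2) (p :: nat \<Rightarrow> real \<Rightarrow> real^2)
          (t0 :: nat \<Rightarrow> real) (t1 :: nat \<Rightarrow> real).
          (\<forall>k. ejection_collision_orbit \<mu> (t0 k) (t1 k) (q k) (p k) \<and>
               (\<forall>t\<in>{t0 k<..<t1 k}. hamiltonian \<mu> (q k t) (p k t) = h)) \<and>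
          limsup (\<lambda>k. SUP t\<in>{t0 k<..<t1 k}. ereal (norm (q k t))) = \<infinity>"
      using sup
      by (intro exI[of _ "\<lambda>k t. to_vec (q k t)"] exI[of _ "\<lambda>k t. to_vec (p k t)"] exI[of _ "\<lambda>k. 0"] exI[of _ b]) simp
  qed (use \<mu>0 in auto)
qed

end
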